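(* For every $\phi\in Z^0(\Omega)$, $|z|^{1/2}\partial_z\phi\in L^2((-1,1);H^{1/2}(x_0,x_1))$ and $\big\||z|^{1/2}\partial_z\phi\big\|_{L^2_z(H^{1/2}_x)}\le C\|\phi\|_{Z^0}$ with $C$ depending only on $x_0,x_1$.
   Context: Fix $x_0<x_1$, $\Omega=(x_0,x_1)\times(-1,1)$ with coordinates $(x,z)$. $Z^0(\Omega)$ is the space of $\phi$ with $\phi,\partial_z\phi,\partial_{zz}\phi,z\partial_x\phi\in L^2(\Omega)$, normed by $\|z\partial_x\phi\|_{L^2}+\|\partial_{zz}\phi\|_{L^2}+\|\partial_z\phi\|_{L^2}+\|\phi\|_{L^2}$. *)

theory Defs
  imports "HOL-Analysis.Analysis"
begin

definition Omega :: "real \<Rightarrow> real \<Rightarrow> (real \<times> real) set" where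
  "Omega x0 x1 = {x0<..<x1} \<times> {-1<..<1}"

definition pd :: "bool \<Rightarrow> (real \<times> real \<Rightarrow> real) \<Rightarrow> real \<times> real \<Rightarrow> real" where
  "pd dir f = (\<lambda>(x, z). if dir then deriv (\<lambda>t. f (t, z)) x else deriv (\<lambda>t. f (x, t)) z)"

definition iter_pd :: "bool list \<Rightarrow> (real \<times> real \<Rightarrow> real) \<Rightarrow> real \<times> real \<Rightarrow> real" where
  "iter_pd ds f = foldr pd ds f"

definition smooth :: "(real \<times> real \<Rightarrow> real) \<Rightarrow> bool" where
  "smooth f \<longleftrightarrow> (\<forall>ds. continuous_on UNIV (iter_pd ds f) \<and> (\<forall>p. iter_pd ds f differentiable (at p)))"

definition test_fun :: "(real \<times> real) set \<Rightarrow> (real \<times> real \<Rightarrow> real) \<Rightarrow> bool" where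
  "test_fun U \<psi> \<longleftrightarrow> smooth \<psi> \<and> (\<exists>K. compact K \<and> K \<subseteq> U \<and> (\<forall>p. p \<notin> K \<longrightarrow> \<psi> p = 0))"

definition L2 :: "(real \<times> real) set \<Rightarrow> (real \<times> real \<Rightarrow> real) \<Rightarrow> bool" where
  "L2 U f \<longleftrightarrow> set_borel_measurable lborel U f \<and> set_integrable lborel U (\<lambda>p. (f p)\<^sup>2)"

definition L2norm :: "(real \<times> real) set \<Rightarrow> (real \<times> real \<Rightarrow> real) \<Rightarrow> real" where
  "L2norm U f = sqrt (LINT p:U|lborel. (f p)\<^sup>2)"

definition weak_dz :: "(real \<times> real) set \<Rightarrow> (real \<times> real \<Rightarrow> real) \<Rightarrow> (real \<times> real \<Rightarrow> real) \<Rightarrow> bool" where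
  "weak_dz U \<phi> g \<longleftrightarrow> (\<forall>\<psi>. test_fun U \<psi> \<longrightarrow>
      (LINT p:U|lborel. \<phi> p * pd False \<psi> p) = - (LINT p:U|lborel. g p * \<psi> p))"

definition weak_dzz :: "(real \<times> real) set \<Rightarrow> (real \<times> real \<Rightarrow> real) \<Rightarrow> (real \<times> real \<Rightarrow> real) \<Rightarrow> bool" where
  "weak_dzz U \<phi> k \<longleftrightarrow> (\<forall>\<psi>. test_fun U \<psi> \<longrightarrow>
      (LINT p:U|lborel. \<phi> p * pd False (pd False \<psi>) p) = (LINT p:U|lborel. k p * \<psi> p))"

text \<open>h = z \<partial>_x \<phi> in the sense of distributions: <z \<partial>_x \<phi>, \<psi>> = - <\<phi>, \<partial>_x (z \<psi>)> = - <\<phi>, z \<partial>_x \<psi>>.\<close>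
definition weak_zdx :: "(real \<times> real) set \<Rightarrow> (real \<times> real \<Rightarrow> real) \<Rightarrow> (real \<times> real \<Rightarrow> real) \<Rightarrow> bool" where
  "weak_zdx U \<phi> h \<longleftrightarrow> (\<forall>\<psi>. test_fun U \<psi> \<longrightarrow>
      (LINT p:U|lborel. \<phi> p * (snd p * pd True \<psi> p)) = - (LINT p:U|lborel. h p * \<psi> p))"

text \<open>Squared H^{1/2}(a,b) norm (Sobolev--Slobodeckij): L^2 part plus Gagliardo seminorm,
  |x-y|^{1+2s} = |x-y|^2 for s = 1/2 in dimension one.\<close>
definition H12_sq :: "real \<Rightarrow> real \<Rightarrow> (real \<Rightarrow> real) \<Rightarrow> ennreal" where
  "H12_sq a b u =
     (\<integral>\<^sup>+ x\<in>{a<..<b}. ennreal ((u x)\<^sup>2) \<partial>lborel)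
   + (\<integral>\<^sup>+ x\<in>{a<..<b}. (\<integral>\<^sup>+ y\<in>{a<..<b}. ennreal ((u x - u y)\<^sup>2 / (x - y)\<^sup>2) \<partial>lborel) \<partial>lborel)"

end

theory Submission
  imports Defs
begin

text \<open>
  Expand in cosines \<open>cos (n \<omega> (x - x0))\<close>, \<open>\<omega> = \<pi> / (x1 - x0)\<close>. The \<open>n\<close>-th coefficient \<open>f(z)\<close> of \<open>\<phi>\<close> has
  the coefficients of \<open>\<partial>\<^sub>z \<phi>\<close> and \<open>\<partial>\<^sub>z\<^sub>z \<phi>\<close> as weak derivatives, and \<open>n \<omega> z f(z)\<close> is, up to sign, the \<open>n\<close>-th
  \<^emph>\<open>sine\<close> coefficient of \<open>z \<partial>\<^sub>x \<phi>\<close>; the sines vanish at the end points, so no boundary condition in \<open>x\<close> enters.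
  For each mode the one-dimensional inequality
  \<open>n \<integral> |z| |f'|\<^sup>2 \<le> C (n\<^sup>2 \<integral> z\<^sup>2 |f|\<^sup>2 + \<integral> |f''|\<^sup>2)\<close> on \<open>(-1, 1)\<close> follows from one integration by parts on each half
  interval, the boundary terms being controlled on the natural length scales \<open>n\<^bsup>-1/3\<^esup>\<close> at \<open>z = 0\<close> and
  \<open>n\<^bsup>-1/2\<^esup>\<close> at \<open>z = \<plusminus>1\<close>. Summing over \<open>n\<close>, Bessel's inequality bounds the right-hand side, while completeness of
  the cosines and Fatou's lemma bound the Gagliardo seminorm by \<open>\<Sum> n |f'\<^sub>n|\<^sup>2\<close>.
\<close>

text \<open>The half derivative and the weight |z|^(1/2) arise because, up to lower order and
  boundary terms, the integral of |z| n |f'|^2 is the pairing of n z f with f'', and both factors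
  are controlled by the \<open>Z^0\<close> norm. The two length scales r are those on which n^2 z^2
  |f|^2 and |f''|^2 balance: n^2 r^2 = r^(-4) next to z = 0, where the weight has size r^2, and n^2
  = r^(-4) next to z = 1 and z = -1, where it has size 1. On such a window the two terms together
  bound f and f' pointwise. Two obstacles shape the rest. The modes do not vanish near the boundary
  of the rectangle, so they are not admissible in the weak identities; they are multiplied by
  cutoffs whose derivatives blow up like the inverse distance to the end points, and the cutoffs are
  removed by dominated convergence. And the modes are only weakly differentiable in z, so they are
  first identified almost everywhere with iterated primitives. For the Gagliardo seminorm, cosines
  extend evenly to a period of length 2 (x1 - x0), over which differences under translation are sums
  of orthogonal sines.\<close>

text \<open>A pi-lambda argument: open intervals are an intersection-stable generator of the Borel
  sets, and the sets over which \<open>w\<close> integrates to zero are closed under complements and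
  countable disjoint unions. Both \<open>fundamental_lemma\<close> and the completeness of the
  cosines reduce to it.\<close>

lemma AE_zero_if_interval_integrals_zero:
  fixes w :: "real \<Rightarrow> real"
  assumes int: "integrable lborel w"
    and zero: "\<And>a b. a < b \<Longrightarrow> (LBINT x:{a<..<b}. w x) = 0"
  shows "AE x in lborel. w x = 0"
proof -
  have [measurable]: "w \<in> borel_measurable borel" using int by auto
  have si: "set_integrable lborel A w" if "A \<in> sets borel" for A
    using int that unfolding set_integrable_def by (intro integrable_mult_indicator) auto
  \<comment> \<open>The complement case below needs the integral over the whole line, which is a
    limit of interval integrals.\<close>
  have "(\<lambda>n. LBINT x. indicator {- real n - 1<..<real n + 1} x * w x) \<longlonglongrightarrow> (LBINT x. w x)"
  proof (rule integral_dominated_convergence[where w = "\<lambda>x. norm (w x)"])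
    show "AE x in lborel. (\<lambda>n. indicator {- real n - 1<..<real n + 1} x * w x) \<longlonglongrightarrow> w x"
    proof (rule AE_I2)
      fix x :: real
      obtain N :: nat where N: "\<bar>x\<bar> < real N" using reals_Archimedean2 by blast
      have "eventually (\<lambda>n. indicator {- real n - 1<..<real n + 1} x * w x = w x) sequentially"
        using eventually_ge_at_top[of N]
      proof eventually_elim
        case (elim n)
        have "real N \<le> real n" using elim by simp
        then have "x \<in> {- real n - 1<..<real n + 1}" using N by auto
        then show ?case by simp
      qed
      then show "(\<lambda>n. indicator {- real n - 1<..<real n + 1} x * w x) \<longlonglongrightarrow> w x"
        by (rule tendsto_eventually)
    qed
  qed (use int in \<open>auto simp: indicator_def\<close>)
  moreover have "(LBINT x. indicator {- real n - 1<..<real n + 1} x * w x) = 0" for n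
    using zero[of "- real n - 1" "real n + 1"] by (simp add: set_lebesgue_integral_def)
  ultimately have tot: "(LBINT x. w x) = 0"
    by (simp add: LIMSEQ_const_iff)
  have "(LBINT x:A. w x) = 0" if "A \<in> sets borel" for A
  proof -
    have A: "A \<in> sigma_sets UNIV (range (\<lambda>(a, b). box a b :: real set))"
      using that unfolding borel_eq_box by (simp del: box_real)
    have st: "Int_stable (range (\<lambda>(a, b). box a b :: real set))"
    proof -
      have "\<exists>a b. box c d \<inter> box c' d' = (box a b :: real set)" for c d c' d' :: real
        by (rule exI[of _ "max c c'"], rule exI[of _ "min d d'"]) auto
      then show ?thesis by (fastforce simp: Int_stable_def)
    qed
    show ?thesis
    proof (rule sigma_sets_induct_disjoint[OF st _ A], goal_cases)
      case 1 then show ?case by simp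
    next
      case (2 A)
      then obtain a b where A: "A = {a<..<b}" by (auto simp: box_real)
      show ?case
        using zero[of a b] by (cases "a < b") (auto simp: A set_lebesgue_integral_def)
    next
      case 3 then show ?case by (simp add: set_lebesgue_integral_def)
    next
      case (4 A)
      have A: "A \<in> sets borel" using 4(1) unfolding borel_eq_box by (simp del: box_real)
      have "(LBINT x:A \<union> (UNIV - A). w x) = (LBINT x:A. w x) + (LBINT x:UNIV - A. w x)"
        using A by (intro set_integral_Un si) auto
      then show ?case using 4 tot by (simp add: set_lebesgue_integral_def)
    next
      case (5 A)
      have A: "A i \<in> sets borel" for i using 5(2) unfolding borel_eq_box by (auto simp del: box_real)
      have "(LBINT x:(\<Union>i. A i). w x) = (\<Sum>i. LBINT x:A i. w x)"
        using A 5(1) by (intro lebesgue_integral_countable_add si) (auto simp: disjoint_family_on_def)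
      then show ?case using 5 by simp
    qed
  qed
  then show ?thesis
    using sigma_finite_measure.density_zero[OF sigma_finite_lborel int] by auto
qed

section \<open>Smooth functions and test functions\<close>

text \<open>The derivative is existentially quantified rather than written \<open>deriv f\<close>,
  so that closed forms can be supplied as witnesses in the inductions.\<close>

primrec C_fun :: "nat \<Rightarrow> (real \<Rightarrow> real) \<Rightarrow> bool" where
  "C_fun 0 f \<longleftrightarrow> True"
| "C_fun (Suc n) f \<longleftrightarrow> (\<exists>f'. (\<forall>x. (f has_real_derivative f' x) (at x)) \<and> C_fun n f')"

definition smooth1 :: "(real \<Rightarrow> real) \<Rightarrow> bool" where
  "smooth1 f \<longleftrightarrow> (\<forall>n. C_fun n f)"

lemma C_fun_SucD: "C_fun (Suc n) f \<Longrightarrow> C_fun n f"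
  by (induction n arbitrary: f) auto

lemma C_fun_add: "C_fun n f \<Longrightarrow> C_fun n g \<Longrightarrow> C_fun n (\<lambda>x. f x + g x)"
proof (induction n arbitrary: f g)
  case (Suc n)
  then obtain f' g' where "\<forall>x. (f has_real_derivative f' x) (at x)" "C_fun n f'"
    "\<forall>x. (g has_real_derivative g' x) (at x)" "C_fun n g'" by auto
  then show ?case
    using Suc.IH[of f' g'] by (auto intro!: exI[of _ "\<lambda>x. f' x + g' x"] derivative_eq_intros)
qed simp

lemma C_fun_mult: "C_fun n f \<Longrightarrow> C_fun n g \<Longrightarrow> C_fun n (\<lambda>x. f x * g x)"
proof (induction n arbitrary: f g)
  case (Suc n)
  then obtain f' g' where d: "\<forall>x. (f has_real_derivative f' x) (at x)" "C_fun n f'"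
    "\<forall>x. (g has_real_derivative g' x) (at x)" "C_fun n g'" by auto
  have "C_fun n (\<lambda>x. f' x * g x + f x * g' x)"
    using Suc C_fun_SucD d by (intro C_fun_add Suc.IH) auto
  then show ?case
    using d by (auto intro!: exI[of _ "\<lambda>x. f' x * g x + f x * g' x"] derivative_eq_intros)
qed simp

lemma C_fun_const: "C_fun n (\<lambda>x. c)"
  by (induction n arbitrary: c) (auto intro!: exI[of _ "\<lambda>x. 0"])

lemma C_fun_affine: "C_fun n f \<Longrightarrow> C_fun n (\<lambda>x. f (p * x + q))"
proof (induction n arbitrary: f)
  case (Suc n)
  then obtain f' where d: "\<And>x. (f has_real_derivative f' x) (at x)" "C_fun n f'" by auto
  have "((\<lambda>x. f (p * x + q)) has_real_derivative p * f' (p * x + q)) (at x)" for x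
  proof -
    have "((\<lambda>x. p * x + q) has_real_derivative p) (at x)" by (auto intro!: derivative_eq_intros)
    from DERIV_chain'[OF this d(1)] show ?thesis by (simp add: mult.commute)
  qed
  moreover have "C_fun n (\<lambda>x. p * f' (p * x + q))"
    using Suc.IH d(2) by (intro C_fun_mult C_fun_const) auto
  ultimately show ?case by (auto intro!: exI[of _ "\<lambda>x. p * f' (p * x + q)"])
qed simp

text \<open>Stated for the whole span of sine and cosine, which differentiation maps to itself, so
  that the induction closes.\<close>

lemma C_fun_trig: "C_fun n (\<lambda>x. p * sin x + q * cos x)"
proof (induction n arbitrary: p q)
  case (Suc n)
  have "((\<lambda>x. p * sin x + q * cos x) has_real_derivative (- q) * sin x + p * cos x) (at x)" for x
    by (auto intro!: derivative_eq_intros)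
  then show ?case using Suc[of "- q" p] by (auto simp del: mult_minus_left minus_add_distrib intro!: exI[of _ "\<lambda>x. (- q) * sin x + p * cos x"])
qed simp

lemma smooth1_add: "smooth1 f \<Longrightarrow> smooth1 g \<Longrightarrow> smooth1 (\<lambda>x. f x + g x)"
  and smooth1_mult: "smooth1 f \<Longrightarrow> smooth1 g \<Longrightarrow> smooth1 (\<lambda>x. f x * g x)"
  and smooth1_const: "smooth1 (\<lambda>x. c)"
  and smooth1_affine: "smooth1 f \<Longrightarrow> smooth1 (\<lambda>x. f (p * x + q))"
  and smooth1_sin: "smooth1 sin"
  and smooth1_cos: "smooth1 cos"
  using C_fun_trig[of _ 1 0] C_fun_trig[of _ 0 1]
  by (simp_all add: smooth1_def C_fun_add C_fun_mult C_fun_const C_fun_affine)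

lemma smooth1_deriv:
  assumes "smooth1 f"
  shows "(f has_real_derivative deriv f x) (at x)" "smooth1 (deriv f)"
proof -
  have "C_fun (Suc 0) f" using assms unfolding smooth1_def by blast
  then show D: "(f has_real_derivative deriv f x) (at x)" for x
    using DERIV_imp_deriv by (metis C_fun.simps(2))
  have "C_fun n (deriv f)" for n
  proof -
    have "C_fun (Suc n) f" using assms unfolding smooth1_def by blast
    then obtain f' where f': "\<forall>x. (f has_real_derivative f' x) (at x)" "C_fun n f'" by auto
    then have "deriv f = f'" by (auto simp: DERIV_imp_deriv)
    then show ?thesis using f' by simp
  qed
  then show "smooth1 (deriv f)" by (simp add: smooth1_def)
qed

lemma smooth1_antideriv:
  assumes "\<And>x. (f has_real_derivative f' x) (at x)" "smooth1 f'"
  shows "smooth1 f"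
  unfolding smooth1_def
proof
  fix n show "C_fun n f"
    using assms by (cases n) (auto simp: smooth1_def)
qed

lemma smooth1_continuous: "smooth1 f \<Longrightarrow> continuous_on A f"
  by (meson DERIV_continuous_on DERIV_subset smooth1_deriv(1) subset_UNIV)

text \<open>Every iterated partial derivative of a tensor product is again a tensor product of
  smooth factors, which settles all direction lists at once.\<close>

lemma smooth_product:
  assumes "smooth1 a" "smooth1 b"
  shows "smooth (\<lambda>(x, z). a x * b z)"
proof -
  have "\<exists>a' b'. smooth1 a' \<and> smooth1 b' \<and> iter_pd ds (\<lambda>(x, z). a x * b z) = (\<lambda>(x, z). a' x * b' z)" for ds
  proof (induction ds)
    case Nil then show ?case using assms by (auto simp: iter_pd_def)
  next
    case (Cons d ds)
    then obtain a' b' where ab: "smooth1 a'" "smooth1 b'"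
      "iter_pd ds (\<lambda>(x, z). a x * b z) = (\<lambda>(x, z). a' x * b' z)" by blast
    have 1: "deriv (\<lambda>t. a' t * b' z) x = deriv a' x * b' z" for x z
      using smooth1_deriv(1)[OF ab(1)] by (intro DERIV_imp_deriv DERIV_cmult_right)
    have 2: "deriv (\<lambda>t. a' x * b' t) z = a' x * deriv b' z" for x z
      using smooth1_deriv(1)[OF ab(2)] by (intro DERIV_imp_deriv DERIV_cmult)
    have *: "iter_pd (d # ds) (\<lambda>(x, z). a x * b z) = pd d (\<lambda>(x, z). a' x * b' z)"
      using ab(3) by (simp add: iter_pd_def)
    show ?case
    proof (cases d)
      case True
      then show ?thesis unfolding * pd_def using 1 ab(1,2) smooth1_deriv(2)
        by (intro exI[of _ "deriv a'"] exI[of _ b']) auto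
    next
      case False
      then show ?thesis unfolding * pd_def using 2 ab(1,2) smooth1_deriv(2)
        by (intro exI[of _ a'] exI[of _ "deriv b'"]) auto
    qed
  qed
  moreover have "(\<lambda>(x, z). a' x * b' z) differentiable (at p)" if "smooth1 a'" "smooth1 b'" for a' b' :: "real \<Rightarrow> real" and p
  proof -
    have da: "a' differentiable (at y)" "b' differentiable (at y)" for y
      using smooth1_deriv(1)[OF that(1)] smooth1_deriv(1)[OF that(2)] real_differentiable_def by blast+
    have "(\<lambda>p. a' (fst p) * b' (snd p)) differentiable (at p)"
      using da by (intro differentiable_mult differentiable_compose[of a' fst] differentiable_compose[of b' snd])
        (auto intro!: bounded_linear_imp_differentiable bounded_linear_fst bounded_linear_snd)
    then show ?thesis by (simp add: case_prod_unfold)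
  qed
  ultimately show ?thesis
    unfolding smooth_def
    by (metis differentiable_imp_continuous_on differentiable_on_def differentiable_at_withinI)
qed

lemma pd_product:
  assumes "smooth1 a" "smooth1 b"
  shows "pd True (\<lambda>(x, z). a x * b z) = (\<lambda>(x, z). deriv a x * b z)"
    and "pd False (\<lambda>(x, z). a x * b z) = (\<lambda>(x, z). a x * deriv b z)"
  using smooth1_deriv(1)[OF assms(1)] smooth1_deriv(1)[OF assms(2)]
  by (auto simp: pd_def fun_eq_iff intro!: DERIV_imp_deriv DERIV_cmult DERIV_cmult_right)

lemma test_fun_product:
  assumes "smooth1 a" "smooth1 b" "\<And>x. x \<notin> {l..r} \<Longrightarrow> a x = 0" "\<And>z. z \<notin> {c..d} \<Longrightarrow> b z = 0"
    and "x0 < l" "r < x1" "-1 < c" "d < 1"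
  shows "test_fun (Omega x0 x1) (\<lambda>(x, z). a x * b z)"
  unfolding test_fun_def
proof (intro conjI smooth_product assms exI[of _ "{l..r} \<times> {c..d}"])
  show "compact ({l..r} \<times> {c..d})" by (intro compact_Times) auto
  show "{l..r} \<times> {c..d} \<subseteq> Omega x0 x1" using assms by (auto simp: Omega_def)
  show "\<forall>p. p \<notin> {l..r} \<times> {c..d} \<longrightarrow> (case p of (x, z) \<Rightarrow> a x * b z) = 0"
    using assms(3,4) by force
qed

section \<open>A flat function and smooth cutoffs of an interval\<close>

text \<open>The classical flat function exp (-1/y) times a polynomial in 1/y. The family is closed
  under differentiation: in the variable t = 1/y the polynomial p becomes t^2 (p - p').\<close>

definition flat_poly :: "real poly \<Rightarrow> real \<Rightarrow> real" where
  "flat_poly p y = (if y > 0 then poly p (1 / y) * exp (- (1 / y)) else 0)"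

lemma poly_exp_tendsto_0: "((\<lambda>t::real. poly q t * exp (- t)) \<longlongrightarrow> 0) at_top"
proof -
  have "((\<lambda>t::real. \<Sum>i\<le>degree q. coeff q i * (t ^ i / exp t)) \<longlongrightarrow> (\<Sum>i\<le>degree q. coeff q i * 0)) at_top"
    by (intro tendsto_sum tendsto_mult tendsto_const tendsto_power_div_exp_0)
  then show ?thesis
    by (simp add: poly_altdef sum_distrib_right sum_divide_distrib exp_minus field_simps)
qed

lemma flat_poly_has_derivative:
  "(flat_poly p has_real_derivative flat_poly (monom 1 2 * (p - pderiv p)) y) (at y)"
proof -
  consider "y > 0" | "y < 0" | "y = 0" by linarith
  then show ?thesis
  proof cases
    case 1
    have "((\<lambda>y. poly p (1 / y) * exp (- (1 / y))) has_real_derivative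
        flat_poly (monom 1 2 * (p - pderiv p)) y) (at y)"
      using 1
      by (auto intro!: derivative_eq_intros DERIV_chain'[OF _ poly_DERIV]
          simp: flat_poly_def poly_monom power2_eq_square field_simps)
    then show ?thesis
      by (rule has_field_derivative_transform_within_open[where S = "{0<..}"])
        (use 1 in \<open>auto simp: flat_poly_def\<close>)
  next
    case 2
    have "((\<lambda>y. 0) has_real_derivative flat_poly (monom 1 2 * (p - pderiv p)) y) (at y)"
      using 2 by (simp add: flat_poly_def)
    then show ?thesis
      by (rule has_field_derivative_transform_within_open[where S = "{..<0}"])
        (use 2 in \<open>auto simp: flat_poly_def\<close>)
  next
    case 3
    \<comment> \<open>With t = 1/y the difference quotient at 0 from the right is t p(t) exp (-t),
      and \<open>pCons 0 p\<close> is the polynomial t p(t).\<close>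
    have "((\<lambda>y. poly (pCons 0 p) (inverse y) * exp (- inverse y)) \<longlongrightarrow> 0) (at_right 0)"
      by (rule filterlim_compose[OF poly_exp_tendsto_0 filterlim_inverse_at_top_right])
    then have R: "((\<lambda>y. flat_poly p y / y) \<longlongrightarrow> 0) (at_right 0)"
      by (rule Lim_transform_eventually)
        (auto simp: eventually_at_right_less flat_poly_def field_simps intro!: eventually_at_rightI[of 0 1])
    have L: "((\<lambda>y. flat_poly p y / y) \<longlongrightarrow> 0) (at_left 0)"
      by (rule tendsto_eventually) (auto simp: flat_poly_def intro!: eventually_at_leftI[of "-1" 0])
    have "((\<lambda>y. flat_poly p y / y) \<longlongrightarrow> 0) (at 0)"
      using L R by (simp add: filterlim_at_split)
    then show ?thesis using 3 by (simp add: has_field_derivative_iff flat_poly_def)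
  qed
qed

lemma smooth1_flat_poly: "smooth1 (flat_poly p)"
proof -
  have "C_fun n (flat_poly p)" for n
    by (induction n arbitrary: p) (auto intro: flat_poly_has_derivative)
  then show ?thesis by (simp add: smooth1_def)
qed

text \<open>\<open>flat\<close> tends to 1 at infinity without reaching it. The cutoffs built from
  it enter only through their supports, uniform bounds and pointwise limits, all of which the closed
  forms make explicit.\<close>

definition flat :: "real \<Rightarrow> real" where "flat = flat_poly 1"
definition flat' :: "real \<Rightarrow> real" where "flat' = flat_poly (monom 1 2)"

lemma flat_eq: "flat y = (if y > 0 then exp (- (1 / y)) else 0)"
  by (simp add: flat_def flat_poly_def)

lemma flat'_eq: "flat' y = (if y > 0 then exp (- (1 / y)) / y\<^sup>2 else 0)"
  by (simp add: flat'_def flat_poly_def poly_monom power_divide)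

lemma smooth1_flat: "smooth1 flat"
  by (simp add: flat_def smooth1_flat_poly)

lemma flat_has_derivative: "(flat has_real_derivative flat' y) (at y)"
  using flat_poly_has_derivative[of 1 y] by (simp add: flat_def flat'_def)

lemma flat_bounds: "0 \<le> flat y" "flat y \<le> 1"
  by (auto simp: flat_eq)

lemma flat_tendsto: "(flat \<longlongrightarrow> 1) at_top"
proof -
  have "((\<lambda>y::real. exp (- inverse y)) \<longlongrightarrow> exp (- 0)) at_top"
    by (intro tendsto_intros tendsto_inverse_0_at_top filterlim_ident)
  then have "((\<lambda>y::real. exp (- inverse y)) \<longlongrightarrow> 1) at_top" by simp
  then show ?thesis
    by (rule Lim_transform_eventually)
      (use eventually_gt_at_top[of 0] in \<open>auto elim!: eventually_mono simp: flat_eq inverse_eq_divide\<close>)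
qed

text \<open>The scale-free form of the derivative bound: for y = J (x - a) - 1 the factor y + 1 is J
  (x - a), so J \<open>flat'\<close> y is at most 2 / (x - a) for x > a, uniformly in J.\<close>

lemma flat'_weighted_bounds: "0 \<le> (y + 1) * flat' y" "(y + 1) * flat' y \<le> 2"
proof -
  show "0 \<le> (y + 1) * flat' y" by (auto simp: flat'_eq)
  show "(y + 1) * flat' y \<le> 2"
  proof (cases "y > 0")
    case True
    \<comment> \<open>In this variable the product is (t + t^2) exp (-t), which the quadratic Taylor
      bound of exp t dominates.\<close>
    define t where "t = 1 / y"
    have t: "t > 0" using True by (simp add: t_def)
    have "1 + t + t\<^sup>2 / 2 \<le> exp t" using exp_lower_Taylor_quadratic[of t] t by simp
    then have "(t + t\<^sup>2) \<le> 2 * exp t" using t by linarith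
    then have "(t + t\<^sup>2) * exp (- t) \<le> 2" using t by (simp add: exp_minus field_simps)
    moreover have "(y + 1) * flat' y = (t + t\<^sup>2) * exp (- t)"
      using True by (simp add: flat'_eq t_def power2_eq_square field_simps)
    ultimately show ?thesis by simp
  qed (simp add: flat'_eq)
qed

lemma flat'_weighted_tendsto: "((\<lambda>y. (y + 1) * flat' y) \<longlongrightarrow> 0) at_top"
proof -
  have "((\<lambda>y::real. (inverse y + (inverse y)\<^sup>2) * exp (- inverse y)) \<longlongrightarrow> (0 + 0\<^sup>2) * exp (- 0)) at_top"
    by (intro tendsto_intros tendsto_inverse_0_at_top filterlim_ident)
  then have "((\<lambda>y::real. (inverse y + (inverse y)\<^sup>2) * exp (- inverse y)) \<longlongrightarrow> 0) at_top" by simp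
  then show ?thesis
    by (rule Lim_transform_eventually)
      (rule eventually_mono[OF eventually_gt_at_top[of 0]], simp add: flat'_eq power2_eq_square field_simps)
qed

text \<open>The shift by -1 keeps the support in the compact interval from a + 1/(j+1) to b -
  1/(j+1); as the dilation factor \<open>Suc j\<close> grows, the bumps tend to the indicator of the
  open interval.\<close>

definition cutoff :: "real \<Rightarrow> real \<Rightarrow> nat \<Rightarrow> real \<Rightarrow> real" where
  "cutoff a b j x = flat (real (Suc j) * (x - a) - 1) * flat (real (Suc j) * (b - x) - 1)"

lemma smooth1_cutoff: "smooth1 (cutoff a b j)"
proof -
  have "cutoff a b j = (\<lambda>x. flat (real (Suc j) * x + (- real (Suc j) * a - 1)) *
      flat ((- real (Suc j)) * x + (real (Suc j) * b - 1)))"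
    by (auto simp: cutoff_def fun_eq_iff algebra_simps)
  then show ?thesis by (auto intro!: smooth1_mult smooth1_affine smooth1_flat)
qed

lemma cutoff_bounds: "0 \<le> cutoff a b j x" "cutoff a b j x \<le> 1"
  using flat_bounds by (auto simp: cutoff_def intro: mult_le_one)

lemma cutoff_eq_0: "x \<notin> {a + 1 / real (Suc j)..b - 1 / real (Suc j)} \<Longrightarrow> cutoff a b j x = 0"
proof -
  define J where "J = real (Suc j)"
  have J: "J > 0" by (simp add: J_def)
  assume "x \<notin> {a + 1 / real (Suc j)..b - 1 / real (Suc j)}"
  then consider "x - a < 1 / J" | "b - x < 1 / J" unfolding J_def[symmetric] by fastforce
  then show ?thesis
  proof cases
    case 1
    then have "J * (x - a) - 1 \<le> 0" using J by (simp add: pos_less_divide_eq mult.commute)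
    then show ?thesis by (simp add: cutoff_def flat_eq J_def[symmetric] del: of_nat_Suc)
  next
    case 2
    then have "J * (b - x) - 1 \<le> 0" using J by (simp add: pos_less_divide_eq mult.commute)
    then show ?thesis by (simp add: cutoff_def flat_eq J_def[symmetric] del: of_nat_Suc)
  qed
qed

lemma cutoff_outside:
  assumes "x \<notin> {a<..<b}"
  shows "cutoff a b j x = 0"
proof (rule cutoff_eq_0)
  have "1 / real (Suc j) > 0" by simp
  then show "x \<notin> {a + 1 / real (Suc j)..b - 1 / real (Suc j)}"
    using assms by (smt (verit) atLeastAtMost_iff greaterThanLessThan_iff)
qed

lemma affine_Suc_at_top: "0 < c \<Longrightarrow> filterlim (\<lambda>j. real (Suc j) * c - 1) at_top sequentially"
proof -
  assume c: "0 < c"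
  have "filterlim (\<lambda>j. c * real (Suc j)) at_top sequentially"
    by (rule filterlim_tendsto_pos_mult_at_top[OF tendsto_const c])
      (rule filterlim_compose[OF filterlim_real_sequentially filterlim_Suc])
  then have "filterlim (\<lambda>j. (-1) + c * real (Suc j)) at_top sequentially"
    by (rule filterlim_tendsto_add_at_top[OF tendsto_const])
  then show ?thesis by (simp add: mult.commute add.commute)
qed

lemma cutoff_tendsto: "(\<lambda>j. cutoff a b j x) \<longlonglongrightarrow> indicator {a<..<b} x"
proof (cases "x \<in> {a<..<b}")
  case True
  have "(\<lambda>j. cutoff a b j x) \<longlonglongrightarrow> 1 * 1"
    unfolding cutoff_def using True
    by (intro tendsto_mult filterlim_compose[OF flat_tendsto] affine_Suc_at_top) auto
  then show ?thesis using True by simp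
next
  case False
  then have "cutoff a b j x = 0" for j by (rule cutoff_outside)
  then show ?thesis using False by simp
qed

lemma cutoff_has_derivative:
  "(cutoff a b j has_real_derivative
     real (Suc j) * flat' (real (Suc j) * (x - a) - 1) * flat (real (Suc j) * (b - x) - 1)
   - real (Suc j) * flat' (real (Suc j) * (b - x) - 1) * flat (real (Suc j) * (x - a) - 1)) (at x)"
proof -
  have *: "((\<lambda>x. flat (p x)) has_real_derivative flat' (p x) * d) (at x)"
    if "(p has_real_derivative d) (at x)" for p d
    by (rule DERIV_chain'[OF that flat_has_derivative])
  show ?thesis unfolding cutoff_def[abs_def]
    by (rule DERIV_cong, rule DERIV_mult[OF * *]) (auto intro!: derivative_eq_intros simp: algebra_simps)
qed

text \<open>Uniformly in \<open>j\<close> the derivative is of the order of the inverse distance to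
  the nearer end point, and it tends to 0 at each fixed point. Multiplied by a function vanishing
  linearly at both ends it is therefore a bounded sequence with limit 0.\<close>

lemma cutoff_deriv:
  assumes "x \<in> {a<..<b}"
  shows "\<bar>deriv (cutoff a b j) x\<bar> * (x - a) * (b - x) \<le> 2 * (b - a)"
    and "(\<lambda>j. deriv (cutoff a b j) x) \<longlonglongrightarrow> 0"
proof -
  define D where "D y = (y + 1) * flat' y" for y
  have D: "real (Suc j) * flat' (real (Suc j) * c - 1) = D (real (Suc j) * c - 1) / c" if "c > 0" for c j
    using that by (simp add: D_def)
  have eq: "deriv (cutoff a b j) x = D (real (Suc j) * (x - a) - 1) / (x - a) * flat (real (Suc j) * (b - x) - 1)
     - D (real (Suc j) * (b - x) - 1) / (b - x) * flat (real (Suc j) * (x - a) - 1)" for j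
  proof -
    have pos: "x - a > 0" "b - x > 0" using assms by auto
    show ?thesis
      using DERIV_imp_deriv[OF cutoff_has_derivative[of a b j x]] by (simp only: D[OF pos(1)] D[OF pos(2)])
  qed
  have Dlim: "(D \<longlongrightarrow> 0) at_top" unfolding D_def[abs_def] by (rule flat'_weighted_tendsto)
  have D0: "0 \<le> D y" "D y \<le> 2" for y using flat'_weighted_bounds by (auto simp: D_def)
  have "(\<lambda>j. deriv (cutoff a b j) x) \<longlonglongrightarrow> 0 / (x - a) * 1 - 0 / (b - x) * 1"
    unfolding eq using assms
    by (intro tendsto_diff tendsto_mult tendsto_divide tendsto_const
        filterlim_compose[OF flat_tendsto] filterlim_compose[OF Dlim] affine_Suc_at_top) auto
  then show "(\<lambda>j. deriv (cutoff a b j) x) \<longlonglongrightarrow> 0" by simp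
  have 1: "\<bar>D y * f\<bar> \<le> 2" if "0 \<le> f" "f \<le> 1" for y f
    using D0[of y] that mult_mono[of "D y" 2 f 1] by (simp add: abs_mult)
  define A B where "A = D (real (Suc j) * (x - a) - 1) * flat (real (Suc j) * (b - x) - 1)"
    and "B = D (real (Suc j) * (b - x) - 1) * flat (real (Suc j) * (x - a) - 1)"
  have AB: "\<bar>A\<bar> \<le> 2" "\<bar>B\<bar> \<le> 2" unfolding A_def B_def by (intro 1 flat_bounds)+
  have pos: "x - a > 0" "b - x > 0" using assms by auto
  have aux: "(A / p * f - B / q * g) * p * q = A * f * q - B * g * p" if "p \<noteq> 0" "q \<noteq> 0" for A B f g p q :: real
    using that by (simp add: field_simps)
  have "\<bar>deriv (cutoff a b j) x\<bar> * (x - a) * (b - x) = \<bar>deriv (cutoff a b j) x * (x - a) * (b - x)\<bar>"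
    using pos by (simp add: abs_mult)
  also have "deriv (cutoff a b j) x * (x - a) * (b - x) = A * (b - x) - B * (x - a)"
    unfolding eq A_def B_def using pos by (intro aux) auto
  also have "\<bar>A * (b - x) - B * (x - a)\<bar> \<le> \<bar>A\<bar> * (b - x) + \<bar>B\<bar> * (x - a)"
    using pos by (metis abs_mult abs_of_pos abs_triangle_ineq4)
  also have "\<dots> \<le> 2 * (b - x) + 2 * (x - a)" using AB pos by (intro add_mono mult_right_mono) auto
  finally show "\<bar>deriv (cutoff a b j) x\<bar> * (x - a) * (b - x) \<le> 2 * (b - a)" by simp
qed

section \<open>Weak derivatives on an interval\<close>

lemma integrable_pair_product:
  fixes f g :: "real \<Rightarrow> real"
  assumes "integrable lborel f" "integrable lborel g"
  shows "integrable (lborel \<Otimes>\<^sub>M lborel) (\<lambda>(x, y). f x * g y)"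
proof -
  have [measurable]: "f \<in> borel_measurable borel" "g \<in> borel_measurable borel" using assms by auto
  show ?thesis
  proof (rule lborel_pair.Fubini_integrable)
    show "integrable lborel (\<lambda>x. \<integral>y. norm (case (x, y) of (x, y) \<Rightarrow> f x * g y) \<partial>lborel)"
      using assms by (simp add: abs_mult)
    show "AE x in lborel. integrable lborel (\<lambda>y. case (x, y) of (x, y) \<Rightarrow> f x * g y)"
      using assms by simp
  qed simp
qed

lemma integrable_mult_bounded:
  fixes u \<eta> :: "'a \<Rightarrow> real"
  assumes "integrable M u" "\<eta> \<in> borel_measurable M" "\<And>x. \<bar>\<eta> x\<bar> \<le> K"
  shows "integrable M (\<lambda>x. u x * \<eta> x)"
proof (rule Bochner_Integration.integrable_bound[OF integrable_mult_right[OF integrable_norm[OF assms(1)], of K]])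
  have "K \<ge> 0" using assms(3) by (meson abs_ge_zero order_trans)
  then show "AE x in M. norm (u x * \<eta> x) \<le> norm (K * norm (u x))"
    using assms(3) by (auto simp: abs_mult mult.commute[of "\<bar>u _\<bar>"] intro!: mult_right_mono)
qed (use assms in auto)

text \<open>Fubini on the triangle a <= s <= z <= b. One factor is only the primitive of an
  integrable function and may fail to be differentiable on a null set, so the classical product rule
  does not apply.\<close>

lemma integration_by_parts_primitive:
  fixes v G G' :: "real \<Rightarrow> real"
  assumes ab: "a \<le> b" and v: "integrable lborel v"
    and G: "\<And>x. x \<in> {a..b} \<Longrightarrow> (G has_real_derivative G' x) (at x within {a..b})"
    and G': "continuous_on {a..b} G'"
  shows "(LBINT z:{a..b}. G' z * (LBINT s:{a..z}. v s)) =
      G b * (LBINT s:{a..b}. v s) - (LBINT s:{a..b}. v s * G s)"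
proof -
  have [measurable]: "v \<in> borel_measurable borel" using v by auto
  define H where "H z = indicator {a..b} z * G' z" for z
  have H: "integrable lborel H"
    using borel_integrable_atLeastAtMost'[OF G'] by (simp add: H_def[abs_def] set_integrable_def)
  then have [measurable]: "H \<in> borel_measurable borel" by auto
  have cG: "continuous_on {a..b} G"
    using G by (meson DERIV_continuous_on)
  define f where "f z s = (if a \<le> s \<and> s \<le> z then H z * v s else 0)" for z s
  have fm: "case_prod f = (\<lambda>p. if a \<le> snd p \<and> snd p \<le> fst p then H (fst p) * v (snd p) else 0)"
    by (auto simp: f_def)
  have "case_prod f \<in> borel_measurable (lborel \<Otimes>\<^sub>M lborel)"
    unfolding fm by measurable
  then have intf: "integrable (lborel \<Otimes>\<^sub>M lborel) (case_prod f)"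
    by (rule Bochner_Integration.integrable_bound[OF integrable_pair_product[OF H v]])
      (auto simp: f_def split_beta)
  have 1: "(LBINT s. f z s) = indicator {a..b} z * (G' z * (LBINT s:{a..z}. v s))" for z
  proof -
    have "(LBINT s. f z s) = (LBINT s. H z * (indicator {a..z} s * v s))"
      by (intro Bochner_Integration.integral_cong) (auto simp: f_def indicator_def)
    then show ?thesis by (simp add: H_def set_lebesgue_integral_def)
  qed
  \<comment> \<open>Integrating over z first leaves the increment of \<open>G\<close> from s to b,
    by the fundamental theorem of calculus.\<close>
  have 2: "(LBINT z. f z s) = indicator {a..b} s * ((G b - G s) * v s)" for s
  proof (cases "s \<in> {a..b}")
    case True
    have "(LBINT z. f z s) = (LBINT z. v s * (indicator {s..b} z *\<^sub>R G' z))"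
      using True by (intro Bochner_Integration.integral_cong) (auto simp: f_def H_def indicator_def)
    also have "\<dots> = v s * (LBINT z. indicator {s..b} z *\<^sub>R G' z)" by simp
    also have "(LBINT z. indicator {s..b} z *\<^sub>R G' z) = G b - G s"
    proof (rule integral_FTC_atLeastAtMost)
      show "s \<le> b" using True by simp
      show "continuous_on {s..b} G'" using G' True by (auto intro: continuous_on_subset)
      fix x assume x: "s \<le> x" "x \<le> b"
      show "(G has_vector_derivative G' x) (at x within {s..b})"
        using G[of x] x True
        by (intro has_real_derivative_iff_has_vector_derivative[THEN iffD1] DERIV_subset[of G _ x "{a..b}" "{s..b}"]) auto
    qed
    finally show ?thesis using True by simp
  next
    case False
    have "f z s = 0" for z using False by (auto simp: f_def H_def indicator_def)
    then show ?thesis using False by simp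
  qed
  have bound: "integrable lborel (\<lambda>s. indicator {a..b} s * (v s * G s))"
  proof -
    have "bounded (G ` {a..b})" by (intro compact_imp_bounded compact_continuous_image cG) auto
    then obtain M where "\<forall>y\<in>G ` {a..b}. norm y \<le> M" unfolding bounded_iff by blast
    then have M: "\<And>x. x \<in> {a..b} \<Longrightarrow> \<bar>G x\<bar> \<le> M" by simp
    have mG: "(\<lambda>s. indicator {a..b} s *\<^sub>R G s) \<in> borel_measurable borel"
      by (rule borel_measurable_continuous_on_indicator[OF _ cG]) simp
    have "integrable lborel (\<lambda>s. v s * (indicator {a..b} s *\<^sub>R G s))"
    proof (rule integrable_mult_bounded[OF v, of _ "max M 0"])
      show "\<bar>indicator {a..b} x *\<^sub>R G x\<bar> \<le> max M 0" for x
        using M[of x] by (cases "x \<in> {a..b}") auto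
    qed (use mG in simp)
    then show ?thesis by (simp add: mult_ac)
  qed
  have "(LBINT z:{a..b}. G' z * (LBINT s:{a..z}. v s)) = (LBINT z. LBINT s. f z s)"
    by (simp add: 1 set_lebesgue_integral_def)
  also have "\<dots> = (LBINT s. LBINT z. f z s)"
    by (rule lborel_pair.Fubini_integral[symmetric, OF intf])
  also have "\<dots> = (LBINT s. G b * (indicator {a..b} s * v s) - indicator {a..b} s * (v s * G s))"
    unfolding 2 by (intro Bochner_Integration.integral_cong) (auto simp: algebra_simps)
  also have "\<dots> = G b * (LBINT s. indicator {a..b} s * v s) - (LBINT s. indicator {a..b} s * (v s * G s))"
    using v bound integrable_real_mult_indicator[of "{a..b}" lborel v]
    by (subst Bochner_Integration.integral_diff) (auto simp: mult.commute)
  finally show ?thesis by (simp add: set_lebesgue_integral_def)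
qed

text \<open>The one-dimensional counterpart of \<open>test_fun\<close>; an empty
  \<open>{c..d}\<close> only admits the zero function.\<close>

definition test1 :: "real \<Rightarrow> real \<Rightarrow> (real \<Rightarrow> real) \<Rightarrow> bool" where
  "test1 a b \<eta> \<longleftrightarrow> smooth1 \<eta> \<and> (\<exists>c d. a < c \<and> d < b \<and> (\<forall>x. x \<notin> {c..d} \<longrightarrow> \<eta> x = 0))"

lemma test1_cutoff:
  assumes "a \<le> c" "d \<le> b"
  shows "test1 a b (cutoff c d j)"
  unfolding test1_def
proof (intro conjI exI allI impI)
  show "smooth1 (cutoff c d j)" by (rule smooth1_cutoff)
  have "1 / real (Suc j) > 0" by simp
  then show "a < c + 1 / real (Suc j)" "d - 1 / real (Suc j) < b" using assms by linarith+
qed (rule cutoff_eq_0)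

lemma test1_bounded:
  assumes "test1 a b \<eta>" obtains M where "\<And>x. \<bar>\<eta> x\<bar> \<le> M"
proof -
  obtain c d where z: "\<And>x. x \<notin> {c..d} \<Longrightarrow> \<eta> x = 0" using assms by (auto simp: test1_def)
  have "continuous_on {c..d} \<eta>" using assms by (simp add: test1_def smooth1_continuous)
  then have "bounded (\<eta> ` {c..d})" by (intro compact_imp_bounded compact_continuous_image) auto
  then obtain M where "\<forall>y\<in>\<eta> ` {c..d}. norm y \<le> M" unfolding bounded_iff by blast
  then have M: "\<And>x. x \<in> {c..d} \<Longrightarrow> \<bar>\<eta> x\<bar> \<le> M" by simp
  have "\<bar>\<eta> x\<bar> \<le> max M 0" for x using z[of x] M[of x] by (cases "x \<in> {c..d}") auto
  then show ?thesis using that by blast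
qed

lemma smooth1_measurable: "smooth1 f \<Longrightarrow> f \<in> borel_measurable borel"
  by (simp add: borel_measurable_continuous_onI smooth1_continuous)

lemma test1_integrable:
  assumes "test1 a b \<eta>" "integrable lborel u"
  shows "integrable lborel (\<lambda>x. u x * \<eta> x)"
proof -
  obtain M where "\<And>x. \<bar>\<eta> x\<bar> \<le> M" using test1_bounded[OF assms(1)] by blast
  moreover have "\<eta> \<in> borel_measurable lborel"
    using assms(1) by (simp add: test1_def smooth1_measurable)
  ultimately show ?thesis by (intro integrable_mult_bounded[OF assms(2)])
qed

text \<open>Cutoffs of a subinterval are test functions that converge boundedly to its indicator, so
  \<open>w\<close> has integral zero over every interval.\<close>

lemma fundamental_lemma:
  fixes w :: "real \<Rightarrow> real"
  assumes w: "integrable lborel w" and supp: "\<And>x. x \<notin> {a<..<b} \<Longrightarrow> w x = 0"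
    and zero: "\<And>\<eta>. test1 a b \<eta> \<Longrightarrow> (LBINT x. w x * \<eta> x) = 0"
  shows "AE x in lborel. w x = 0"
proof (rule AE_zero_if_interval_integrals_zero[OF w])
  have [measurable]: "w \<in> borel_measurable borel" using w by auto
  fix c d :: real assume "c < d"
  \<comment> \<open>Clipping to (a, b) keeps the cutoffs admissible; it loses nothing because
    \<open>w\<close> vanishes outside.\<close>
  define c' d' where "c' = max a c" and "d' = min b d"
  have "(\<lambda>j. LBINT x. w x * cutoff c' d' j x) \<longlonglongrightarrow> (LBINT x. w x * indicator {c'<..<d'} x)"
  proof (rule integral_dominated_convergence[where w = "\<lambda>x. norm (w x)"])
    show "AE x in lborel. (\<lambda>j. w x * cutoff c' d' j x) \<longlonglongrightarrow> w x * indicator {c'<..<d'} x"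
      by (intro AE_I2 tendsto_mult tendsto_const cutoff_tendsto)
    show "\<And>j. AE x in lborel. norm (w x * cutoff c' d' j x) \<le> norm (w x)"
      using cutoff_bounds by (auto simp: abs_mult intro!: mult_left_le)
    show "\<And>j. (\<lambda>x. w x * cutoff c' d' j x) \<in> borel_measurable lborel"
      using smooth1_measurable[OF smooth1_cutoff] by (intro borel_measurable_times) simp_all
  qed (use w in auto)
  moreover have "(LBINT x. w x * cutoff c' d' j x) = 0" for j
    by (intro zero test1_cutoff) (auto simp: c'_def d'_def)
  ultimately have "(LBINT x. w x * indicator {c'<..<d'} x) = 0"
    by (simp add: LIMSEQ_const_iff)
  moreover have "w x * indicator {c'<..<d'} x = indicator {c<..<d} x *\<^sub>R w x" for x
    using supp[of x] by (auto simp: c'_def d'_def indicator_def)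
  ultimately show "(LBINT x:{c<..<d}. w x) = 0"
    by (simp add: set_lebesgue_integral_def)
qed


text \<open>Dominated convergence: the indicators of the intervals from a to X n converge at every
  point except possibly the limit z itself.\<close>

lemma primitive_continuous:
  fixes v :: "real \<Rightarrow> real"
  assumes v: "integrable lborel v"
  shows "continuous_on {a..b} (\<lambda>z. LBINT s:{a..z}. v s)"
proof -
  have [measurable]: "v \<in> borel_measurable borel" using v by auto
  have "continuous_on {a..b} (\<lambda>z. LBINT s. indicator {a..z} s *\<^sub>R v s)"
    unfolding continuous_on_sequentially
  proof (intro allI ballI impI)
    fix X :: "nat \<Rightarrow> real" and z assume X: "z \<in> {a..b}" "(\<forall>n. X n \<in> {a..b}) \<and> X \<longlonglongrightarrow> z"
    show "((\<lambda>z. LBINT s. indicator {a..z} s *\<^sub>R v s) \<circ> X) \<longlonglongrightarrow> (LBINT s. indicator {a..z} s *\<^sub>R v s)"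
      unfolding comp_def
    proof (rule integral_dominated_convergence[where w = "\<lambda>x. norm (v x)"])
      show "AE s in lborel. (\<lambda>n. indicator {a..X n} s *\<^sub>R v s) \<longlonglongrightarrow> indicator {a..z} s *\<^sub>R v s"
        using AE_lborel_singleton[of z]
      proof eventually_elim
        case (elim s)
        have "eventually (\<lambda>n. indicator {a..X n} s *\<^sub>R v s = indicator {a..z} s *\<^sub>R v s) sequentially"
        proof (cases "s < z")
          case True
          then have "eventually (\<lambda>n. s < X n) sequentially" using X order_tendstoD(1) by blast
          then show ?thesis by eventually_elim (use True in \<open>auto simp: indicator_def\<close>)
        next
          case False
          then have "eventually (\<lambda>n. X n < s) sequentially" using elim X order_tendstoD(2)[of X z _ s] by auto
          then show ?thesis by eventually_elim (use False elim in \<open>auto simp: indicator_def\<close>)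
        qed
        then show ?case by (rule tendsto_eventually)
      qed
    qed (use v in \<open>auto simp: indicator_def\<close>)
  qed
  then show ?thesis by (simp add: set_lebesgue_integral_def)
qed

lemma smooth1_antideriv_exists:
  assumes "smooth1 \<theta>"
  obtains F where "\<And>x. (F has_real_derivative \<theta> x) (at x)" "smooth1 F"
proof -
  have "\<exists>F. \<forall>x::real. - \<infinity> < ereal x \<longrightarrow> ereal x < \<infinity> \<longrightarrow> (F has_vector_derivative \<theta> x) (at x)"
    using smooth1_continuous[OF assms, of UNIV]
    by (intro einterval_antiderivative) (auto simp: continuous_on_eq_continuous_at)
  then obtain F where "\<And>x. (F has_real_derivative \<theta> x) (at x)"
    by (auto simp: has_real_derivative_iff_has_vector_derivative)
  then show ?thesis using that smooth1_antideriv[OF _ assms] by blast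
qed

text \<open>The antiderivative normalised at \<open>a\<close> is constant to the right of the
  support, and that constant is the mass of \<open>\<theta>\<close>.\<close>

lemma test1_mass_zero_antideriv:
  assumes th: "test1 a b \<theta>" and z: "(LBINT x. \<theta> x) = 0" and "a < b"
  obtains \<eta> where "test1 a b \<eta>" "deriv \<eta> = \<theta>"
proof -
  obtain c d where cd: "a < c" "d < b" "\<And>x. x \<notin> {c..d} \<Longrightarrow> \<theta> x = 0" using th by (auto simp: test1_def)
  have s: "smooth1 \<theta>" using th by (simp add: test1_def)
  obtain F where F: "\<And>x. (F has_real_derivative \<theta> x) (at x)" "smooth1 F"
    using smooth1_antideriv_exists[OF s] by blast
  define \<eta> where "\<eta> x = F x + (- F a)" for x
  have D: "(\<eta> has_real_derivative \<theta> x) (at x)" for x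
    unfolding \<eta>_def[abs_def] using F(1)[of x] by (auto intro!: derivative_eq_intros)
  have ftc: "(LBINT x. \<theta> x * indicator {p..q} x) = \<eta> q - \<eta> p" if "p \<le> q" for p q
    using that D smooth1_continuous[OF s, of UNIV]
    by (intro integral_FTC_Icc_real) (auto simp: continuous_on_eq_continuous_at)
  have "\<eta> a = 0" by (simp add: \<eta>_def)
  have "\<eta> x = 0" if x: "x < c" for x
  proof -
    have "(LBINT s. \<theta> s * indicator {min x a..max x a} s) = (LINT s|(lborel :: real measure). 0)"
      using x cd(1) by (intro Bochner_Integration.integral_cong) (auto simp: indicator_def intro!: cd(3))
    then show ?thesis using ftc[of "min x a" "max x a"] \<open>\<eta> a = 0\<close> by (auto simp: min_def max_def split: if_splits)
  qed
  moreover have "\<eta> x = 0" if x: "x > d" for x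
  proof -
    have "\<theta> s * indicator {a..max x b} s = \<theta> s" for s
      using cd(1,2) cd(3)[of s] by (cases "s \<in> {a..max x b}") (auto simp: le_max_iff_disj)
    then have "(LBINT s. \<theta> s * indicator {a..max x b} s) = (LBINT s. \<theta> s)" by (simp only:)
    then have "\<eta> (max x b) - \<eta> a = (LBINT s. \<theta> s)"
      using ftc[of a "max x b"] \<open>a < b\<close> by simp
    moreover have "(LBINT s. \<theta> s * indicator {x..max x b} s) = (LINT s|(lborel :: real measure). 0)"
      using x by (intro Bochner_Integration.integral_cong) (auto simp: indicator_def intro!: cd(3))
    ultimately show ?thesis using ftc[of x "max x b"] \<open>\<eta> a = 0\<close> z by simp
  qed
  moreover have "smooth1 \<eta>" unfolding \<eta>_def[abs_def] using F(2) by (intro smooth1_add smooth1_const)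
  ultimately have "test1 a b \<eta>"
    unfolding test1_def using cd(1,2) by (metis atLeastAtMost_iff not_le)
  moreover have "deriv \<eta> = \<theta>" using D by (auto simp: DERIV_imp_deriv)
  ultimately show ?thesis using that by blast
qed

lemma test1_add_scaled:
  assumes "test1 a b f" "test1 a b g"
  shows "test1 a b (\<lambda>x. f x + k * g x)"
proof -
  obtain c d c' d' where "a < c" "d < b" "\<forall>x. x \<notin> {c..d} \<longrightarrow> f x = 0"
    "a < c'" "d' < b" "\<forall>x. x \<notin> {c'..d'} \<longrightarrow> g x = 0" using assms by (auto simp: test1_def)
  then have "a < min c c'" "max d d' < b" "\<forall>x. x \<notin> {min c c'..max d d'} \<longrightarrow> f x + k * g x = 0"
    by (simp_all add: min_le_iff_disj le_max_iff_disj)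
  moreover have "smooth1 (\<lambda>x. f x + k * g x)"
    using assms by (auto simp: test1_def intro!: smooth1_add smooth1_mult smooth1_const)
  ultimately show ?thesis unfolding test1_def by blast
qed

lemma test1_integrable': "test1 a b f \<Longrightarrow> integrable lborel f"
proof -
  assume f: "test1 a b f"
  then obtain c d where z: "\<And>x. x \<notin> {c..d} \<Longrightarrow> f x = 0" by (auto simp: test1_def)
  have "set_integrable lborel {c..d} f"
    using f by (intro borel_integrable_atLeastAtMost') (simp add: test1_def smooth1_continuous)
  moreover have "(\<lambda>x. indicator {c..d} x *\<^sub>R f x) = f" using z by (auto simp: indicator_def fun_eq_iff)
  ultimately show ?thesis by (simp add: set_integrable_def)
qed

text \<open>Integration by parts shows that \<open>u\<close> minus the primitive of \<open>v\<close>
  annihilates all test functions that are derivatives of test functions, which are those of mass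
  zero. It is therefore constant.\<close>

lemma weak_derivative_primitive:
  fixes u v :: "real \<Rightarrow> real"
  assumes ab: "a < b" and u: "integrable lborel u" and v: "integrable lborel v"
    and u0: "\<And>x. x \<notin> {a<..<b} \<Longrightarrow> u x = 0"
    and v0: "\<And>x. x \<notin> {a<..<b} \<Longrightarrow> v x = 0"
    and weak: "\<And>\<eta>. test1 a b \<eta> \<Longrightarrow> (LBINT x. u x * deriv \<eta> x) = - (LBINT x. v x * \<eta> x)"
  shows "\<exists>C. AE x in lborel. x \<in> {a<..<b} \<longrightarrow> u x = C + (LBINT s:{a..x}. v s)"
proof -
  define V where "V = (\<lambda>x. LBINT s:{a..x}. v s)"
  have cV: "continuous_on {a..b} V" unfolding V_def by (rule primitive_continuous[OF v])
  define V1 where "V1 x = indicator {a<..<b} x * V x" for x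
  have V1: "integrable lborel V1"
  proof -
    have "set_integrable lborel {a<..<b} V"
      by (rule set_integrable_subset[OF borel_integrable_atLeastAtMost'[OF cV]]) auto
    then show ?thesis by (simp add: set_integrable_def V1_def[abs_def])
  qed
  define w where "w x = u x - V1 x" for x
  have w: "integrable lborel w" using u V1 by (simp add: w_def[abs_def])
  have wd: "(LBINT x. w x * deriv \<eta> x) = 0" if t: "test1 a b \<eta>" and t': "test1 a b (deriv \<eta>)" for \<eta>
  proof -
    have s: "smooth1 \<eta>" using t by (simp add: test1_def)
    obtain c d where cd: "d < b" "\<And>x. x \<notin> {c..d} \<Longrightarrow> \<eta> x = 0" using t by (auto simp: test1_def)
    have "\<eta> b = 0" using cd by auto
    have "(LBINT z:{a..b}. deriv \<eta> z * V z) =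
      \<eta> b * (LBINT s:{a..b}. v s) - (LBINT s:{a..b}. v s * \<eta> s)"
      unfolding V_def using ab
      by (intro integration_by_parts_primitive v DERIV_subset[OF smooth1_deriv(1)[OF s]]
          smooth1_continuous[OF smooth1_deriv(2)[OF s]]) auto
    moreover have "(LBINT s:{a..b}. v s * \<eta> s) = (LBINT s. v s * \<eta> s)"
    proof -
      have "indicator {a..b} x *\<^sub>R (v x * \<eta> x) = v x * \<eta> x" for x
        using v0[of x] by (cases "x \<in> {a<..<b}") auto
      then show ?thesis unfolding set_lebesgue_integral_def by (simp only:)
    qed
    moreover have "(LBINT z:{a..b}. deriv \<eta> z * V z) = (LBINT z. V1 z * deriv \<eta> z)"
      unfolding set_lebesgue_integral_def
    proof (rule integral_cong_AE)
      show "AE x in lborel. indicator {a..b} x *\<^sub>R (deriv \<eta> x * V x) = V1 x * deriv \<eta> x"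
        using AE_lborel_singleton[of a] AE_lborel_singleton[of b]
        by eventually_elim (auto simp: V1_def indicator_def)
      have "continuous_on {a..b} (\<lambda>x. deriv \<eta> x * V x)"
        by (intro continuous_intros cV smooth1_continuous[OF smooth1_deriv(2)[OF s]])
      then show "(\<lambda>x. indicator {a..b} x *\<^sub>R (deriv \<eta> x * V x)) \<in> borel_measurable lborel"
        using borel_measurable_continuous_on_indicator[of "{a..b}" "\<lambda>x. deriv \<eta> x * V x"] by simp
      show "(\<lambda>x. V1 x * deriv \<eta> x) \<in> borel_measurable lborel"
        using test1_integrable[OF t' V1] by (rule borel_measurable_integrable)
    qed
    ultimately have "(LBINT z. V1 z * deriv \<eta> z) = - (LBINT s. v s * \<eta> s)"
      using \<open>\<eta> b = 0\<close> by simp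
    moreover have "(LBINT x. w x * deriv \<eta> x) = (LBINT x. u x * deriv \<eta> x) - (LBINT x. V1 x * deriv \<eta> x)"
      unfolding w_def using test1_integrable[OF t'] u V1
      by (subst Bochner_Integration.integral_diff[symmetric]) (auto simp: algebra_simps)
    ultimately show ?thesis using weak[OF t] by simp
  qed
  \<comment> \<open>A test function of nonzero mass exists because the masses of the cutoffs tend to
    b - a.\<close>
  obtain j where j: "(LBINT x. cutoff a b j x) > 0"
  proof -
    have "(\<lambda>j. LBINT x. cutoff a b j x) \<longlonglongrightarrow> (LBINT x. indicator {a<..<b} x)"
    proof (rule integral_dominated_convergence[where w = "\<lambda>x. indicator {a..b} x"])
      show "AE x in lborel. norm (cutoff a b j x) \<le> indicator {a..b} x" for j
      proof (rule AE_I2)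
        fix x
        show "norm (cutoff a b j x) \<le> indicator {a..b} x"
          using cutoff_bounds[of a b j x] cutoff_outside[of x a b j] by (auto simp: indicator_def)
      qed
      show "cutoff a b j \<in> borel_measurable lborel" for j
        using smooth1_measurable[OF smooth1_cutoff] by simp
      show "integrable lborel (indicat_real {a..b})"
        by (rule integrable_real_indicator) (simp_all add: emeasure_lborel_Icc_eq)
    qed (auto intro: cutoff_tendsto)
    then have "(\<lambda>j. LBINT x. cutoff a b j x) \<longlonglongrightarrow> b - a" using ab by simp
    then have "eventually (\<lambda>j. (LBINT x. cutoff a b j x) > 0) sequentially"
      using ab by (intro order_tendstoD(1)) auto
    then show ?thesis using that by (auto simp: eventually_sequentially)
  qed
  define \<rho> where "\<rho> = cutoff a b j"
  have \<rho>: "test1 a b \<rho>" "(LBINT x. \<rho> x) > 0" using j test1_cutoff[of a a b b j] by (auto simp: \<rho>_def)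
  \<comment> \<open>If \<open>w\<close> is constant on the interval, its value can only be its mean
    against \<open>\<rho>\<close>.\<close>
  define K where "K = (LBINT x. w x * \<rho> x) / (LBINT x. \<rho> x)"
  define w' where "w' x = w x - K * indicator {a<..<b} x" for x
  have w': "integrable lborel w'" using w ab by (simp add: w'_def[abs_def])
  have "AE x in lborel. w' x = 0"
  proof (rule fundamental_lemma[OF w', of a b])
    fix x assume "x \<notin> {a<..<b}" then show "w' x = 0" using u0 by (simp add: w'_def w_def V1_def)
  next
    fix \<zeta> assume t: "test1 a b \<zeta>"
    \<comment> \<open>Subtracting this multiple of \<open>\<rho>\<close> from \<open>\<zeta>\<close>
      leaves mass zero, hence a derivative of a test function.\<close>
    define c where "c = (LBINT x. \<zeta> x) / (LBINT x. \<rho> x)"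
    define \<theta> where "\<theta> x = \<zeta> x + (- c) * \<rho> x" for x
    have th: "test1 a b \<theta>" unfolding \<theta>_def[abs_def] by (rule test1_add_scaled[OF t \<rho>(1)])
    have "(LBINT x. \<theta> x) = (LBINT x. \<zeta> x) + (- c) * (LBINT x. \<rho> x)"
      unfolding \<theta>_def using test1_integrable'[OF t] test1_integrable'[OF \<rho>(1)]
      by (subst Bochner_Integration.integral_add) auto
    also have "\<dots> = 0" using \<rho>(2) by (simp add: c_def)
    finally obtain \<eta> where \<eta>: "test1 a b \<eta>" "deriv \<eta> = \<theta>"
      using test1_mass_zero_antideriv[OF th _ ab] by blast
    have "0 = (LBINT x. w x * \<theta> x)" using wd[of \<eta>] \<eta> th by simp
    also have "\<dots> = (LBINT x. w x * \<zeta> x + (- c) * (w x * \<rho> x))"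
      by (simp add: \<theta>_def algebra_simps)
    also have "\<dots> = (LBINT x. w x * \<zeta> x) + (- c) * (LBINT x. w x * \<rho> x)"
      using test1_integrable[OF t w] test1_integrable[OF \<rho>(1) w]
      by (subst Bochner_Integration.integral_add) auto
    finally have 1: "(LBINT x. w x * \<zeta> x) = K * (LBINT x. \<zeta> x)"
      by (simp add: c_def K_def)
    obtain c' d' where z: "a < c'" "d' < b" "\<And>x. x \<notin> {c'..d'} \<Longrightarrow> \<zeta> x = 0" using t by (auto simp: test1_def)
    have "w' x * \<zeta> x = w x * \<zeta> x - K * \<zeta> x" for x
      using z by (cases "x \<in> {c'..d'}") (auto simp: w'_def algebra_simps)
    then have "(LBINT x. w' x * \<zeta> x) = (LBINT x. w x * \<zeta> x) - K * (LBINT x. \<zeta> x)"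
      using test1_integrable[OF t w] test1_integrable'[OF t] by simp
    then show "(LBINT x. w' x * \<zeta> x) = 0" using 1 by simp
  qed
  then have "AE x in lborel. x \<in> {a<..<b} \<longrightarrow> u x = K + V x"
    by eventually_elim (auto simp: w'_def w_def V1_def)
  then show ?thesis unfolding V_def by (rule exI[of _ K])
qed

section \<open>The weighted interpolation inequality\<close>

lemma set_integral_nonneg':
  fixes f :: "real \<Rightarrow> real"
  assumes "\<And>x. 0 \<le> f x"
  shows "0 \<le> (LBINT x:A. f x)"
  unfolding set_lebesgue_integral_def using assms by (intro integral_nonneg_AE) auto

lemma set_integral_subset_mono:
  fixes f :: "real \<Rightarrow> real"
  assumes "set_integrable lborel B f" "A \<subseteq> B" "A \<in> sets borel" "\<And>x. 0 \<le> f x"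
  shows "(LBINT x:A. f x) \<le> (LBINT x:B. f x)"
proof -
  have "set_integrable lborel A f" using assms by (intro set_integrable_subset[OF assms(1)]) auto
  then show ?thesis
    using assms unfolding set_lebesgue_integral_def set_integrable_def
    by (intro integral_mono) (auto simp: indicator_def)
qed

lemma set_integral_split:
  fixes f :: "real \<Rightarrow> real"
  assumes "p \<le> q" "q \<le> r" "set_integrable lborel {p..r} f"
  shows "(LBINT x:{p..r}. f x) = (LBINT x:{p..q}. f x) + (LBINT x:{q..r}. f x)"
proof -
  have i: "set_integrable lborel {p..q} f" "set_integrable lborel {q..r} f"
    using assms by (auto intro: set_integrable_subset[OF assms(3)])
  have "{p..r} = {p..q} \<union> {q..r}" using assms by auto
  moreover have "AE x in lborel. \<not> (x \<in> {p..q} \<and> x \<in> {q..r})"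
    using AE_lborel_singleton[of q] by eventually_elim auto
  ultimately show ?thesis
    using i by (simp add: set_integral_Un_AE)
qed

text \<open>Obtained by expanding the nonnegative integral of ((d - c) k - m)^2, with m the integral
  of \<open>k\<close>.\<close>

lemma cauchy_schwarz_set_integral_1:
  fixes k :: "real \<Rightarrow> real"
  assumes cd: "c < d" and k: "set_integrable lborel {c..d} k" and k2: "set_integrable lborel {c..d} (\<lambda>x. (k x)\<^sup>2)"
  shows "(LBINT x:{c..d}. k x)\<^sup>2 \<le> (d - c) * (LBINT x:{c..d}. (k x)\<^sup>2)"
proof -
  define m where "m = (LBINT x:{c..d}. k x)"
  define K where "K = (LBINT x:{c..d}. (k x)\<^sup>2)"
  have 1: "set_integrable lborel {c..d} (\<lambda>x. (d - c)\<^sup>2 * (k x)\<^sup>2)" "set_integrable lborel {c..d} (\<lambda>x. 2 * (d - c) * m * k x)"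
    "set_integrable lborel {c..d} (\<lambda>x. m\<^sup>2)"
    using k k2 by (auto intro!: borel_integrable_atLeastAtMost')
  have "0 \<le> (LBINT x:{c..d}. ((d - c) * k x - m)\<^sup>2)"
    unfolding set_lebesgue_integral_def by (intro integral_nonneg_AE) auto
  also have "(\<lambda>x. ((d - c) * k x - m)\<^sup>2) = (\<lambda>x. ((d - c)\<^sup>2 * (k x)\<^sup>2 - 2 * (d - c) * m * k x) + m\<^sup>2)"
    by (auto simp: power2_eq_square algebra_simps)
  also have "(LBINT x:{c..d}. ((d - c)\<^sup>2 * (k x)\<^sup>2 - 2 * (d - c) * m * k x) + m\<^sup>2)
     = (d - c)\<^sup>2 * K - 2 * (d - c) * m * m + m\<^sup>2 * (d - c)"
    using 1 cd by (simp add: set_integral_add set_integral_diff K_def m_def set_integral_const)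
  finally have "0 \<le> (d - c) * ((d - c) * K - m\<^sup>2)"
    by (simp add: power2_eq_square algebra_simps)
  then show ?thesis
    using cd by (auto simp: m_def K_def zero_le_mult_iff)
qed

text \<open>The second derivative only exists almost everywhere, hence the hypothesis on \<open>F\<close>.\<close>

locale primitive_pair =
  fixes f F k :: "real \<Rightarrow> real"
  assumes f_deriv: "\<And>x. x \<in> {0..1} \<Longrightarrow> (f has_real_derivative F x) (at x within {0..1})"
    and F_eq: "\<And>x. x \<in> {0..1} \<Longrightarrow> F x = F 0 + (LBINT s:{0..x}. k s)"
    and k_int: "integrable lborel k" and k2_int: "integrable lborel (\<lambda>x. (k x)\<^sup>2)"
begin

lemma k_set: "A \<in> sets borel \<Longrightarrow> set_integrable lborel A k"
  and k2_set: "A \<in> sets borel \<Longrightarrow> set_integrable lborel A (\<lambda>x. (k x)\<^sup>2)"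
  unfolding set_integrable_def using k_int k2_int by (auto intro!: integrable_mult_indicator simp del: real_scaleR_def)

lemma F_cont: "continuous_on {0..1} F"
proof -
  have "continuous_on {0..1} (\<lambda>x. F 0 + (LBINT s:{0..x}. k s))"
    by (intro continuous_intros primitive_continuous k_int)
  then show ?thesis by (rule continuous_on_eq) (rule F_eq[symmetric])
qed

lemma f_cont: "continuous_on {0..1} f"
  using f_deriv by (meson DERIV_continuous_on)

lemma F_diff:
  assumes "0 \<le> x" "x \<le> y" "y \<le> 1"
  shows "F y - F x = (LBINT s:{x..y}. k s)"
  using F_eq[of x] F_eq[of y] assms set_integral_split[OF assms(1,2) k_set] by simp

text \<open>Cauchy-Schwarz for the integral of \<open>k\<close>: a Hoelder bound of exponent 1/2,
  squared.\<close>

lemma F_diff_sq: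
  assumes "0 \<le> c" "d \<le> 1" "x \<in> {c..d}" "y \<in> {c..d}"
  shows "(F y - F x)\<^sup>2 \<le> (d - c) * (LBINT s:{c..d}. (k s)\<^sup>2)"
proof -
  have *: "(F y - F x)\<^sup>2 \<le> (d - c) * (LBINT s:{c..d}. (k s)\<^sup>2)"
    if "x \<in> {c..d}" "y \<in> {c..d}" "x < y" for x y
  proof -
    have "(F y - F x)\<^sup>2 \<le> (y - x) * (LBINT s:{x..y}. (k s)\<^sup>2)"
      using F_diff[of x y] that assms by (auto intro!: cauchy_schwarz_set_integral_1 k_set k2_set)
    also have "\<dots> \<le> (d - c) * (LBINT s:{c..d}. (k s)\<^sup>2)"
    proof (rule mult_mono)
      show "(LBINT s:{x..y}. (k s)\<^sup>2) \<le> (LBINT s:{c..d}. (k s)\<^sup>2)"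
        using that by (intro set_integral_subset_mono k2_set) auto
      show "0 \<le> (LBINT s:{x..y}. (k s)\<^sup>2)"
        by (simp add: set_integral_nonneg')
    qed (use that in auto)
    finally show ?thesis .
  qed
  have "0 \<le> (d - c) * (LBINT s:{c..d}. (k s)\<^sup>2)"
    using assms by (intro mult_nonneg_nonneg) (auto simp: set_integral_nonneg')
  then show ?thesis
    using *[of x y] *[of y x] assms by (cases x y rule: linorder_cases) (auto simp: power2_commute)
qed

lemma small_value:
  assumes "0 \<le> p" "p < q" "q \<le> 1"
  obtains t where "t \<in> {p..q}" "(f t)\<^sup>2 \<le> (LBINT s:{p..q}. (f s)\<^sup>2) / (q - p)"
proof -
  have c: "continuous_on {p..q} (\<lambda>x. (f x)\<^sup>2)"
    using assms by (intro continuous_intros continuous_on_subset[OF f_cont]) auto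
  obtain t where t: "t \<in> {p..q}" "\<And>x. x \<in> {p..q} \<Longrightarrow> (f t)\<^sup>2 \<le> (f x)\<^sup>2"
    using continuous_attains_inf[OF _ _ c] assms by auto
  have "(LBINT s:{p..q}. (f t)\<^sup>2) \<le> (LBINT s:{p..q}. (f s)\<^sup>2)"
    using t c by (intro set_integral_mono borel_integrable_atLeastAtMost') auto
  then have "(f t)\<^sup>2 * (q - p) \<le> (LBINT s:{p..q}. (f s)\<^sup>2)"
    using assms by (simp add: set_integral_const mult.commute)
  then show ?thesis using that t assms by (simp add: field_simps)
qed

lemma f_mvt:
  assumes "0 \<le> p" "p < q" "q \<le> 1"
  obtains t where "t \<in> {p..q}" "f q - f p = (q - p) * F t"
proof -
  have "\<exists>t\<in>{p<..<q}. f q - f p = (\<lambda>h. h * F t) (q - p)"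
  proof (rule mvt[OF assms(2)])
    show "continuous_on {p..q} f" using assms by (intro continuous_on_subset[OF f_cont]) auto
    fix x assume x: "p < x" "x < q"
    have "(f has_real_derivative F x) (at x within {0..1})"
      using x assms by (intro f_deriv) simp
    moreover have "at x within {0..1} = at x"
      using x assms by (intro at_within_Icc_at) auto
    ultimately show "(f has_derivative (\<lambda>h. h * F x)) (at x)"
      by (simp add: has_field_derivative_def mult_commute_abs)
  qed (auto intro: bexI)
  then obtain t where "t \<in> {p<..<q}" "f q - f p = (q - p) * F t" by blast
  then show ?thesis using that[of t] by simp
qed

text \<open>The first quarter of the interval is left out of \<open>J\<close>, because for \<open>c = 0\<close> the weight degenerates there.\<close>

lemma local_bounds:
  assumes c: "0 \<le> c" and r: "0 < r" and d: "c + r \<le> 1" and s: "s \<in> {c..c + r}"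
  defines "J \<equiv> (LBINT x:{c + r / 4..c + r}. (f x)\<^sup>2)"
    and "K \<equiv> (LBINT x:{0..1}. (k x)\<^sup>2)"
  shows "(F s)\<^sup>2 \<le> 512 * J / r ^ 3 + 2 * r * K"
    and "(f s)\<^sup>2 \<le> 1032 * J / r + 4 * r ^ 3 * K"
proof -
  have f2: "set_integrable lborel {c + r / 4..c + r} (\<lambda>x. (f x)\<^sup>2)"
    using c r d by (intro borel_integrable_atLeastAtMost' continuous_intros continuous_on_subset[OF f_cont]) auto
  have J: "(LBINT x:{p..q}. (f x)\<^sup>2) \<le> J" if "{p..q} \<subseteq> {c + r / 4..c + r}" for p q
    unfolding J_def using that f2 by (intro set_integral_subset_mono) auto
  have quarter: "\<exists>t\<in>{l..l + r / 4}. (f t)\<^sup>2 \<le> J / (r / 4)" if l: "c + r / 4 \<le> l" "l + r / 4 \<le> c + r" for l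
  proof -
    obtain t where t: "t \<in> {l..l + r / 4}" and 1: "(f t)\<^sup>2 \<le> (LBINT s:{l..l + r / 4}. (f s)\<^sup>2) / (l + r / 4 - l)"
      using small_value[of l "l + r / 4"] c r d l by auto
    have "(LBINT s:{l..l + r / 4}. (f s)\<^sup>2) / (r / 4) \<le> J / (r / 4)"
      using r l by (intro divide_right_mono J) auto
    then show ?thesis using t 1 by (intro bexI[of _ t]) auto
  qed
  have quarters: "c + r / 4 + r / 4 = c + r / 2" "c + 3 * r / 4 + r / 4 = c + r" by simp_all
  \<comment> \<open>Points with small \<open>f\<close> in the second and the fourth quarter are at
    least r/4 apart. The mean value theorem between them yields a point \<open>t\<close> with small
    \<open>F\<close>, and \<open>F_diff_sq\<close> carries this bound to the whole window.\<close>
  obtain p where p: "p \<in> {c + r / 4..c + r / 2}" "(f p)\<^sup>2 \<le> J / (r / 4)"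
    using quarter[of "c + r / 4"] r unfolding quarters by auto
  obtain q where q: "q \<in> {c + 3 * r / 4..c + r}" "(f q)\<^sup>2 \<le> J / (r / 4)"
    using quarter[of "c + 3 * r / 4"] r unfolding quarters by auto
  have pq: "q - p \<ge> r / 4" using p q by auto
  obtain t where t: "t \<in> {p..q}" "f q - f p = (q - p) * F t"
    using f_mvt[of p q] p q c r d by auto
  have "(r / 4)\<^sup>2 * (F t)\<^sup>2 \<le> (q - p)\<^sup>2 * (F t)\<^sup>2"
    using pq r by (intro mult_right_mono power_mono) auto
  also have "\<dots> = (f q - f p)\<^sup>2" by (simp add: t(2) power_mult_distrib)
  also have "\<dots> \<le> 2 * (f q)\<^sup>2 + 2 * (f p)\<^sup>2"
    using zero_le_power2[of "f q + f p"] by (simp add: power2_sum power2_diff)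
  also have "\<dots> \<le> 16 * J / r" using p q r by (simp add: field_simps)
  finally have Ft: "(F t)\<^sup>2 \<le> 256 * J / r ^ 3"
    using r by (simp add: field_simps power2_eq_square power3_eq_cube)
  have K: "(LBINT s:{c..c + r}. (k s)\<^sup>2) \<le> K"
    unfolding K_def using c d by (intro set_integral_subset_mono k2_set) auto
  have Fs: "(F x)\<^sup>2 \<le> 512 * J / r ^ 3 + 2 * r * K" if "x \<in> {c..c + r}" for x
  proof -
    have "(F x - F t)\<^sup>2 \<le> (c + r - c) * (LBINT s:{c..c + r}. (k s)\<^sup>2)"
      using p q t c d that r by (intro F_diff_sq) auto
    also have "\<dots> \<le> r * K" using K r by simp
    finally have "(F x - F t)\<^sup>2 \<le> r * K" .
    moreover have "(F x)\<^sup>2 \<le> 2 * (F x - F t)\<^sup>2 + 2 * (F t)\<^sup>2"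
      using zero_le_power2[of "F x - 2 * F t"] by (simp add: power2_eq_square algebra_simps)
    ultimately show ?thesis using Ft by simp
  qed
  show "(F s)\<^sup>2 \<le> 512 * J / r ^ 3 + 2 * r * K" by (rule Fs[OF s])
  \<comment> \<open>A second mean value step, starting from the small value at \<open>p\<close>,
    turns the bound \<open>B\<close> on the square of \<open>F\<close> into one on \<open>f\<close>;
    1032 is 2 * 512 + 8.\<close>
  define B where "B = 512 * J / r ^ 3 + 2 * r * K"
  have "(f s - f p)\<^sup>2 \<le> r\<^sup>2 * B"
  proof -
    have *: "(f y - f x)\<^sup>2 \<le> r\<^sup>2 * B" if xy: "x \<in> {c..c + r}" "y \<in> {c..c + r}" "x < y" for x y
    proof -
      obtain u where u: "u \<in> {x..y}" "f y - f x = (y - x) * F u"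
        by (rule f_mvt[of x y]) (use xy c d in auto)
      have "(f y - f x)\<^sup>2 = (y - x)\<^sup>2 * (F u)\<^sup>2" by (simp add: u(2) power_mult_distrib)
      also have "\<dots> \<le> r\<^sup>2 * B"
        unfolding B_def using xy u by (intro mult_mono power_mono Fs) auto
      finally show ?thesis .
    qed
    have "0 \<le> B" using Fs[OF s] zero_le_power2[of "F s"] unfolding B_def by linarith
    then show ?thesis
      using *[of s p] *[of p s] s p q r by (cases s p rule: linorder_cases) (auto simp: power2_commute)
  qed
  moreover have "(f s)\<^sup>2 \<le> 2 * (f s - f p)\<^sup>2 + 2 * (f p)\<^sup>2"
    using zero_le_power2[of "f s - 2 * f p"] by (simp add: power2_eq_square algebra_simps)
  ultimately have "(f s)\<^sup>2 \<le> 2 * (r\<^sup>2 * B) + 2 * (J / (r / 4))" using p by linarith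
  also have "\<dots> = 1032 * J / r + 4 * r ^ 3 * K"
    using r by (simp add: B_def field_simps power2_eq_square power3_eq_cube)
  finally show "(f s)\<^sup>2 \<le> 1032 * J / r + 4 * r ^ 3 * K" .
qed

text \<open>On [p, q] the weight x^2 is at least p^2: away from the degenerate point 0 the weighted
  norm controls the plain one.\<close>

lemma J_bound:
  assumes "0 < p" "q \<le> 1"
  shows "p\<^sup>2 * (LBINT x:{p..q}. (f x)\<^sup>2) \<le> (LBINT x:{0..1}. (x * f x)\<^sup>2)"
proof -
  have i: "set_integrable lborel {0..1} (\<lambda>x. (x * f x)\<^sup>2)"
    by (intro borel_integrable_atLeastAtMost' continuous_intros f_cont)
  have "p\<^sup>2 * (LBINT x:{p..q}. (f x)\<^sup>2) = (LBINT x:{p..q}. p\<^sup>2 * (f x)\<^sup>2)" by simp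
  also have "\<dots> \<le> (LBINT x:{p..q}. (x * f x)\<^sup>2)"
  proof (rule set_integral_mono)
    show "set_integrable lborel {p..q} (\<lambda>x. p\<^sup>2 * (f x)\<^sup>2)" "set_integrable lborel {p..q} (\<lambda>x. (x * f x)\<^sup>2)"
      using assms by (auto intro!: borel_integrable_atLeastAtMost' continuous_intros continuous_on_subset[OF f_cont])
    fix x assume "x \<in> {p..q}"
    then show "p\<^sup>2 * (f x)\<^sup>2 \<le> (x * f x)\<^sup>2"
      using assms by (auto simp: power_mult_distrib intro!: mult_right_mono power_mono)
  qed
  also have "\<dots> \<le> (LBINT x:{0..1}. (x * f x)\<^sup>2)"
    using i assms by (intro set_integral_subset_mono) auto
  finally show ?thesis .
qed

text \<open>Formally (x f') f' is integrated by parts: the derivative of x f' contributes x f'' and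
  f', and f f' is the derivative of f^2 / 2.\<close>

lemma parts_identity:
  "(LBINT x:{0..1}. x * (F x)\<^sup>2) = f 1 * F 1 - (LBINT x:{0..1}. k x * (x * f x)) - ((f 1)\<^sup>2 - (f 0)\<^sup>2) / 2"
proof -
  define V where "V z = (LBINT s:{0..z}. k s)" for z
  have c: "continuous_on {0..1} (\<lambda>x. f x + x * F x)" "continuous_on {0..1} (\<lambda>x. f x * F x)"
    "continuous_on {0..1} (\<lambda>x. x * (F x)\<^sup>2)"
    by (intro continuous_intros f_cont F_cont)+
  have D: "((\<lambda>x. x * f x) has_real_derivative f x + x * F x) (at x within {0..1})" if "x \<in> {0..1}" for x
    using f_deriv[OF that] by (auto intro!: derivative_eq_intros)
  have D2: "((\<lambda>x. (f x)\<^sup>2 / 2) has_real_derivative f x * F x) (at x within {0..1})" if "x \<in> {0..1}" for x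
    using f_deriv[OF that] by (auto intro!: derivative_eq_intros)
  have e1: "(LBINT x:{0..1}. f x * F x) = (f 1)\<^sup>2 / 2 - (f 0)\<^sup>2 / 2"
    unfolding set_lebesgue_integral_def using D2 c
    by (intro integral_FTC_atLeastAtMost) (auto simp: has_real_derivative_iff_has_vector_derivative[symmetric])
  have e2: "(LBINT x:{0..1}. f x + x * F x) = f 1"
    unfolding set_lebesgue_integral_def using D c
    by (subst integral_FTC_atLeastAtMost[where F = "\<lambda>x. x * f x"]) (auto simp: has_real_derivative_iff_has_vector_derivative[symmetric])
  \<comment> \<open>The lemma on primitives applies to \<open>V\<close>, which is \<open>F\<close>
    minus the constant \<open>F 0\<close>; the part belonging to \<open>F 0\<close> is restored
    through \<open>e2\<close>.\<close>
  have "(LBINT x:{0..1}. (f x + x * F x) * V x) = (1 * f 1) * V 1 - (LBINT x:{0..1}. k x * (x * f x))"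
    unfolding V_def by (rule integration_by_parts_primitive[OF _ k_int D c(1)]) auto
  moreover have "(LBINT x:{0..1}. f x * F x + x * (F x)\<^sup>2) = (LBINT x:{0..1}. F 0 * (f x + x * F x) + (f x + x * F x) * V x)"
  proof (rule set_lebesgue_integral_cong)
    show "\<forall>x. x \<in> {0..1} \<longrightarrow> f x * F x + x * (F x)\<^sup>2 = F 0 * (f x + x * F x) + (f x + x * F x) * V x"
    proof (intro allI impI)
      fix x :: real assume "x \<in> {0..1}"
      then have "F x = F 0 + V x" using F_eq unfolding V_def by blast
      then show "f x * F x + x * (F x)\<^sup>2 = F 0 * (f x + x * F x) + (f x + x * F x) * V x"
        by (simp add: power2_eq_square algebra_simps)
    qed
  qed simp
  moreover have "(LBINT x:{0..1}. F 0 * (f x + x * F x) + (f x + x * F x) * V x)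
      = F 0 * f 1 + (LBINT x:{0..1}. (f x + x * F x) * V x)"
    using c(1) primitive_continuous[OF k_int, of 0 1] unfolding V_def
    by (subst set_integral_add) (auto intro!: borel_integrable_atLeastAtMost' continuous_intros simp: e2)
  moreover have "(LBINT x:{0..1}. f x * F x + x * (F x)\<^sup>2) = (LBINT x:{0..1}. f x * F x) + (LBINT x:{0..1}. x * (F x)\<^sup>2)"
    using c by (intro set_integral_add borel_integrable_atLeastAtMost')
  moreover have "F 1 = F 0 + V 1" using F_eq[of 1] unfolding V_def by simp
  ultimately show ?thesis using e1 by (simp add: algebra_simps diff_divide_distrib)
qed

lemma weighted_interpolation:
  assumes n: "1 \<le> n"
  shows "n * (LBINT x:{0..1}. x * (F x)\<^sup>2)
    \<le> 21000 * (n\<^sup>2 * (LBINT x:{0..1}. (x * f x)\<^sup>2) + (LBINT x:{0..1}. (k x)\<^sup>2))"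
proof -
  define I where "I = (LBINT x:{0..1}. (x * f x)\<^sup>2)"
  define K where "K = (LBINT x:{0..1}. (k x)\<^sup>2)"
  define A where "A = n\<^sup>2 * I"
  have I0: "0 \<le> I" and K0: "0 \<le> K" unfolding I_def K_def by (simp_all add: set_integral_nonneg')
  then have A0: "0 \<le> A" by (simp add: A_def)
  have at0: "n * (f 0)\<^sup>2 \<le> 16512 * A + 4 * K"
  proof -
    \<comment> \<open>With r^3 = 1/n both terms of \<open>local_bounds\<close> become multiples of
      1/n. The window touches 0, so \<open>J_bound\<close> costs a factor 16 / r^2, and 16512 is 16
      * 1032.\<close>
    define r where "r = root 3 (1 / n)"
    have r: "0 < r" "r ^ 3 = 1 / n" "r \<le> 1"
      using n real_root_pow_pos2[of 3 "1 / n"] by (simp_all add: r_def real_root_gt_zero real_root_le_1_iff)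
    define J where "J = (LBINT x:{0 + r / 4..0 + r}. (f x)\<^sup>2)"
    have "(r / 4)\<^sup>2 * J \<le> I" unfolding J_def I_def using J_bound[of "r / 4" r] r by simp
    then have J: "J / r \<le> 16 * I / r ^ 3" using r(1) by (simp add: field_simps power2_eq_square power3_eq_cube)
    have "(f 0)\<^sup>2 \<le> 1032 * J / r + 4 * r ^ 3 * K"
      unfolding J_def K_def using r by (intro local_bounds) auto
    also have "\<dots> \<le> 16512 * I / r ^ 3 + 4 * r ^ 3 * K" using J by simp
    also have "\<dots> = 16512 * I * n + 4 * K / n" using r(2) n by simp
    finally have "n * (f 0)\<^sup>2 \<le> n * (16512 * I * n + 4 * K / n)" using n by (intro mult_left_mono) auto
    also have "\<dots> = 16512 * A + 4 * K" using n by (simp add: A_def power2_eq_square field_simps)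
    finally show ?thesis .
  qed
  have at1: "n * (f 1 * F 1) \<le> 12352 * A + 3 * K"
  proof -
    \<comment> \<open>Near 1 the weight is harmless and r^2 = 1/n is the balance: in terms of A + K
      the squares of \<open>f 1\<close> and \<open>F 1\<close> are of order r^3 and r, so their
      product is of order r^2.\<close>
    define r where "r = sqrt (1 / n)"
    have r: "0 < r" "r\<^sup>2 = 1 / n" "r \<le> 1" using n by (auto simp: r_def)
    define J where "J = (LBINT x:{1 - r + r / 4..1 - r + r}. (f x)\<^sup>2)"
    \<comment> \<open>Since r <= 1, the last three quarters of the window lie in [1/4, 1] even for n
      = 1, so the weight costs only the factor 16.\<close>
    have "(1 / 4)\<^sup>2 * J \<le> (1 - r + r / 4)\<^sup>2 * J"
      using r unfolding J_def by (intro mult_right_mono power_mono) (auto simp: set_integral_nonneg')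
    also have "\<dots> \<le> I" unfolding J_def I_def using r by (intro J_bound) auto
    finally have J: "J \<le> 16 * I" by (simp add: power2_eq_square)
    have IA: "I = A * r ^ 4"
    proof -
      have "r ^ 4 = (r\<^sup>2)\<^sup>2" by simp
      also have "\<dots> = 1 / n\<^sup>2" using r(2) by (simp add: power_divide)
      finally show ?thesis using n by (simp add: A_def)
    qed
    have "(F 1)\<^sup>2 \<le> 512 * J / r ^ 3 + 2 * r * K"
      unfolding J_def K_def using r by (intro local_bounds) auto
    also have "\<dots> \<le> 512 * (16 * I) / r ^ 3 + 2 * r * K" using J r by (intro add_mono divide_right_mono) auto
    also have "\<dots> = r * (8192 * A + 2 * K)" using r(1) by (simp add: IA field_simps power_numeral_reduce)
    finally have F1: "(F 1)\<^sup>2 \<le> r * (8192 * A + 2 * K)" .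
    have "(f 1)\<^sup>2 \<le> 1032 * J / r + 4 * r ^ 3 * K"
      unfolding J_def K_def using r by (intro local_bounds) auto
    also have "\<dots> \<le> 1032 * (16 * I) / r + 4 * r ^ 3 * K" using J r by (intro add_mono divide_right_mono) auto
    also have "\<dots> = r ^ 3 * (16512 * A + 4 * K)" using r(1) by (simp add: IA field_simps power_numeral_reduce)
    finally have f1: "(f 1)\<^sup>2 \<le> r ^ 3 * (16512 * A + 4 * K)" .
    \<comment> \<open>Young's inequality with the factor \<open>r\<close> gives both squares the
      same power r^3; 12352 is the mean of 16512 and 8192.\<close>
    have "r * (2 * (f 1 * F 1)) \<le> (f 1)\<^sup>2 + r\<^sup>2 * (F 1)\<^sup>2"
      using zero_le_power2[of "f 1 - r * F 1"] by (simp add: power2_eq_square algebra_simps)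
    also have "\<dots> \<le> r ^ 3 * (16512 * A + 4 * K) + r\<^sup>2 * (r * (8192 * A + 2 * K))"
      using f1 F1 by (intro add_mono mult_left_mono) auto
    also have "\<dots> = r * (2 * (r\<^sup>2 * (12352 * A + 3 * K)))"
      by (simp add: algebra_simps power2_eq_square power3_eq_cube)
    finally have "f 1 * F 1 \<le> r\<^sup>2 * (12352 * A + 3 * K)" using r(1) by simp
    then show ?thesis using r(2) n by (simp add: field_simps)
  qed
  have mid: "- (n * (LBINT x:{0..1}. k x * (x * f x))) \<le> (A + K) / 2"
  proof -
    have i1: "set_integrable lborel {0..1} (\<lambda>x. (n\<^sup>2 / 2) * (x * f x)\<^sup>2)"
      by (intro borel_integrable_atLeastAtMost' continuous_intros f_cont)
    have i2: "set_integrable lborel {0..1} (\<lambda>x. (1 / 2) * (k x)\<^sup>2)" using k2_set[of "{0..1}"] by simp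
    have am: "\<bar>n * (k x * (x * f x))\<bar> \<le> (n\<^sup>2 / 2) * (x * f x)\<^sup>2 + (1 / 2) * (k x)\<^sup>2" for x
      using zero_le_power2[of "n * (x * f x) - k x"] zero_le_power2[of "n * (x * f x) + k x"]
      by (simp add: abs_le_iff power2_eq_square algebra_simps)
    have mf: "(\<lambda>x. indicator {0..1} x *\<^sub>R (x * f x)) \<in> borel_measurable borel"
      by (intro borel_measurable_continuous_on_indicator continuous_intros f_cont) auto
    have mk: "k \<in> borel_measurable borel" using k_int by auto
    have "(\<lambda>x. n * (k x * (indicator {0..1} x *\<^sub>R (x * f x)))) \<in> borel_measurable borel"
      using mf mk by (intro borel_measurable_times) auto
    then have mm: "(\<lambda>x. indicator {0..1} x *\<^sub>R (n * (k x * (x * f x)))) \<in> borel_measurable borel"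
      by (simp add: mult_ac)
    have i3: "set_integrable lborel {0..1} (\<lambda>x. n * (k x * (x * f x)))"
      using mm am by (intro set_integrable_bound[OF set_integral_add(1)[OF i1 i2]])
        (auto simp: set_borel_measurable_def intro!: AE_I2 intro: order_trans[OF _ abs_ge_self])
    have "- (n * (LBINT x:{0..1}. k x * (x * f x))) = (LBINT x:{0..1}. - (n * (k x * (x * f x))))"
      using i3 by (simp add: set_integral_uminus)
    also have "\<dots> \<le> (LBINT x:{0..1}. (n\<^sup>2 / 2) * (x * f x)\<^sup>2 + (1 / 2) * (k x)\<^sup>2)"
      using am i3 set_integral_add(1)[OF i1 i2]
      by (intro set_integral_mono) (auto simp: set_integrable_def abs_le_iff)
    also have "\<dots> = (A + K) / 2"
      by (subst set_integral_add(2)[OF i1 i2]) (simp add: A_def K_def I_def)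
    finally show ?thesis .
  qed
  \<comment> \<open>The term with the square of \<open>f 1\<close> has the favourable sign and is
    dropped. The coefficients of \<open>A\<close> then add up to 20608.5, rounded up to
    21000.\<close>
  have "n * (LBINT x:{0..1}. x * (F x)\<^sup>2) = n * (f 1 * F 1) - n * (LBINT x:{0..1}. k x * (x * f x)) - n * (f 1)\<^sup>2 / 2 + n * (f 0)\<^sup>2 / 2"
    unfolding parts_identity by (simp add: algebra_simps diff_divide_distrib)
  also have "\<dots> \<le> (12352 * A + 3 * K) + (A + K) / 2 - 0 + (16512 * A + 4 * K) / 2"
  proof -
    have "0 \<le> n * (f 1)\<^sup>2 / 2" using n by simp
    moreover have "p - i - e + z / 2 \<le> (12352 * A + 3 * K) + (A + K) / 2 - 0 + (16512 * A + 4 * K) / 2"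
      if "0 \<le> e" "z \<le> 16512 * A + 4 * K" "p \<le> 12352 * A + 3 * K" "- i \<le> (A + K) / 2" for p i e z
      using that by (simp add: field_simps)
    ultimately show ?thesis using at0 at1 mid by blast
  qed
  also have "\<dots> \<le> 21000 * (A + K)" using A0 K0 by (simp add: field_simps)
  finally show ?thesis by (simp add: A_def K_def I_def)
qed

end

section \<open>Cosine series\<close>

lemma orthogonal_sum_norm:
  fixes e :: "'i \<Rightarrow> 'a \<Rightarrow> real"
  assumes fin: "finite I"
    and int: "\<And>i j. i \<in> I \<Longrightarrow> j \<in> I \<Longrightarrow> integrable M (\<lambda>x. e i x * e j x)"
    and orth: "\<And>i j. i \<in> I \<Longrightarrow> j \<in> I \<Longrightarrow> (LINT x|M. e i x * e j x) = (if i = j then c else 0)"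
  shows "integrable M (\<lambda>x. (\<Sum>i\<in>I. \<beta> i * e i x)\<^sup>2)"
    and "(LINT x|M. (\<Sum>i\<in>I. \<beta> i * e i x)\<^sup>2) = c * (\<Sum>i\<in>I. (\<beta> i)\<^sup>2)"
proof -
  have eq: "(\<Sum>i\<in>I. \<beta> i * e i x)\<^sup>2 = (\<Sum>i\<in>I. \<Sum>j\<in>I. \<beta> i * \<beta> j * (e i x * e j x))" for x
    by (simp add: power2_eq_square sum_product mult_ac)
  show "integrable M (\<lambda>x. (\<Sum>i\<in>I. \<beta> i * e i x)\<^sup>2)"
    unfolding eq using int by (intro Bochner_Integration.integrable_sum integrable_mult_right) auto
  have "(LINT x|M. (\<Sum>i\<in>I. \<beta> i * e i x)\<^sup>2) = (\<Sum>i\<in>I. \<Sum>j\<in>I. \<beta> i * \<beta> j * (LINT x|M. e i x * e j x))"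
    unfolding eq using int
    by (simp add: Bochner_Integration.integral_sum Bochner_Integration.integrable_sum)
  also have "\<dots> = (\<Sum>i\<in>I. \<Sum>j\<in>I. if j = i then c * (\<beta> i)\<^sup>2 else 0)"
    by (intro sum.cong refl) (auto simp: orth power2_eq_square)
  also have "\<dots> = c * (\<Sum>i\<in>I. (\<beta> i)\<^sup>2)"
    using fin by (simp add: sum_distrib_left)
  finally show "(LINT x|M. (\<Sum>i\<in>I. \<beta> i * e i x)\<^sup>2) = c * (\<Sum>i\<in>I. (\<beta> i)\<^sup>2)" .
qed

text \<open>As the \<open>e i\<close> have the common squared norm c, the sum \<open>S\<close>
  divided by c is the orthogonal projection of \<open>u\<close>; the claim comes from expanding the
  integral of (c u - S)^2.\<close>

lemma bessel_inequality:
  fixes e :: "'i \<Rightarrow> 'a \<Rightarrow> real"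
  assumes fin: "finite I"
    and int: "\<And>i j. i \<in> I \<Longrightarrow> j \<in> I \<Longrightarrow> integrable M (\<lambda>x. e i x * e j x)"
    and orth: "\<And>i j. i \<in> I \<Longrightarrow> j \<in> I \<Longrightarrow> (LINT x|M. e i x * e j x) = (if i = j then c else 0)"
    and c: "0 < c" and u2: "integrable M (\<lambda>x. (u x)\<^sup>2)"
    and ue: "\<And>i. i \<in> I \<Longrightarrow> integrable M (\<lambda>x. u x * e i x)"
  shows "(\<Sum>i\<in>I. (LINT x|M. u x * e i x)\<^sup>2) \<le> c * (LINT x|M. (u x)\<^sup>2)"
proof -
  define \<alpha> where "\<alpha> i = (LINT x|M. u x * e i x)" for i
  define S where "S x = (\<Sum>i\<in>I. \<alpha> i * e i x)" for x
  have S2: "integrable M (\<lambda>x. (S x)\<^sup>2)" "(LINT x|M. (S x)\<^sup>2) = c * (\<Sum>i\<in>I. (\<alpha> i)\<^sup>2)"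
    unfolding S_def by (intro orthogonal_sum_norm[OF fin int orth]; simp)+
  have uS: "u x * S x = (\<Sum>i\<in>I. \<alpha> i * (u x * e i x))" for x
    by (simp add: S_def sum_distrib_left mult_ac)
  have uSi: "integrable M (\<lambda>x. u x * S x)"
    unfolding uS using ue by (intro Bochner_Integration.integrable_sum integrable_mult_right) auto
  have uSv: "(LINT x|M. u x * S x) = (\<Sum>i\<in>I. (\<alpha> i)\<^sup>2)"
    unfolding uS using ue by (simp add: Bochner_Integration.integral_sum \<alpha>_def power2_eq_square)
  have "0 \<le> (LINT x|M. (c * u x - S x)\<^sup>2)" by (intro integral_nonneg_AE) auto
  also have "(\<lambda>x. (c * u x - S x)\<^sup>2) = (\<lambda>x. (c\<^sup>2 * (u x)\<^sup>2 - 2 * c * (u x * S x)) + (S x)\<^sup>2)"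
    by (auto simp: power2_eq_square algebra_simps)
  also have "(LINT x|M. (c\<^sup>2 * (u x)\<^sup>2 - 2 * c * (u x * S x)) + (S x)\<^sup>2)
      = c\<^sup>2 * (LINT x|M. (u x)\<^sup>2) - 2 * c * (\<Sum>i\<in>I. (\<alpha> i)\<^sup>2) + c * (\<Sum>i\<in>I. (\<alpha> i)\<^sup>2)"
    using u2 uSi S2 by (simp add: uSv)
  finally have "0 \<le> c * (c * (LINT x|M. (u x)\<^sup>2) - (\<Sum>i\<in>I. (\<alpha> i)\<^sup>2))"
    by (simp add: power2_eq_square algebra_simps)
  then show ?thesis using c by (simp add: zero_le_mult_iff \<alpha>_def)
qed

lemma integral_cos_affine:
  fixes m p q t :: real
  assumes "m \<noteq> 0" "p \<le> q"
  shows "(LBINT x:{p..q}. cos (m * x + t)) = (sin (m * q + t) - sin (m * p + t)) / m"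
proof -
  have "(LBINT x:{p..q}. cos (m * x + t)) = sin (m * q + t) / m - sin (m * p + t) / m"
    unfolding set_lebesgue_integral_def
  proof (rule integral_FTC_atLeastAtMost[OF assms(2)])
    show "((\<lambda>x. sin (m * x + t) / m) has_vector_derivative cos (m * x + t)) (at x within {p..q})" for x
      unfolding has_real_derivative_iff_has_vector_derivative[symmetric]
      using assms(1) by (auto intro!: derivative_eq_intros)
  qed (intro continuous_intros)
  then show ?thesis by (simp add: diff_divide_distrib)
qed

section \<open>The cosine and sine systems of an interval\<close>

locale fourier_interval =
  fixes a b :: real
  assumes ab: "a < b"
begin

definition om :: real where "om = pi / (b - a)"

text \<open>The indicator lets all integrals run over the whole line. Inside the interval these are
  Neumann eigenfunctions and the \<open>sn\<close> are Dirichlet ones; differentiation exchanges the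
  two families up to factors.\<close>

definition cs :: "nat \<Rightarrow> real \<Rightarrow> real" where
  "cs n x = indicator {a<..<b} x * cos (real n * om * (x - a))"

definition sn :: "nat \<Rightarrow> real \<Rightarrow> real" where
  "sn n x = indicator {a<..<b} x * sin (real n * om * (x - a))"

definition coef :: "(real \<Rightarrow> real) \<Rightarrow> nat \<Rightarrow> real" where
  "coef u n = (LBINT x. u x * cs n x)"

lemma om_pos: "0 < om"
  using ab by (simp add: om_def)

lemma om_ba: "om * (b - a) = pi"
  using ab by (simp add: om_def)

lemma cs_meas[measurable]: "cs n \<in> borel_measurable borel"
  and sn_meas[measurable]: "sn n \<in> borel_measurable borel"
  unfolding cs_def[abs_def] sn_def[abs_def]
  by (intro borel_measurable_times borel_measurable_indicator borel_measurable_continuous_onI continuous_intros; simp)+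

lemma cs_bound: "\<bar>cs n x\<bar> \<le> 1" and sn_bound: "\<bar>sn n x\<bar> \<le> 1"
  by (auto simp: cs_def sn_def indicator_def)

lemma indicator_integrable: "integrable lborel (indicat_real {a<..<b})"
  using ab by (intro integrable_real_indicator) auto

lemma trig_integrable:
  fixes f :: "real \<Rightarrow> real"
  assumes "continuous_on UNIV f" "\<And>x. \<bar>f x\<bar> \<le> 1"
  shows "integrable lborel (\<lambda>x. indicator {a<..<b} x * f x)"
  using assms by (intro integrable_mult_bounded[OF indicator_integrable]) (auto intro: borel_measurable_continuous_onI)

lemma cos_integral:
  "(LBINT x. indicator {a<..<b} x * cos (of_int m * om * (x - a))) = (if m = 0 then b - a else 0)"
proof (cases "m = 0")
  case True
  then show ?thesis using ab by simp
next
  case False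
  have "(LBINT x. indicator {a<..<b} x * cos (of_int m * om * (x - a))) = (LBINT x:{a..b}. cos (of_int m * om * x + (- of_int m * om * a)))"
    unfolding set_lebesgue_integral_def
  proof (rule integral_cong_AE)
    show "AE x in lborel. indicator {a<..<b} x * cos (of_int m * om * (x - a)) = indicator {a..b} x *\<^sub>R cos (of_int m * om * x + (- of_int m * om * a))"
      using AE_lborel_singleton[of a] AE_lborel_singleton[of b]
      by eventually_elim (auto simp: indicator_def algebra_simps)
  qed measurable
  also have "\<dots> = (sin (of_int m * om * b + (- of_int m * om * a)) - sin (of_int m * om * a + (- of_int m * om * a))) / (of_int m * om)"
    using False om_pos ab by (intro integral_cos_affine) auto
  also have "of_int m * om * b + (- of_int m * om * a) = of_int m * pi"
  proof -
    have "of_int m * om * b + (- of_int m * om * a) = of_int m * (om * (b - a))" by (simp add: algebra_simps)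
    then show ?thesis by (simp add: om_ba)
  qed
  finally show ?thesis using False by (simp add: sin_times_pi_eq_0 sin_int_times_real mult.commute)
qed

lemma cs_cs_integrable: "integrable lborel (\<lambda>x. cs n x * cs m x)"
  and sn_sn_integrable: "integrable lborel (\<lambda>x. sn n x * sn m x)"
  and cs_integrable: "integrable lborel (cs n)"
proof -
  have *: "integrable lborel (cs n)" "integrable lborel (sn n)" for n
    unfolding cs_def[abs_def] sn_def[abs_def] by (intro trig_integrable continuous_intros; simp)+
  then show "integrable lborel (cs n)" by simp
  show "integrable lborel (\<lambda>x. cs n x * cs m x)" using * by (intro integrable_mult_bounded[where K = 1] cs_bound) auto
  show "integrable lborel (\<lambda>x. sn n x * sn m x)" using * by (intro integrable_mult_bounded[where K = 1] sn_bound) auto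
qed

text \<open>The product formulas reduce both claims to \<open>cos_integral\<close> at the integers n
  - m and n + m. The hypothesis excludes n = m = 0, where the values are b - a and 0
  instead.\<close>

lemma
  assumes "n \<noteq> 0 \<or> m \<noteq> 0"
  shows cs_orth: "(LBINT x. cs n x * cs m x) = (if n = m then (b - a) / 2 else 0)"
    and sn_orth: "(LBINT x. sn n x * sn m x) = (if n = m then (b - a) / 2 else 0)"
proof -
  define f where "f k x = indicator {a<..<b} x * cos (of_int k * om * (x - a))" for k :: int and x
  have fi: "integrable lborel (f k)" for k
    unfolding f_def[abs_def] by (intro trig_integrable continuous_intros; simp)
  have fv: "(LBINT x. f k x) = (if k = 0 then b - a else 0)" for k
    unfolding f_def by (rule cos_integral)
  have arg: "real n * om * (x - a) - real m * om * (x - a) = of_int (int n - int m) * om * (x - a)"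
    "real n * om * (x - a) + real m * om * (x - a) = of_int (int n + int m) * om * (x - a)" for x
    by (simp_all add: algebra_simps)
  have 1: "cs n x * cs m x = (f (int n - int m) x + f (int n + int m) x) / 2" for x
    unfolding cs_def f_def arg[symmetric] by (auto simp: cos_times_cos indicator_def)
  have 2: "sn n x * sn m x = (f (int n - int m) x - f (int n + int m) x) / 2" for x
    unfolding sn_def f_def arg[symmetric] by (auto simp: sin_times_sin indicator_def)
  show "(LBINT x. cs n x * cs m x) = (if n = m then (b - a) / 2 else 0)"
    unfolding 1 using fi assms by (auto simp: fv)
  show "(LBINT x. sn n x * sn m x) = (if n = m then (b - a) / 2 else 0)"
    unfolding 2 using fi assms by (auto simp: fv)
qed

lemma cs0_cs0: "(LBINT x. cs 0 x * cs 0 x) = b - a"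
proof -
  have "cs 0 x * cs 0 x = indicator {a<..<b} x" for x by (simp add: cs_def indicator_def)
  then show ?thesis using ab by simp
qed

lemma mult_cs_integrable: "integrable lborel f \<Longrightarrow> integrable lborel (\<lambda>x. f x * cs n x)"
  by (intro integrable_mult_bounded[where K = 1] cs_bound) auto

lemma bessel_cs:
  assumes "integrable lborel u" "integrable lborel (\<lambda>x. (u x)\<^sup>2)" "finite I" "0 \<notin> I"
  shows "(\<Sum>n\<in>I. (coef u n)\<^sup>2) \<le> (b - a) / 2 * (LBINT x. (u x)\<^sup>2)"
  unfolding coef_def
proof (rule bessel_inequality[OF assms(3)])
  show "integrable lborel (\<lambda>x. u x * cs i x)" for i
    using assms(1) by (rule mult_cs_integrable)
  show "(LBINT x. cs i x * cs j x) = (if i = j then (b - a) / 2 else 0)" if "i \<in> I" "j \<in> I" for i j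
    using that assms(4) by (intro cs_orth) auto
qed (use ab assms in \<open>auto intro: cs_cs_integrable\<close>)

lemma bessel_sn:
  assumes "integrable lborel u" "integrable lborel (\<lambda>x. (u x)\<^sup>2)" "finite I" "0 \<notin> I"
  shows "(\<Sum>n\<in>I. (LBINT x. u x * sn n x)\<^sup>2) \<le> (b - a) / 2 * (LBINT x. (u x)\<^sup>2)"
proof (rule bessel_inequality[OF assms(3)])
  show "integrable lborel (\<lambda>x. u x * sn i x)" for i
    using assms(1) by (intro integrable_mult_bounded[where K = 1] sn_bound) auto
  show "(LBINT x. sn i x * sn j x) = (if i = j then (b - a) / 2 else 0)" if "i \<in> I" "j \<in> I" for i j
    using that assms(4) by (intro sn_orth) auto
qed (use ab assms in \<open>auto intro: sn_sn_integrable\<close>)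

text \<open>All cosines are polynomials in the single function C(x) = cos (om (x - a)). Hence
  \<open>w\<close> is orthogonal to every power of C, by Weierstrass to every continuous function of
  C, and in the limit to indicators of intervals, since C is strictly monotone on the
  interval.\<close>

lemma cosine_system_complete:
  fixes w :: "real \<Rightarrow> real"
  assumes w: "integrable lborel w" and supp: "\<And>x. x \<notin> {a<..<b} \<Longrightarrow> w x = 0"
    and zero: "\<And>n. coef w n = 0"
  shows "AE x in lborel. w x = 0"
proof -
  have [measurable]: "w \<in> borel_measurable borel" using w by auto
  define C where "C x = cos (om * (x - a))" for x
  have C_bound: "\<bar>C x\<bar> \<le> 1" for x by (simp add: C_def)
  have C_mem: "C x \<in> {-1..1}" for x by (simp add: C_def)
  have C_meas[measurable]: "C \<in> borel_measurable borel"
    unfolding C_def[abs_def] by (intro borel_measurable_continuous_onI continuous_intros)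
  define D where "D n x = cos (real n * om * (x - a))" for n x
  have D_meas[measurable]: "D n \<in> borel_measurable borel" for n
    unfolding D_def[abs_def] by (intro borel_measurable_continuous_onI continuous_intros)
  have CD_bound: "\<bar>C x ^ k * D n x\<bar> \<le> 1" for k n x
  proof -
    have "\<bar>C x ^ k\<bar> \<le> 1" using C_bound[of x] by (simp add: power_abs power_le_one)
    moreover have "\<bar>D n x\<bar> \<le> 1" by (simp add: D_def)
    ultimately show ?thesis by (simp add: abs_mult mult_le_one)
  qed
  have int: "integrable lborel (\<lambda>x. w x * (C x ^ k * D n x))" for k n
    by (intro integrable_mult_bounded[OF w _ CD_bound]) simp
  \<comment> \<open>The extra factor \<open>D n\<close> strengthens the claim: multiplying by one
    more C shifts n to n - 1 and n + 1, so the induction on the power needs every frequency.\<close>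
  have P1: "(LBINT x. w x * (C x ^ k * D n x)) = 0" for k n
  proof (induction k arbitrary: n)
    case 0
    have "w x * (C x ^ 0 * D n x) = w x * cs n x" for x
      using supp[of x] by (cases "x \<in> {a<..<b}") (auto simp: D_def cs_def)
    then have "(LBINT x. w x * (C x ^ 0 * D n x)) = (LBINT x. w x * cs n x)" by (simp only:)
    then show ?case using zero[of n] by (simp only: coef_def)
  next
    case (Suc k)
    show ?case
    proof (cases n)
      case 0
      have "C x ^ Suc k * D 0 x = C x ^ k * D 1 x" for x by (simp add: C_def D_def)
      then show ?thesis using Suc[of 1] 0 by presburger
    next
      case (Suc m)
      have CD: "C x * D (Suc m) x = (D m x + D (Suc (Suc m)) x) / 2" for x
      proof -
        have "real (Suc m) * om * (x - a) - om * (x - a) = real m * om * (x - a)"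
          "real (Suc m) * om * (x - a) + om * (x - a) = real (Suc (Suc m)) * om * (x - a)"
          by (simp_all add: algebra_simps)
        then show ?thesis
          unfolding C_def D_def using cos_times_cos[of "real (Suc m) * om * (x - a)" "om * (x - a)"]
          by (simp only: mult.commute[of "cos (om * (x - a))"])
      qed
      have "w x * (C x ^ Suc k * D n x) = (w x * (C x ^ k * D m x) + w x * (C x ^ k * D (Suc (Suc m)) x)) / 2" for x
      proof -
        have "w x * (C x ^ Suc k * D n x) = w x * C x ^ k * (C x * D (Suc m) x)" by (simp add: Suc mult_ac)
        also have "\<dots> = w x * C x ^ k * ((D m x + D (Suc (Suc m)) x) / 2)" by (simp only: CD)
        finally show ?thesis by (simp add: distrib_left mult.assoc)
      qed
      then have "(LBINT x. w x * (C x ^ Suc k * D n x)) =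
          (LBINT x. (w x * (C x ^ k * D m x) + w x * (C x ^ k * D (Suc (Suc m)) x)) / 2)" by (simp only:)
      then show ?thesis using int Suc.IH by simp
    qed
  qed
  have P2: "(LBINT x. w x * C x ^ k) = 0" for k
    using P1[of k 0] by (simp add: D_def)
  have P2i: "integrable lborel (\<lambda>x. w x * C x ^ k)" for k
    using int[of k 0] by (simp add: D_def)
  have P3: "(LBINT x. w x * F (C x)) = 0" if F: "continuous_on UNIV F" for F :: "real \<Rightarrow> real"
  proof -
    have cF: "continuous_on {-1..1} F" using F by (rule continuous_on_subset) auto
    have mF: "(\<lambda>x. F (C x)) \<in> borel_measurable lborel"
      using measurable_compose[OF C_meas borel_measurable_continuous_onI[OF F]] by simp
    have "bounded (F ` {-1..1})" by (intro compact_imp_bounded compact_continuous_image cF) auto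
    then obtain B where "\<forall>y\<in>F ` {-1..1}. norm y \<le> B" unfolding bounded_iff by blast
    then have B: "\<bar>F (C x)\<bar> \<le> B" for x using C_mem[of x] by simp
    have Fi: "integrable lborel (\<lambda>x. w x * F (C x))"
      by (intro integrable_mult_bounded[OF w mF B])
    define W where "W = (LBINT x. \<bar>w x\<bar>)"
    \<comment> \<open>A polynomial within e of \<open>F\<close> on [-1, 1], the range of C, changes
      the integral by at most e times the L1 norm of \<open>w\<close>.\<close>
    have eW: "\<bar>LBINT x. w x * F (C x)\<bar> \<le> e * W" if e: "e > 0" for e
    proof -
      obtain g where g: "real_polynomial_function g" "\<And>y. y \<in> {-1..1} \<Longrightarrow> \<bar>F y - g y\<bar> < e"
        using Stone_Weierstrass_real_polynomial_function[OF compact_Icc cF e] by blast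
      obtain c N where gs: "g = (\<lambda>y. \<Sum>i\<le>N. c i * y ^ i)"
        using g(1) by (auto simp: real_polynomial_function_iff_sum)
      have gi: "w x * g (C x) = (\<Sum>i\<le>N. c i * (w x * C x ^ i))" for x
        by (simp add: gs sum_distrib_left mult_ac)
      have gint: "integrable lborel (\<lambda>x. w x * g (C x))"
        unfolding gi using P2i by (intro Bochner_Integration.integrable_sum integrable_mult_right) auto
      have "(LBINT x. w x * g (C x)) = 0"
        unfolding gi using P2i P2 by (simp add: Bochner_Integration.integral_sum)
      then have "(LBINT x. w x * F (C x)) = (LBINT x. w x * F (C x) - w x * g (C x))"
        using Fi gint by simp
      also have "\<bar>\<dots>\<bar> \<le> (LBINT x. \<bar>w x * F (C x) - w x * g (C x)\<bar>)"
        using integral_norm_bound[of lborel "\<lambda>x. w x * F (C x) - w x * g (C x)"] by simp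
      also have "\<dots> \<le> (LBINT x. e * \<bar>w x\<bar>)"
      proof (rule integral_mono)
        fix x
        have "\<bar>F (C x) - g (C x)\<bar> \<le> e" using g(2)[OF C_mem[of x]] by simp
        then have "\<bar>F (C x) - g (C x)\<bar> * \<bar>w x\<bar> \<le> e * \<bar>w x\<bar>" by (rule mult_right_mono) simp
        then show "\<bar>w x * F (C x) - w x * g (C x)\<bar> \<le> e * \<bar>w x\<bar>"
          by (simp add: abs_mult mult.commute flip: right_diff_distrib)
      qed (use Fi gint w in auto)
      also have "\<dots> = e * W" by (simp add: W_def)
      finally show ?thesis .
    qed
    have "W \<ge> 0" by (simp add: W_def)
    have le: "\<bar>LBINT x. w x * F (C x)\<bar> \<le> e" if "e > 0" for e
    proof -
      have "\<bar>LBINT x. w x * F (C x)\<bar> \<le> e / (W + 1) * W"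
        using \<open>W \<ge> 0\<close> that by (intro eW) simp
      also have "\<dots> \<le> e" using \<open>W \<ge> 0\<close> that by (simp add: field_simps)
      finally show ?thesis .
    qed
    show ?thesis using field_le_epsilon[of "\<bar>LBINT x. w x * F (C x)\<bar>" 0] le by simp
  qed
  show ?thesis
  proof (rule AE_zero_if_interval_integrals_zero[OF w])
    fix c d :: real assume "c < d"
    define c' d' where "c' = max a c" and "d' = min b d"
    show "(LBINT x:{c<..<d}. w x) = 0"
    proof (cases "c' < d'")
      case False
      have "indicator {c<..<d} x *\<^sub>R w x = 0" for x
        using supp[of x] False by (auto simp: indicator_def c'_def d'_def)
      then show ?thesis unfolding set_lebesgue_integral_def by (simp only: Bochner_Integration.integral_zero)
    next
      case True
      \<comment> \<open>C is decreasing, so the end points are exchanged; the trapezoids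
        \<open>F j\<close> are continuous and tend to the indicator of (p, q).\<close>
      define p q where "p = C d'" and "q = C c'"
      define F where "F j y = min 1 (real j * max 0 (min (y - p) (q - y)))" for j :: nat and y
      have iff: "C x \<in> {p<..<q} \<longleftrightarrow> x \<in> {c'<..<d'}" if x: "x \<in> {a<..<b}" for x
      proof -
        have m: "C y < C z \<longleftrightarrow> z < y" if "y \<in> {a..b}" "z \<in> {a..b}" for y z
        proof -
          have r: "0 \<le> om * (t - a)" "om * (t - a) \<le> pi" if "t \<in> {a..b}" for t
          proof -
            show "0 \<le> om * (t - a)" using that om_pos by simp
            have "om * (t - a) \<le> om * (b - a)" using that om_pos by (intro mult_left_mono) auto
            then show "om * (t - a) \<le> pi" using om_ba by simp
          qed
          show ?thesis unfolding C_def
            using cos_mono_less_eq[of "om * (y - a)" "om * (z - a)"] r[OF that(1)] r[OF that(2)] om_pos by simp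
        qed
        have "c' \<in> {a..b}" "d' \<in> {a..b}" "x \<in> {a..b}" using True x ab by (auto simp: c'_def d'_def)
        then show ?thesis using m by (auto simp: p_def q_def)
      qed
      have lim: "(\<lambda>j. F j y) \<longlonglongrightarrow> indicator {p<..<q} y" for y
      proof (cases "y \<in> {p<..<q}")
        case T: True
        then have t: "min (y - p) (q - y) > 0" by auto
        obtain N :: nat where N: "1 / min (y - p) (q - y) < real N" using reals_Archimedean2 by blast
        have "eventually (\<lambda>j. F j y = 1) sequentially"
          using eventually_ge_at_top[of N]
        proof eventually_elim
          case (elim j)
          have "1 / min (y - p) (q - y) \<le> real j" using N elim by linarith
          then have "1 \<le> real j * min (y - p) (q - y)" using t by (simp add: pos_divide_le_eq)
          then show ?case using t by (simp add: F_def)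
        qed
        then show ?thesis using T by (simp add: tendsto_eventually)
      next
        case False
        then have "min (y - p) (q - y) \<le> 0" by auto
        then have "F j y = 0" for j by (simp add: F_def)
        then show ?thesis using False by simp
      qed
      have cF: "continuous_on UNIV (F j)" for j unfolding F_def[abs_def] by (intro continuous_intros)
      have F01: "\<bar>F j y\<bar> \<le> 1" for j y by (auto simp: F_def abs_le_iff)
      have "(\<lambda>j. LBINT x. w x * F j (C x)) \<longlonglongrightarrow> (LBINT x. w x * indicator {p<..<q} (C x))"
      proof (rule integral_dominated_convergence[where w = "\<lambda>x. norm (w x)"])
        show "AE x in lborel. (\<lambda>j. w x * F j (C x)) \<longlonglongrightarrow> w x * indicator {p<..<q} (C x)"
          by (intro AE_I2 tendsto_mult tendsto_const lim)
        show "AE x in lborel. norm (w x * F j (C x)) \<le> norm (w x)" for j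
          using F01 by (auto simp: abs_mult intro!: mult_left_le)
        show "(\<lambda>x. w x * F j (C x)) \<in> borel_measurable lborel" for j
          using measurable_compose[OF C_meas borel_measurable_continuous_onI[OF cF[of j]]]
          by (intro borel_measurable_times) auto
      qed (use w in auto)
      then have "(LBINT x. w x * indicator {p<..<q} (C x)) = 0"
        unfolding P3[OF cF] by (simp add: LIMSEQ_const_iff)
      moreover have "w x * indicator {p<..<q} (C x) = indicator {c<..<d} x *\<^sub>R w x" for x
        using supp[of x] iff[of x]
        by (cases "x \<in> {a<..<b}") (auto simp: indicator_def c'_def d'_def)
      ultimately show ?thesis unfolding set_lebesgue_integral_def by (simp only:)
    qed
  qed
qed

end

section \<open>Almost everywhere convergence of cosine partial sums\<close>

context fourier_interval
begin

text \<open>The zero mode has squared norm b - a, all others half of it, hence the two normalising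
  factors.\<close>

definition psum :: "(real \<Rightarrow> real) \<Rightarrow> nat \<Rightarrow> real \<Rightarrow> real" where
  "psum u N x = coef u 0 / (b - a) * cs 0 x + (\<Sum>n=1..N. 2 / (b - a) * coef u n * cs n x)"

lemma psum_integrable: "integrable lborel (psum u N)"
  unfolding psum_def[abs_def] using cs_integrable
  by (intro Bochner_Integration.integrable_add Bochner_Integration.integrable_sum integrable_mult_right)

lemma psum_outside: "x \<notin> {a<..<b} \<Longrightarrow> psum u N x = 0"
  by (simp add: psum_def cs_def)

lemma coef_psum:
  assumes "n \<le> N"
  shows "coef (psum u N) n = coef u n"
proof -
  have "psum u N x * cs n x = coef u 0 / (b - a) * (cs 0 x * cs n x) + (\<Sum>m=1..N. 2 / (b - a) * coef u m * (cs m x * cs n x))" for x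
    by (simp add: psum_def distrib_right sum_distrib_right mult.assoc)
  then have "coef (psum u N) n = coef u 0 / (b - a) * (LBINT x. cs 0 x * cs n x)
      + (\<Sum>m=1..N. 2 / (b - a) * coef u m * (LBINT x. cs m x * cs n x))"
    unfolding coef_def[of "psum u N"]
    by (simp add: cs_cs_integrable Bochner_Integration.integral_sum Bochner_Integration.integrable_sum)
  also have "\<dots> = coef u n"
  proof (cases "n = 0")
    case True
    have "(\<Sum>m=1..N. 2 / (b - a) * coef u m * (LBINT x. cs m x * cs 0 x)) = 0"
      by (intro sum.neutral ballI) (simp add: cs_orth)
    then show ?thesis using True ab by (simp add: cs0_cs0)
  next
    case False
    have "(\<Sum>m=1..N. 2 / (b - a) * coef u m * (LBINT x. cs m x * cs n x)) = (\<Sum>m=1..N. if m = n then coef u n else 0)"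
      using False ab by (intro sum.cong refl) (simp add: cs_orth)
    also have "\<dots> = coef u n" using False assms by simp
    finally show ?thesis using False by (simp add: cs_orth)
  qed
  finally show ?thesis .
qed

text \<open>Orthogonality gives the L2 distance, and Cauchy-Schwarz on the bounded interval turns it
  into an L1 distance, the norm in which \<open>psum_tendsto_AE\<close> extracts its
  subsequence.\<close>

lemma psum_L1_dist:
  assumes "N \<le> M"
  shows "(LBINT x. \<bar>psum u M x - psum u N x\<bar>)\<^sup>2 \<le> 2 * (\<Sum>n=Suc N..<Suc M. (coef u n)\<^sup>2)"
proof -
  define \<beta> where "\<beta> n = 2 / (b - a) * coef u n" for n
  define D where "D x = psum u M x - psum u N x" for x
  have D: "D x = (\<Sum>n=Suc N..<Suc M. \<beta> n * cs n x)" for x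
  proof -
    have "{1..M} = {1..N} \<union> {Suc N..<Suc M}" using assms by auto
    then have "(\<Sum>n=1..M. \<beta> n * cs n x) = (\<Sum>n=1..N. \<beta> n * cs n x) + (\<Sum>n=Suc N..<Suc M. \<beta> n * cs n x)"
      by (simp only:) (intro sum.union_disjoint; auto)
    then show ?thesis by (simp add: D_def psum_def \<beta>_def)
  qed
  have D2: "integrable lborel (\<lambda>x. (D x)\<^sup>2)" "(LBINT x. (D x)\<^sup>2) = (b - a) / 2 * (\<Sum>n=Suc N..<Suc M. (\<beta> n)\<^sup>2)"
    unfolding D by (rule orthogonal_sum_norm; auto simp: cs_orth intro: cs_cs_integrable)+
  have Di: "integrable lborel D" unfolding D_def[abs_def] by (intro Bochner_Integration.integrable_diff psum_integrable)
  have D0: "D x = 0" if "x \<notin> {a..b}" for x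
    using that psum_outside[of x u] by (auto simp: D_def)
  have i1: "(\<lambda>x. indicator {a..b} x *\<^sub>R \<bar>D x\<bar>) = (\<lambda>x. \<bar>D x\<bar>)" and i2: "(\<lambda>x. indicator {a..b} x *\<^sub>R \<bar>D x\<bar>\<^sup>2) = (\<lambda>x. (D x)\<^sup>2)"
    using D0 by (auto simp: fun_eq_iff indicator_def)
  have "(LBINT x:{a..b}. \<bar>D x\<bar>)\<^sup>2 \<le> (b - a) * (LBINT x:{a..b}. \<bar>D x\<bar>\<^sup>2)"
    using D2(1) Di by (intro cauchy_schwarz_set_integral_1 ab) (simp_all only: set_integrable_def i1 i2 integrable_abs)
  then have "(LBINT x. \<bar>D x\<bar>)\<^sup>2 \<le> (b - a) * (LBINT x. (D x)\<^sup>2)"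
    by (simp only: set_lebesgue_integral_def i1 i2)
  also have "\<dots> = 2 * (\<Sum>n=Suc N..<Suc M. (coef u n)\<^sup>2)"
  proof -
    have "(\<Sum>n=Suc N..<Suc M. (\<beta> n)\<^sup>2) = (2 / (b - a))\<^sup>2 * (\<Sum>n=Suc N..<Suc M. (coef u n)\<^sup>2)"
      by (simp only: \<beta>_def power_mult_distrib sum_distrib_left)
    moreover have "(b - a) * ((b - a) / 2 * ((2 / (b - a))\<^sup>2 * X)) = 2 * X" for X :: real
      using ab by (simp add: power2_eq_square)
    ultimately show ?thesis by (simp only: D2(2))
  qed
  finally show ?thesis unfolding D_def .
qed

lemma psum_L1_cauchy:
  assumes "integrable lborel u" "integrable lborel (\<lambda>x. (u x)\<^sup>2)" and e: "0 < e"
  shows "\<exists>N. \<forall>i\<ge>N. \<forall>j\<ge>N. (LBINT x. \<bar>psum u i x - psum u j x\<bar>) < e"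
proof -
  have "summable (\<lambda>n. (coef u (Suc n))\<^sup>2)"
  proof (rule summableI_nonneg_bounded)
    fix n
    have "(\<Sum>i<n. (coef u (Suc i))\<^sup>2) = (\<Sum>i\<in>Suc ` {..<n}. (coef u i)\<^sup>2)"
      by (subst sum.reindex) auto
    also have "\<dots> \<le> (b - a) / 2 * (LBINT x. (u x)\<^sup>2)"
      using assms by (intro bessel_cs) auto
    finally show "(\<Sum>i<n. (coef u (Suc i))\<^sup>2) \<le> (b - a) / 2 * (LBINT x. (u x)\<^sup>2)" .
  qed simp
  then have "summable (\<lambda>n. (coef u n)\<^sup>2)" by (subst (asm) summable_Suc_iff)
  then obtain N where N: "\<And>m n. m \<ge> N \<Longrightarrow> norm (\<Sum>k=m..<n. (coef u k)\<^sup>2) < e\<^sup>2 / 2"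
    using e unfolding summable_Cauchy by (metis half_gt_zero zero_less_power)
  have *: "(LBINT x. \<bar>psum u i x - psum u j x\<bar>) < e" if "N \<le> j" "j \<le> i" for i j
  proof -
    have "(LBINT x. \<bar>psum u i x - psum u j x\<bar>)\<^sup>2 \<le> 2 * (\<Sum>n=Suc j..<Suc i. (coef u n)\<^sup>2)"
      using that by (intro psum_L1_dist)
    also have "\<dots> < e\<^sup>2" using N[of "Suc j" "Suc i"] that by (simp add: abs_less_iff)
    finally show ?thesis using e by (simp add: power2_less_imp_less)
  qed
  have "(LBINT x. \<bar>psum u i x - psum u j x\<bar>) < e" if "N \<le> j" "N \<le> i" for i j
    using *[of i j] *[of j i] that by (cases "i \<le> j") (auto simp: abs_minus_commute)
  then show ?thesis by blast
qed

text \<open>The partial sums are Cauchy in L1, so a subsequence converges almost everywhere to some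
  \<open>v\<close>. This \<open>v\<close> has the cosine coefficients of \<open>u\<close>, and
  completeness identifies the two.\<close>

lemma psum_tendsto_AE:
  assumes u: "integrable lborel u" and u2: "integrable lborel (\<lambda>x. (u x)\<^sup>2)"
    and u0: "\<And>x. x \<notin> {a<..<b} \<Longrightarrow> u x = 0"
  obtains r where "strict_mono r" "AE x in lborel. (\<lambda>i. psum u (r i) x) \<longlonglongrightarrow> u x"
proof -
  have "\<exists>N. \<forall>i\<ge>N. \<forall>j\<ge>N. (LBINT x. norm (psum u i x - psum u j x)) < e" if "e > 0" for e
    using psum_L1_cauchy[OF u u2 that] by simp
  then obtain r where r: "strict_mono r" "AE x in lborel. Cauchy (\<lambda>i. psum u (r i) x)"
    using cauchy_L1_AE_cauchy_subseq[of lborel "psum u"] psum_integrable by blast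
  have [measurable]: "psum u N \<in> borel_measurable borel" for N
    using psum_integrable[of u N] by auto
  define v where "v x = lim (\<lambda>i. psum u (r i) x)" for x
  have [measurable]: "v \<in> borel_measurable borel" unfolding v_def[abs_def] by measurable
  have v: "AE x in lborel. (\<lambda>i. psum u (r i) x) \<longlonglongrightarrow> v x"
    using r(2) by eventually_elim (simp add: v_def Cauchy_convergent convergent_LIMSEQ_iff[symmetric])
  have v0: "v x = 0" if "x \<notin> {a<..<b}" for x
    using that by (simp add: v_def psum_outside)
  \<comment> \<open>Fatou along the subsequence transfers the Cauchy estimate to the limit; it
    yields both the integrability of \<open>v\<close> and the equality of coefficients.\<close>
  have fatou: "\<exists>N. \<forall>j\<ge>N. (\<integral>\<^sup>+x. ennreal \<bar>v x - psum u j x\<bar> \<partial>lborel) \<le> ennreal e" if "e > 0" for e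
  proof -
    obtain N where N: "\<And>i j. i \<ge> N \<Longrightarrow> j \<ge> N \<Longrightarrow> (LBINT x. \<bar>psum u i x - psum u j x\<bar>) < e"
      using psum_L1_cauchy[OF u u2 \<open>e > 0\<close>] by blast
    have "(\<integral>\<^sup>+x. ennreal \<bar>v x - psum u j x\<bar> \<partial>lborel) \<le> ennreal e" if "j \<ge> N" for j
    proof -
      have "(\<integral>\<^sup>+x. ennreal \<bar>v x - psum u j x\<bar> \<partial>lborel) = (\<integral>\<^sup>+x. liminf (\<lambda>i. ennreal \<bar>psum u (r i) x - psum u j x\<bar>) \<partial>lborel)"
      proof (rule nn_integral_cong_AE)
        show "AE x in lborel. ennreal \<bar>v x - psum u j x\<bar> = liminf (\<lambda>i. ennreal \<bar>psum u (r i) x - psum u j x\<bar>)"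
          using v
        proof eventually_elim
          case (elim x)
          have "(\<lambda>i. ennreal \<bar>psum u (r i) x - psum u j x\<bar>) \<longlonglongrightarrow> ennreal \<bar>v x - psum u j x\<bar>"
            by (intro tendsto_ennrealI tendsto_rabs tendsto_diff elim tendsto_const)
          then show ?case by (rule lim_imp_Liminf[OF sequentially_bot, symmetric])
        qed
      qed
      also have "\<dots> \<le> liminf (\<lambda>i. \<integral>\<^sup>+x. ennreal \<bar>psum u (r i) x - psum u j x\<bar> \<partial>lborel)"
        by (rule nn_integral_liminf) measurable
      also have "\<dots> \<le> ennreal e"
      proof (rule Liminf_le[OF sequentially_bot])
        show "\<forall>\<^sub>F i in sequentially. (\<integral>\<^sup>+x. ennreal \<bar>psum u (r i) x - psum u j x\<bar> \<partial>lborel) \<le> ennreal e"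
          using eventually_ge_at_top[of N]
        proof eventually_elim
          case (elim i)
          have "N \<le> r i" using elim seq_suble[OF r(1), of i] by simp
          then have "(LBINT x. \<bar>psum u (r i) x - psum u j x\<bar>) \<le> e"
            using N[of "r i" j] that by simp
          moreover have "(\<integral>\<^sup>+x. ennreal \<bar>psum u (r i) x - psum u j x\<bar> \<partial>lborel) = ennreal (LBINT x. \<bar>psum u (r i) x - psum u j x\<bar>)"
            by (intro nn_integral_eq_integral integrable_abs Bochner_Integration.integrable_diff psum_integrable) simp
          ultimately show ?case by (simp add: ennreal_leI)
        qed
      qed
      finally show ?thesis .
    qed
    then show ?thesis by blast
  qed
  have vi: "integrable lborel v"
  proof -
    obtain j where j: "(\<integral>\<^sup>+x. ennreal \<bar>v x - psum u j x\<bar> \<partial>lborel) \<le> ennreal 1" using fatou[of 1] by auto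
    have "integrable lborel (\<lambda>x. v x - psum u j x)"
      using j by (intro integrableI_bounded) (auto intro: le_less_trans)
    from Bochner_Integration.integrable_add[OF this psum_integrable[of u j]] show ?thesis by simp
  qed
  have coef_v: "coef v n = coef u n" for n
  proof -
    have "\<bar>coef v n - coef u n\<bar> \<le> 0 + e" if e: "e > 0" for e
    proof -
      obtain N where N: "\<forall>j\<ge>N. (\<integral>\<^sup>+x. ennreal \<bar>v x - psum u j x\<bar> \<partial>lborel) \<le> ennreal e" using fatou[OF e] by blast
      \<comment> \<open>For \<open>j\<close> at least \<open>n\<close> the n-th coefficient of the
        partial sum is exactly that of \<open>u\<close>.\<close>
      define j where "j = max N n"
      have i: "integrable lborel (\<lambda>x. v x - psum u j x)" by (intro Bochner_Integration.integrable_diff vi psum_integrable)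
      have "ennreal (LBINT x. \<bar>v x - psum u j x\<bar>) \<le> ennreal e"
        using N i by (subst nn_integral_eq_integral[symmetric]) (auto simp: j_def)
      then have le: "(LBINT x. \<bar>v x - psum u j x\<bar>) \<le> e" using e by simp
      have "coef v n - coef u n = coef v n - coef (psum u j) n" by (simp add: coef_psum j_def)
      also have "\<dots> = (LBINT x. (v x - psum u j x) * cs n x)"
        unfolding coef_def using mult_cs_integrable[OF vi] mult_cs_integrable[OF psum_integrable]
        by (simp add: left_diff_distrib)
      also have "\<bar>\<dots>\<bar> \<le> (LBINT x. \<bar>(v x - psum u j x) * cs n x\<bar>)"
        using integral_norm_bound[of lborel "\<lambda>x. (v x - psum u j x) * cs n x"] by simp
      also have "\<dots> \<le> (LBINT x. \<bar>v x - psum u j x\<bar>)"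
        using i mult_cs_integrable[OF i] cs_bound by (intro integral_mono integrable_abs) (auto simp: abs_mult intro!: mult_left_le)
      finally show ?thesis using le by simp
    qed
    then show ?thesis using field_le_epsilon[of "\<bar>coef v n - coef u n\<bar>" 0] by simp
  qed
  have "AE x in lborel. u x - v x = 0"
  proof (rule cosine_system_complete)
    show "integrable lborel (\<lambda>x. u x - v x)" using u vi by simp
    show "u x - v x = 0" if "x \<notin> {a<..<b}" for x using u0[OF that] v0[OF that] by simp
    fix n
    have "coef (\<lambda>x. u x - v x) n = coef u n - coef v n"
      unfolding coef_def using mult_cs_integrable[OF u] mult_cs_integrable[OF vi] by (simp add: left_diff_distrib)
    then show "coef (\<lambda>x. u x - v x) n = 0" using coef_v by simp
  qed
  with v have "AE x in lborel. (\<lambda>i. psum u (r i) x) \<longlonglongrightarrow> u x"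
    by eventually_elim simp
  then show ?thesis using that r(1) by blast
qed

end

section \<open>The Gagliardo seminorm of a cosine series\<close>

lemma nn_integral_inverse_1_plus_square:
  "(\<integral>\<^sup>+s. ennreal (inverse (1 + s\<^sup>2)) \<partial>lborel) = ennreal pi"
proof -
  define f :: "real \<Rightarrow> ennreal" where "f s = ennreal (inverse (1 + s\<^sup>2))" for s
  have cf: "continuous_on UNIV (\<lambda>s::real. inverse (1 + s\<^sup>2))"
    by (intro continuous_intros) (auto simp: add_nonneg_eq_0_iff)
  then have m: "(\<lambda>s::real. inverse (1 + s\<^sup>2)) \<in> borel_measurable borel"
    by (rule borel_measurable_continuous_onI)
  then have [measurable]: "f \<in> borel_measurable borel" unfolding f_def[abs_def] by simp
  have half: "(\<integral>\<^sup>+s. f s * indicator {0..} s \<partial>lborel) = ennreal (pi / 2)"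
    unfolding f_def
    by (subst nn_integral_FTC_atLeast[OF m, where F = arctan and T = "pi / 2"])
      (auto intro!: DERIV_arctan tendsto_arctan_at_top)
  have "(\<integral>\<^sup>+s. f s * indicator {..0} s \<partial>lborel) = ennreal \<bar>-1\<bar> * (\<integral>\<^sup>+s. f (0 + (-1) * s) * indicator {..0} (0 + (-1) * s) \<partial>lborel)"
    by (rule nn_integral_real_affine) auto
  also have "(\<lambda>s. f (0 + (-1) * s) * indicator {..0} (0 + (-1) * s)) = (\<lambda>s. f s * indicator {0..} s)"
    by (auto simp: f_def indicator_def fun_eq_iff)
  finally have neg: "(\<integral>\<^sup>+s. f s * indicator {..0} s \<partial>lborel) = ennreal (pi / 2)" using half by simp
  have "(\<integral>\<^sup>+s. f s \<partial>lborel) = (\<integral>\<^sup>+s. f s * indicator {0..} s + f s * indicator {..0} s \<partial>lborel)"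
  proof (rule nn_integral_cong_AE)
    show "AE s in lborel. f s = f s * indicator {0..} s + f s * indicator {..0} s"
      using AE_lborel_singleton[of "0::real"] by eventually_elim (auto simp: indicator_def)
  qed
  also have "\<dots> = ennreal (pi / 2) + ennreal (pi / 2)"
    using half neg by (subst nn_integral_add) auto
  also have "\<dots> = ennreal pi" by (simp flip: ennreal_plus)
  finally show ?thesis by (simp add: f_def)
qed

text \<open>An integrable majorant of Cauchy type reduces this to the arctangent integral. The
  growth linear in \<open>m\<close> is what makes the seminorm count half a derivative.\<close>

lemma nn_integral_sin_sq_bound:
  assumes "0 < m"
  shows "(\<integral>\<^sup>+s. ennreal (4 * (sin (m * s / 2))\<^sup>2 / s\<^sup>2) \<partial>lborel) \<le> ennreal (5 * pi * m)"
proof -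
  have cf: "(\<lambda>s::real. ennreal (inverse (1 + s\<^sup>2))) \<in> borel_measurable borel" by measurable
  \<comment> \<open>With t = m s / 2, the bounds t^2 and 1 for the squared sine give sin(t)^2 (1 + 4
    t^2) <= 5 t^2. At s = 0 the left-hand quotient is 0 by the convention on division.\<close>
  have pt: "4 * (sin (m * s / 2))\<^sup>2 / s\<^sup>2 \<le> 5 * m\<^sup>2 * inverse (1 + (m * s)\<^sup>2)" for s
  proof (cases "s = 0")
    case False
    define t where "t = m * s / 2"
    have "\<bar>sin t\<bar> \<le> \<bar>t\<bar>" by (rule abs_sin_x_le_abs_x)
    then have 1: "(sin t)\<^sup>2 \<le> t\<^sup>2" by (simp add: abs_le_square_iff)
    have 2: "t\<^sup>2 * (sin t)\<^sup>2 \<le> t\<^sup>2 * 1" by (intro mult_left_mono) (auto simp: abs_square_le_1)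
    have "(sin t)\<^sup>2 * (1 + 4 * t\<^sup>2) \<le> 5 * t\<^sup>2" using 1 2 by (simp add: algebra_simps)
    then have "4 * (sin t)\<^sup>2 * (1 + (m * s)\<^sup>2) \<le> 5 * m\<^sup>2 * s\<^sup>2"
      by (simp add: t_def power_mult_distrib power_divide)
    moreover have "0 < 1 + (m * s)\<^sup>2" by (simp add: add_pos_nonneg)
    ultimately show ?thesis using False unfolding t_def[symmetric] by (simp add: field_simps)
  qed simp
  have "(\<integral>\<^sup>+s. ennreal (4 * (sin (m * s / 2))\<^sup>2 / s\<^sup>2) \<partial>lborel)
      \<le> (\<integral>\<^sup>+s. ennreal (5 * m\<^sup>2) * ennreal (inverse (1 + (0 + m * s)\<^sup>2)) \<partial>lborel)"
    using pt by (intro nn_integral_mono) (simp add: ennreal_mult'[symmetric] ennreal_leI)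
  also have "\<dots> = ennreal (5 * m\<^sup>2) * (\<integral>\<^sup>+s. ennreal (inverse (1 + (0 + m * s)\<^sup>2)) \<partial>lborel)"
    by (rule nn_integral_cmult) measurable
  also have "ennreal (5 * m\<^sup>2) = ennreal (5 * m) * ennreal \<bar>m\<bar>"
    using assms by (simp add: ennreal_mult[symmetric] power2_eq_square)
  also have "ennreal (5 * m) * ennreal \<bar>m\<bar> * (\<integral>\<^sup>+s. ennreal (inverse (1 + (0 + m * s)\<^sup>2)) \<partial>lborel) =
      ennreal (5 * m) * ennreal pi"
    using nn_integral_real_affine[OF cf, of m 0] assms
    by (simp add: nn_integral_inverse_1_plus_square mult.assoc)
  also have "\<dots> = ennreal (5 * pi * m)" using assms by (simp add: ennreal_mult[symmetric] mult_ac)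
  finally show ?thesis .
qed

context fourier_interval
begin

text \<open>The doubled interval is a full period of all these sines, so orthogonality survives an
  arbitrary shift \<open>t\<close>; over (a, b) alone it would in general be lost.\<close>

lemma shifted_sine_orth:
  fixes t :: real
  defines "e \<equiv> \<lambda>n x. indicator {a..2 * b - a} x * sin (real n * om * (x - a + t))"
  assumes "n \<noteq> 0" "m \<noteq> 0"
  shows "integrable lborel (\<lambda>x. e n x * e m x)"
    and "(LBINT x. e n x * e m x) = (if n = m then b - a else 0)"
proof -
  define f where "f k x = indicator {a..2 * b - a} x * cos (of_int k * om * (x - a + t))" for k :: int and x
  have fi: "integrable lborel (f k)" for k
  proof -
    have "set_integrable lborel {a..2 * b - a} (\<lambda>x. cos (of_int k * om * (x - a + t)))"
      by (intro borel_integrable_atLeastAtMost' continuous_intros)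
    then show ?thesis by (simp add: set_integrable_def f_def[abs_def])
  qed
  have fv: "(LBINT x. f k x) = (if k = 0 then 2 * (b - a) else 0)" for k
  proof (cases "k = 0")
    case True
    then show ?thesis using ab by (simp add: f_def[abs_def])
  next
    case False
    have "(LBINT x. f k x) = (LBINT x:{a..2 * b - a}. cos (of_int k * om * x + of_int k * om * (t - a)))"
      unfolding set_lebesgue_integral_def f_def by (simp add: algebra_simps)
    also have "\<dots> = (sin (of_int k * om * (2 * b - a) + of_int k * om * (t - a)) - sin (of_int k * om * a + of_int k * om * (t - a))) / (of_int k * om)"
      using False om_pos ab by (intro integral_cos_affine) auto
    also have "of_int k * om * (2 * b - a) + of_int k * om * (t - a) = (of_int k * om * a + of_int k * om * (t - a)) + of_int k * (2 * pi)"
    proof -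
      have "of_int k * om * (2 * b - a) + of_int k * om * (t - a) = (of_int k * om * a + of_int k * om * (t - a)) + of_int k * (2 * (om * (b - a)))"
        by (simp add: algebra_simps)
      then show ?thesis by (simp only: om_ba)
    qed
    also have "sin ((of_int k * om * a + of_int k * om * (t - a)) + of_int k * (2 * pi)) = sin (of_int k * om * a + of_int k * om * (t - a))"
      using sin.plus_of_int[of "of_int k * om * a + of_int k * om * (t - a)" k] by simp
    finally show ?thesis using False by simp
  qed
  have arg: "real n * om * (x - a + t) - real m * om * (x - a + t) = of_int (int n - int m) * om * (x - a + t)"
    "real n * om * (x - a + t) + real m * om * (x - a + t) = of_int (int n + int m) * om * (x - a + t)" for x
    by (simp_all add: algebra_simps)
  have 1: "e n x * e m x = (f (int n - int m) x - f (int n + int m) x) / 2" for x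
    unfolding e_def f_def arg[symmetric] by (auto simp: sin_times_sin indicator_def)
  show "integrable lborel (\<lambda>x. e n x * e m x)" unfolding 1 using fi by simp
  show "(LBINT x. e n x * e m x) = (if n = m then b - a else 0)"
    unfolding 1 using fi assms by (auto simp: fv)
qed

definition gagliardo :: "(real \<Rightarrow> real) \<Rightarrow> ennreal" where
  "gagliardo u = (\<integral>\<^sup>+ x\<in>{a<..<b}. (\<integral>\<^sup>+ y\<in>{a<..<b}. ennreal ((u x - u y)\<^sup>2 / (x - y)\<^sup>2) \<partial>lborel) \<partial>lborel)"

text \<open>A difference of cosines is a product of two sines, one depending only on
  \<open>s\<close> and one a shifted sine in x. Enlarging the domain to the full period [a, 2b - a]
  makes the sum orthogonal, so only the diagonal terms remain.\<close>

lemma translation_difference_norm: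
  fixes \<gamma> :: "nat \<Rightarrow> real" and N :: nat
  defines "T \<equiv> \<lambda>x. \<Sum>n=1..N. \<gamma> n * cos (real n * om * (x - a))"
  shows "(\<integral>\<^sup>+x\<in>{a<..<b}. ennreal ((T x - T (x + s))\<^sup>2 / s\<^sup>2) \<partial>lborel)
     \<le> (\<Sum>n=1..N. ennreal ((b - a) * (\<gamma> n)\<^sup>2) * ennreal (4 * (sin (real n * om * s / 2))\<^sup>2 / s\<^sup>2))"
proof -
  define e where "e = (\<lambda>n x. indicator {a..2 * b - a} x * sin (real n * om * (x - a + s / 2)))"
  define \<beta> where "\<beta> n = 2 * \<gamma> n * sin (real n * om * s / 2)" for n
  have diff: "indicator {a..2 * b - a} x * (T x - T (x + s)) = (\<Sum>n=1..N. \<beta> n * e n x)" for x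
  proof -
    have "cos (real n * om * (x - a)) - cos (real n * om * (x + s - a)) = 2 * sin (real n * om * s / 2) * sin (real n * om * (x - a + s / 2))" for n
      by (subst cos_diff_cos) (simp add: field_simps)
    then have "\<gamma> n * cos (real n * om * (x - a)) - \<gamma> n * cos (real n * om * (x + s - a)) = \<beta> n * sin (real n * om * (x - a + s / 2))" for n
      by (simp add: \<beta>_def mult_ac flip: right_diff_distrib)
    then show ?thesis
      unfolding T_def e_def sum_subtractf[symmetric] by (simp add: sum_distrib_left mult_ac)
  qed
  have o: "integrable lborel (\<lambda>x. (\<Sum>n=1..N. \<beta> n * e n x)\<^sup>2)" "(LBINT x. (\<Sum>n=1..N. \<beta> n * e n x)\<^sup>2) = (b - a) * (\<Sum>n=1..N. (\<beta> n)\<^sup>2)"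
    by (rule orthogonal_sum_norm; auto simp: shifted_sine_orth e_def)+
  have "(\<integral>\<^sup>+x\<in>{a<..<b}. ennreal ((T x - T (x + s))\<^sup>2 / s\<^sup>2) \<partial>lborel) \<le> (\<integral>\<^sup>+x. ennreal ((\<Sum>n=1..N. \<beta> n * e n x)\<^sup>2 / s\<^sup>2) \<partial>lborel)"
    unfolding diff[symmetric] using ab by (intro nn_integral_mono) (auto simp: indicator_def)
  also have "\<dots> = ennreal ((b - a) * (\<Sum>n=1..N. (\<beta> n)\<^sup>2) / s\<^sup>2)"
    using o by (subst nn_integral_eq_integral) auto
  also have "(b - a) * (\<Sum>n=1..N. (\<beta> n)\<^sup>2) / s\<^sup>2 = (\<Sum>n=1..N. ((b - a) * (\<gamma> n)\<^sup>2) * (4 * (sin (real n * om * s / 2))\<^sup>2 / s\<^sup>2))"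
    by (simp add: \<beta>_def sum_distrib_left sum_divide_distrib power_mult_distrib mult_ac)
  also have "ennreal \<dots> = (\<Sum>n=1..N. ennreal (((b - a) * (\<gamma> n)\<^sup>2) * (4 * (sin (real n * om * s / 2))\<^sup>2 / s\<^sup>2)))"
    using ab by (intro sum_ennreal[symmetric]) simp
  also have "\<dots> = (\<Sum>n=1..N. ennreal ((b - a) * (\<gamma> n)\<^sup>2) * ennreal (4 * (sin (real n * om * s / 2))\<^sup>2 / s\<^sup>2))"
    using ab by (intro sum.cong refl ennreal_mult) auto
  finally show ?thesis .
qed

text \<open>\<open>T\<close> is defined on the whole line, so y may range over all reals; then y = x
  + s and Tonelli reduce the seminorm to translation differences, mode by mode.\<close>

lemma gagliardo_trig_sum:
  fixes \<gamma> :: "nat \<Rightarrow> real" and N :: nat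
  defines "T \<equiv> \<lambda>x. \<Sum>n=1..N. \<gamma> n * cos (real n * om * (x - a))"
  shows "gagliardo T \<le> ennreal (5 * pi\<^sup>2) * (\<Sum>n=1..N. ennreal (real n * (\<gamma> n)\<^sup>2))"
proof -
  have cT: "continuous_on UNIV T" unfolding T_def by (intro continuous_intros)
  have T_meas[measurable]: "T \<in> borel_measurable borel" using cT by (rule borel_measurable_continuous_onI)
  have "gagliardo T \<le> (\<integral>\<^sup>+ x\<in>{a<..<b}. (\<integral>\<^sup>+ s. ennreal ((T x - T (x + s))\<^sup>2 / s\<^sup>2) \<partial>lborel) \<partial>lborel)"
    unfolding gagliardo_def
  proof (rule nn_integral_mono, rule mult_right_mono)
    fix x
    have "(\<integral>\<^sup>+ y\<in>{a<..<b}. ennreal ((T x - T y)\<^sup>2 / (x - y)\<^sup>2) \<partial>lborel) \<le> (\<integral>\<^sup>+ y. ennreal ((T x - T y)\<^sup>2 / (x - y)\<^sup>2) \<partial>lborel)"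
      by (intro nn_integral_mono) (auto simp: indicator_def)
    also have "\<dots> = ennreal \<bar>1\<bar> * (\<integral>\<^sup>+ s. ennreal ((T x - T (x + 1 * s))\<^sup>2 / (x - (x + 1 * s))\<^sup>2) \<partial>lborel)"
      by (rule nn_integral_real_affine) measurable
    finally show "(\<integral>\<^sup>+ y\<in>{a<..<b}. ennreal ((T x - T y)\<^sup>2 / (x - y)\<^sup>2) \<partial>lborel) \<le> (\<integral>\<^sup>+ s. ennreal ((T x - T (x + s))\<^sup>2 / s\<^sup>2) \<partial>lborel)"
      by simp
  qed simp
  also have "\<dots> = (\<integral>\<^sup>+ x. (\<integral>\<^sup>+ s. ennreal ((T x - T (x + s))\<^sup>2 / s\<^sup>2) * indicator {a<..<b} x \<partial>lborel) \<partial>lborel)"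
    by (intro nn_integral_cong nn_integral_multc[symmetric]) measurable
  also have "\<dots> = (\<integral>\<^sup>+ s. (\<integral>\<^sup>+ x. ennreal ((T x - T (x + s))\<^sup>2 / s\<^sup>2) * indicator {a<..<b} x \<partial>lborel) \<partial>lborel)"
    by (rule lborel_pair.Fubini') measurable
  also have "\<dots> \<le> (\<integral>\<^sup>+ s. (\<Sum>n=1..N. ennreal ((b - a) * (\<gamma> n)\<^sup>2) * ennreal (4 * (sin (real n * om * s / 2))\<^sup>2 / s\<^sup>2)) \<partial>lborel)"
    unfolding T_def by (intro nn_integral_mono translation_difference_norm)
  also have "\<dots> = (\<Sum>n=1..N. ennreal ((b - a) * (\<gamma> n)\<^sup>2) * (\<integral>\<^sup>+ s. ennreal (4 * (sin (real n * om * s / 2))\<^sup>2 / s\<^sup>2) \<partial>lborel))"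
    by (subst nn_integral_sum) (auto intro!: sum.cong nn_integral_cmult)
  also have "\<dots> \<le> (\<Sum>n=1..N. ennreal ((b - a) * (\<gamma> n)\<^sup>2) * ennreal (5 * pi * (real n * om)))"
    using om_pos by (intro sum_mono mult_left_mono nn_integral_sin_sq_bound) auto
  also have "\<dots> = (\<Sum>n=1..N. ennreal (5 * pi\<^sup>2) * ennreal (real n * (\<gamma> n)\<^sup>2))"
  \<comment> \<open>The length b - a from orthogonality cancels against \<open>om\<close>, because
    their product is pi.\<close>
  proof (intro sum.cong refl)
    fix n
    have "(b - a) * (\<gamma> n)\<^sup>2 * (5 * pi * (real n * om)) = (om * (b - a)) * (5 * pi * (real n * (\<gamma> n)\<^sup>2))" by (simp add: mult_ac)
    also have "\<dots> = 5 * pi\<^sup>2 * (real n * (\<gamma> n)\<^sup>2)" by (simp add: om_ba power2_eq_square)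
    finally show "ennreal ((b - a) * (\<gamma> n)\<^sup>2) * ennreal (5 * pi * (real n * om)) = ennreal (5 * pi\<^sup>2) * ennreal (real n * (\<gamma> n)\<^sup>2)"
      using ab om_pos by (simp add: ennreal_mult[symmetric])
  qed
  finally show ?thesis by (simp only: sum_distrib_left)
qed

text \<open>The bound for finite sums passes to \<open>u\<close> along the almost everywhere
  convergent subsequence, by Fatou once in y and once in x.\<close>

lemma gagliardo_le_coef_series:
  assumes u: "integrable lborel u" and u2: "integrable lborel (\<lambda>x. (u x)\<^sup>2)"
    and u0: "\<And>x. x \<notin> {a<..<b} \<Longrightarrow> u x = 0"
  shows "gagliardo u \<le> ennreal (5 * pi\<^sup>2 * (2 / (b - a))\<^sup>2) * (\<Sum>n. ennreal (real n * (coef u n)\<^sup>2))" (is "_ \<le> ?B")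
proof -
  have [measurable]: "u \<in> borel_measurable borel" using u by auto
  obtain r where r: "strict_mono r" "AE x in lborel. (\<lambda>i. psum u (r i) x) \<longlonglongrightarrow> u x"
    using psum_tendsto_AE[OF u u2 u0] by blast
  define \<gamma> where "\<gamma> n = 2 / (b - a) * coef u n" for n
  define T where "T N x = (\<Sum>n=1..N. \<gamma> n * cos (real n * om * (x - a)))" for N x
  have T_meas[measurable]: "T N \<in> borel_measurable borel" for N
    unfolding T_def[abs_def] by (intro borel_measurable_continuous_onI continuous_intros)
  \<comment> \<open>Inside the interval \<open>psum\<close> and \<open>T\<close> differ by the
    constant zero mode, which cancels here; unlike \<open>psum\<close>, \<open>T\<close> is not cut
    off and can be translated.\<close>
  have diff: "psum u N x - psum u N y = T N x - T N y" if "x \<in> {a<..<b}" "y \<in> {a<..<b}" for N x y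
    using that by (simp add: psum_def T_def cs_def \<gamma>_def)
  define g where "g i x y = ennreal ((T (r i) x - T (r i) y)\<^sup>2 / (x - y)\<^sup>2) * indicator {a<..<b} y" for i x y
  have lim: "(\<lambda>i. g i x y) \<longlonglongrightarrow> ennreal ((u x - u y)\<^sup>2 / (x - y)\<^sup>2) * indicator {a<..<b} y"
    if x: "x \<in> {a<..<b}" "(\<lambda>i. psum u (r i) x) \<longlonglongrightarrow> u x" and y: "(\<lambda>i. psum u (r i) y) \<longlonglongrightarrow> u y" for x y
  proof (cases "y \<in> {a<..<b}")
    case True
    have "(\<lambda>i. ennreal ((psum u (r i) x - psum u (r i) y)\<^sup>2 / (x - y)\<^sup>2)) \<longlonglongrightarrow> ennreal ((u x - u y)\<^sup>2 / (x - y)\<^sup>2)"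
    proof (cases "x = y")
      case False
      then show ?thesis using x y by (intro tendsto_ennrealI tendsto_intros) auto
    qed simp
    then show ?thesis using True x by (simp add: g_def diff)
  qed (simp add: g_def)
  have "gagliardo u = (\<integral>\<^sup>+ x. (\<integral>\<^sup>+ y. ennreal ((u x - u y)\<^sup>2 / (x - y)\<^sup>2) * indicator {a<..<b} y \<partial>lborel) * indicator {a<..<b} x \<partial>lborel)"
    by (simp add: gagliardo_def)
  also have "\<dots> \<le> (\<integral>\<^sup>+ x. liminf (\<lambda>i. (\<integral>\<^sup>+ y. g i x y \<partial>lborel) * indicator {a<..<b} x) \<partial>lborel)"
  proof (rule nn_integral_mono_AE)
    show "AE x in lborel. (\<integral>\<^sup>+ y. ennreal ((u x - u y)\<^sup>2 / (x - y)\<^sup>2) * indicator {a<..<b} y \<partial>lborel) * indicator {a<..<b} x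
        \<le> liminf (\<lambda>i. (\<integral>\<^sup>+ y. g i x y \<partial>lborel) * indicator {a<..<b} x)"
      using r(2)
    proof eventually_elim
      case (elim x)
      show ?case
      proof (cases "x \<in> {a<..<b}")
        case True
        have "(\<integral>\<^sup>+ y. ennreal ((u x - u y)\<^sup>2 / (x - y)\<^sup>2) * indicator {a<..<b} y \<partial>lborel) = (\<integral>\<^sup>+ y. liminf (\<lambda>i. g i x y) \<partial>lborel)"
        proof (rule nn_integral_cong_AE)
          show "AE y in lborel. ennreal ((u x - u y)\<^sup>2 / (x - y)\<^sup>2) * indicator {a<..<b} y = liminf (\<lambda>i. g i x y)"
            using r(2) by eventually_elim (use lim[OF True elim] in \<open>auto intro: lim_imp_Liminf[OF sequentially_bot, symmetric]\<close>)
        qed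
        also have "\<dots> \<le> liminf (\<lambda>i. \<integral>\<^sup>+ y. g i x y \<partial>lborel)"
          unfolding g_def by (rule nn_integral_liminf) measurable
        finally show ?thesis using True by simp
      qed simp
    qed
  qed
  also have "\<dots> \<le> liminf (\<lambda>i. \<integral>\<^sup>+ x. (\<integral>\<^sup>+ y. g i x y \<partial>lborel) * indicator {a<..<b} x \<partial>lborel)"
    unfolding g_def by (rule nn_integral_liminf) measurable
  also have "\<dots> = liminf (\<lambda>i. gagliardo (T (r i)))" by (simp add: gagliardo_def g_def)
  also have "\<dots> \<le> ?B"
  proof (rule Liminf_le[OF sequentially_bot], rule always_eventually, rule allI)
    fix i
    have 1: "gagliardo (T (r i)) \<le> ennreal (5 * pi\<^sup>2) * (\<Sum>n=1..r i. ennreal (real n * (\<gamma> n)\<^sup>2))"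
      unfolding T_def[abs_def] by (rule gagliardo_trig_sum)
    have "(\<Sum>n=1..r i. ennreal (real n * (\<gamma> n)\<^sup>2)) = ennreal ((2 / (b - a))\<^sup>2) * (\<Sum>n=1..r i. ennreal (real n * (coef u n)\<^sup>2))"
      unfolding sum_distrib_left
    proof (intro sum.cong refl)
      fix n
      have eq: "real n * (\<gamma> n)\<^sup>2 = (2 / (b - a))\<^sup>2 * (real n * (coef u n)\<^sup>2)"
        unfolding \<gamma>_def by (simp only: power_mult_distrib mult_ac)
      show "ennreal (real n * (\<gamma> n)\<^sup>2) = ennreal ((2 / (b - a))\<^sup>2) * ennreal (real n * (coef u n)\<^sup>2)"
        unfolding eq by (intro ennreal_mult) auto
    qed
    also have "\<dots> \<le> ennreal ((2 / (b - a))\<^sup>2) * (\<Sum>n. ennreal (real n * (coef u n)\<^sup>2))"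
      by (intro mult_left_mono sum_le_suminf) auto
    finally have "gagliardo (T (r i)) \<le> ennreal (5 * pi\<^sup>2) * (ennreal ((2 / (b - a))\<^sup>2) * (\<Sum>n. ennreal (real n * (coef u n)\<^sup>2)))"
      by (intro order_trans[OF 1] mult_left_mono) auto
    then show "gagliardo (T (r i)) \<le> ?B"
      by (subst ennreal_mult) (auto simp only: mult.assoc zero_le_mult_iff zero_le_power2 zero_le_numeral)
  qed
  finally show ?thesis .
qed

end

section \<open>The one-dimensional inequality for weak derivatives on (-1, 1)\<close>

lemma test1_deriv:
  assumes "test1 a b \<eta>"
  shows "test1 a b (deriv \<eta>)"
proof -
  obtain c d where cd: "a < c" "d < b" "\<And>x. x \<notin> {c..d} \<Longrightarrow> \<eta> x = 0" and s: "smooth1 \<eta>"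
    using assms by (auto simp: test1_def)
  have "deriv \<eta> x = 0" if "x \<notin> {c..d}" for x
  proof -
    have "((\<lambda>x. 0) has_real_derivative 0) (at x)" by simp
    then have "(\<eta> has_real_derivative 0) (at x)"
      by (rule has_field_derivative_transform_within_open[where S = "- {c..d}"]) (use that cd(3) in \<open>auto simp: open_Compl\<close>)
    then show ?thesis by (rule DERIV_imp_deriv)
  qed
  then show ?thesis unfolding test1_def using cd(1,2) smooth1_deriv(2)[OF s] by blast
qed

lemma set_integral_reflect:
  fixes f :: "real \<Rightarrow> real"
  shows "(LBINT x:{p..q}. f (- x)) = (LBINT x:{-q..-p}. f x)"
proof -
  have "(LBINT x. indicator {-q..-p} x *\<^sub>R f x) = \<bar>-1\<bar> *\<^sub>R (LBINT x. indicator {-q..-p} (0 + (-1) * x) *\<^sub>R f (0 + (-1) * x))"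
    by (rule lborel_integral_real_affine) simp
  also have "(\<lambda>x. indicator {-q..-p} (0 + (-1) * x) *\<^sub>R f (0 + (-1) * x)) = (\<lambda>x. indicator {p..q} x *\<^sub>R f (- x))"
    by (auto simp: indicator_def fun_eq_iff)
  finally show ?thesis by (simp add: set_lebesgue_integral_def)
qed

text \<open>The half-interval inequality is applied to \<open>f\<close> and to its reflection x -> f
  (-x), whose derivatives are -F (-x) and k (-x), and the two are added.\<close>

lemma primitive_weighted_interpolation:
  fixes f F k :: "real \<Rightarrow> real"
  assumes fd: "\<And>x. x \<in> {-1..1} \<Longrightarrow> (f has_real_derivative F x) (at x within {-1..1})"
    and Fe: "\<And>x. x \<in> {-1..1} \<Longrightarrow> F x = C + (LBINT s:{-1..x}. k s)"
    and k: "integrable lborel k" and k2: "integrable lborel (\<lambda>x. (k x)\<^sup>2)" and n: "1 \<le> n"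
  shows "n * (LBINT x:{-1..1}. \<bar>x\<bar> * (F x)\<^sup>2)
    \<le> 21000 * (n\<^sup>2 * (LBINT x:{-1..1}. (x * f x)\<^sup>2) + (LBINT x:{-1..1}. (k x)\<^sup>2))"
proof -
  have ks: "set_integrable lborel A k" if "A \<in> sets borel" for A
    unfolding set_integrable_def using k that by (intro integrable_mult_indicator) auto
  have k2s: "set_integrable lborel {-1..1} (\<lambda>x. (k x)\<^sup>2)"
    unfolding set_integrable_def using k2 by (intro integrable_mult_indicator) auto
  have Fdiff: "F y - F x = (LBINT s:{x..y}. k s)" if "-1 \<le> x" "x \<le> y" "y \<le> 1" for x y
    using Fe[of x] Fe[of y] that set_integral_split[OF that(1,2) ks] by simp
  have cF: "continuous_on {-1..1} F"
  proof -
    have "continuous_on {-1..1} (\<lambda>x. C + (LBINT s:{-1..x}. k s))"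
      by (intro continuous_intros primitive_continuous k)
    then show ?thesis by (rule continuous_on_eq) (rule Fe[symmetric])
  qed
  have cf: "continuous_on {-1..1} f" using fd by (meson DERIV_continuous_on)
  interpret P: primitive_pair f F k
  proof
    fix x :: real assume x: "x \<in> {0..1}"
    show "(f has_real_derivative F x) (at x within {0..1})"
      by (rule DERIV_subset[OF fd]) (use x in auto)
    show "F x = F 0 + (LBINT s:{0..x}. k s)" using Fdiff[of 0 x] x by simp
  qed (use k k2 in auto)
  interpret M: primitive_pair "\<lambda>x. f (- x)" "\<lambda>x. - F (- x)" "\<lambda>x. k (- x)"
  proof
    fix x :: real assume x: "x \<in> {0..1}"
    have "(f \<circ> uminus has_real_derivative F (- x) * (- 1)) (at x within {0..1})"
    proof (rule DERIV_image_chain)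
      show "(uminus has_real_derivative - 1) (at x within {0..1})" by (auto intro!: derivative_eq_intros)
      show "(f has_real_derivative F (- x)) (at (- x) within uminus ` {0..1})"
        by (rule DERIV_subset[OF fd]) (use x in auto)
    qed
    then show "((\<lambda>x. f (- x)) has_real_derivative - F (- x)) (at x within {0..1})" by (simp add: comp_def)
    show "- F (- x) = - F (- 0) + (LBINT s:{0..x}. k (- s))"
      using Fdiff[of "- x" 0] x by (simp add: set_integral_reflect)
  next
    show "integrable lborel (\<lambda>x. k (- x))" using lborel_integrable_real_affine[OF k, of "-1" 0] by simp
    show "integrable lborel (\<lambda>x. (k (- x))\<^sup>2)" using lborel_integrable_real_affine[OF k2, of "-1" 0] by simp
  qed
  have cont: "set_integrable lborel {-1..1} (\<lambda>x. \<bar>x\<bar> * (F x)\<^sup>2)" "set_integrable lborel {-1..1} (\<lambda>x. (x * f x)\<^sup>2)"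
    by (intro borel_integrable_atLeastAtMost' continuous_intros cf cF)+
  have split: "(LBINT x:{-1..1}. g x) = (LBINT x:{0..1}. g (- x)) + (LBINT x:{0..1}. g x)"
    if "set_integrable lborel {-1..1} g" for g :: "real \<Rightarrow> real"
    using set_integral_split[OF _ _ that, of 0] by (simp add: set_integral_reflect)
  have pos: "(LBINT x:{0..1}. \<bar>x\<bar> * (F x)\<^sup>2) = (LBINT x:{0..1}. x * (F x)\<^sup>2)"
    "(LBINT x:{0..1}. \<bar>- x\<bar> * (F (- x))\<^sup>2) = (LBINT x:{0..1}. x * (- F (- x))\<^sup>2)"
    by (intro set_lebesgue_integral_cong; simp)+
  have neg: "(\<lambda>x. (- x * f (- x))\<^sup>2) = (\<lambda>x. (x * f (- x))\<^sup>2)" by simp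
  show ?thesis
    unfolding split[OF cont(1)] split[OF cont(2)] split[OF k2s] pos neg
    using P.weighted_interpolation[OF n] M.weighted_interpolation[OF n]
    by (simp add: distrib_left)
qed

text \<open>Up to constants of integration, \<open>v\<close> is almost everywhere the primitive
  \<open>F\<close> of \<open>k\<close>, and \<open>u\<close> the primitive \<open>f\<close> of
  \<open>F\<close>, so the inequality for primitives applies to these representatives. Extended
  nonnegative integrals prepare the summation over modes.\<close>

lemma weak_weighted_interpolation:
  fixes u v k :: "real \<Rightarrow> real"
  assumes u: "integrable lborel u" and v: "integrable lborel v"
    and k: "integrable lborel k" and k2: "integrable lborel (\<lambda>x. (k x)\<^sup>2)"
    and supp: "\<And>x. x \<notin> {-1<..<1} \<Longrightarrow> u x = 0" "\<And>x. x \<notin> {-1<..<1} \<Longrightarrow> v x = 0" "\<And>x. x \<notin> {-1<..<1} \<Longrightarrow> k x = 0"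
    and uv: "\<And>\<eta>. test1 (-1) 1 \<eta> \<Longrightarrow> (LBINT x. u x * deriv \<eta> x) = - (LBINT x. v x * \<eta> x)"
    and vk: "\<And>\<eta>. test1 (-1) 1 \<eta> \<Longrightarrow> (LBINT x. v x * deriv \<eta> x) = - (LBINT x. k x * \<eta> x)"
    and n: "1 \<le> n"
  shows "ennreal n * (\<integral>\<^sup>+z. ennreal (\<bar>z\<bar> * (v z)\<^sup>2) \<partial>lborel)
    \<le> ennreal 21000 * ((\<integral>\<^sup>+z. ennreal ((n * z * u z)\<^sup>2) \<partial>lborel) + (\<integral>\<^sup>+z. ennreal ((k z)\<^sup>2) \<partial>lborel))"
proof -
  obtain C where C: "AE x in lborel. x \<in> {-1<..<1} \<longrightarrow> v x = C + (LBINT s:{-1..x}. k s)"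
    using weak_derivative_primitive[of "-1" 1 v k] v k supp(2,3) vk by auto
  obtain C' where C': "AE x in lborel. x \<in> {-1<..<1} \<longrightarrow> u x = C' + (LBINT s:{-1..x}. v s)"
    using weak_derivative_primitive[of "-1" 1 u v] u v supp(1,2) uv by auto
  define F where "F x = C + (LBINT s:{-1..x}. k s)" for x
  define f where "f x = C' + (LBINT s:{-1..x}. F s)" for x
  have cF: "continuous_on {-1..1} F"
    unfolding F_def by (intro continuous_intros primitive_continuous k)
  have vF: "AE x in lborel. x \<in> {-1<..<1} \<longrightarrow> v x = F x" using C by (simp add: F_def)
  have meas: "v \<in> borel_measurable lborel" "(\<lambda>x. indicator {-1..1} x *\<^sub>R F x) \<in> borel_measurable lborel"
    using v borel_measurable_continuous_on_indicator[OF _ cF] by auto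
  \<comment> \<open>Exchanging \<open>v\<close> for its continuous representative under the integral
    makes \<open>f\<close> differentiable everywhere on [-1, 1], end points included.\<close>
  have prim: "(LBINT s:{-1..x}. v s) = (LBINT s:{-1..x}. F s)" if "x \<in> {-1..1}" for x
  proof -
    have "(LBINT s. indicator {-1..x} s *\<^sub>R v s) = (LBINT s. indicator {-1..x} s *\<^sub>R (indicator {-1..1} s *\<^sub>R F s))"
    proof (rule integral_cong_AE)
      show "AE s in lborel. indicator {-1..x} s *\<^sub>R v s = indicator {-1..x} s *\<^sub>R (indicator {-1..1} s *\<^sub>R F s)"
        using vF AE_lborel_singleton[of "-1::real"] AE_lborel_singleton[of "1::real"]
        by eventually_elim (use that in \<open>auto simp: indicator_def\<close>)
      show "(\<lambda>s. indicator {-1..x} s *\<^sub>R v s) \<in> borel_measurable lborel"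
        by (rule borel_measurable_scaleR[OF _ meas(1)]) simp
      show "(\<lambda>s. indicator {-1..x} s *\<^sub>R (indicator {-1..1} s *\<^sub>R F s)) \<in> borel_measurable lborel"
        by (rule borel_measurable_scaleR[OF _ meas(2)]) simp
    qed
    also have "(\<lambda>s. indicator {-1..x} s *\<^sub>R (indicator {-1..1} s *\<^sub>R F s)) = (\<lambda>s. indicator {-1..x} s *\<^sub>R F s)"
      using that by (auto simp: fun_eq_iff indicator_def)
    finally show ?thesis by (simp add: set_lebesgue_integral_def)
  qed
  have uf: "AE x in lborel. x \<in> {-1<..<1} \<longrightarrow> u x = f x"
    using C' by eventually_elim (auto simp: f_def prim)
  have fd: "(f has_real_derivative F x) (at x within {-1..1})" if "x \<in> {-1..1}" for x
  proof -
    have "((\<lambda>x. integral {-1..x} F) has_real_derivative F x) (at x within {-1..1})"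
      by (rule integral_has_real_derivative[OF cF that])
    then have "((\<lambda>x. C' + integral {-1..x} F) has_real_derivative F x) (at x within {-1..1})"
      by (auto intro!: derivative_eq_intros)
    moreover have "C' + integral {-1..y} F = f y" if "y \<in> {-1..1}" for y
    proof -
      have "set_integrable lborel {-1..y} F"
        using that by (intro borel_integrable_atLeastAtMost' continuous_on_subset[OF cF]) auto
      then show ?thesis by (simp add: f_def set_borel_integral_eq_integral(2))
    qed
    ultimately show ?thesis
      using that by (auto intro: has_field_derivative_transform_within[of _ _ _ _ 1])
  qed
  have cf: "continuous_on {-1..1} f" using fd by (meson DERIV_continuous_on)
  have main: "n * (LBINT x:{-1..1}. \<bar>x\<bar> * (F x)\<^sup>2)
    \<le> 21000 * (n\<^sup>2 * (LBINT x:{-1..1}. (x * f x)\<^sup>2) + (LBINT x:{-1..1}. (k x)\<^sup>2))"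
    by (rule primitive_weighted_interpolation[OF fd _ k k2 n]) (simp_all add: F_def)
  have conv: "(\<integral>\<^sup>+z. ennreal (p z) \<partial>lborel) = ennreal (LBINT z:{-1..1}. q z)"
    if "AE z in lborel. p z = indicator {-1..1} z * q z" "set_integrable lborel {-1..1} q" "\<And>z. 0 \<le> q z" for p q :: "real \<Rightarrow> real"
  proof -
    have "(\<integral>\<^sup>+z. ennreal (p z) \<partial>lborel) = (\<integral>\<^sup>+z. ennreal (indicator {-1..1} z * q z) \<partial>lborel)"
      using that(1) by (intro nn_integral_cong_AE) (auto elim!: eventually_mono)
    also have "\<dots> = ennreal (LBINT z. indicator {-1..1} z * q z)"
      using that(2,3) by (intro nn_integral_eq_integral) (auto simp: set_integrable_def)
    finally show ?thesis by (simp add: set_lebesgue_integral_def)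
  qed
  have 1: "(\<integral>\<^sup>+z. ennreal (\<bar>z\<bar> * (v z)\<^sup>2) \<partial>lborel) = ennreal (LBINT x:{-1..1}. \<bar>x\<bar> * (F x)\<^sup>2)"
  proof (rule conv)
    show "AE z in lborel. \<bar>z\<bar> * (v z)\<^sup>2 = indicator {-1..1} z * (\<bar>z\<bar> * (F z)\<^sup>2)"
      using vF AE_lborel_singleton[of "-1::real"] AE_lborel_singleton[of "1::real"]
      by eventually_elim (use supp(2) in \<open>auto simp: indicator_def\<close>)
  qed (auto intro!: borel_integrable_atLeastAtMost' continuous_intros cF)
  have 2: "(\<integral>\<^sup>+z. ennreal ((n * z * u z)\<^sup>2) \<partial>lborel) = ennreal (LBINT x:{-1..1}. (n * x * f x)\<^sup>2)"
  proof (rule conv)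
    show "AE z in lborel. (n * z * u z)\<^sup>2 = indicator {-1..1} z * (n * z * f z)\<^sup>2"
      using uf AE_lborel_singleton[of "-1::real"] AE_lborel_singleton[of "1::real"]
      by eventually_elim (use supp(1) in \<open>auto simp: indicator_def\<close>)
  qed (auto intro!: borel_integrable_atLeastAtMost' continuous_intros cf)
  have 3: "(\<integral>\<^sup>+z. ennreal ((k z)\<^sup>2) \<partial>lborel) = ennreal (LBINT x:{-1..1}. (k x)\<^sup>2)"
  proof (rule conv)
    show "AE z in lborel. (k z)\<^sup>2 = indicator {-1..1} z * (k z)\<^sup>2"
    proof (rule AE_I2)
      fix z show "(k z)\<^sup>2 = indicator {-1..1} z * (k z)\<^sup>2"
        using supp(3)[of z] by (cases "z \<in> {-1<..<1}") auto
    qed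
    show "set_integrable lborel {-1..1} (\<lambda>z. (k z)\<^sup>2)"
      unfolding set_integrable_def using k2 by (intro integrable_mult_indicator) auto
  qed auto
  have "(LBINT x:{-1..1}. (n * x * f x)\<^sup>2) = n\<^sup>2 * (LBINT x:{-1..1}. (x * f x)\<^sup>2)"
    by (simp add: power_mult_distrib mult.assoc)
  moreover have "0 \<le> (LBINT x:{-1..1}. (n * x * f x)\<^sup>2)" "0 \<le> (LBINT x:{-1..1}. (k x)\<^sup>2)"
    by (rule set_integral_nonneg'; simp)+
  moreover have "ennreal n * ennreal X \<le> ennreal 21000 * (ennreal Y + ennreal Z)"
    if "n * X \<le> 21000 * (Y + Z)" "0 \<le> Y" "0 \<le> Z" for X Y Z
  proof -
    have "ennreal n * ennreal X = ennreal (n * X)" using n by (simp add: ennreal_mult')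
    also have "\<dots> \<le> ennreal (21000 * (Y + Z))" using that(1) by (rule ennreal_leI)
    also have "\<dots> = ennreal 21000 * ennreal (Y + Z)" by (rule ennreal_mult') simp
    also have "ennreal (Y + Z) = ennreal Y + ennreal Z" using that by (intro ennreal_plus)
    finally show ?thesis .
  qed
  ultimately show ?thesis unfolding 1 2 3 using main by simp
qed

section \<open>Fourier modes on the rectangle\<close>

lemma test1_mult_smooth1:
  assumes "test1 a b A" "smooth1 s"
  shows "test1 a b (\<lambda>x. A x * s x)"
proof -
  obtain c d where cd: "a < c" "d < b" "\<And>x. x \<notin> {c..d} \<Longrightarrow> A x = 0" using assms by (auto simp: test1_def)
  then have "\<forall>x. x \<notin> {c..d} \<longrightarrow> A x * s x = 0" by simp
  then show ?thesis using cd(1,2) assms by (auto simp: test1_def intro!: smooth1_mult)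
qed

lemma test_fun_test1_product:
  assumes "test1 x0 x1 A" "test1 (-1) 1 \<eta>"
  shows "test_fun (Omega x0 x1) (\<lambda>(x, z). A x * \<eta> z)"
proof -
  obtain l r where lr: "x0 < l" "r < x1" "\<And>x. x \<notin> {l..r} \<Longrightarrow> A x = 0"
    using assms(1) by (auto simp: test1_def)
  obtain c d where cd: "-1 < c" "d < 1" "\<And>x. x \<notin> {c..d} \<Longrightarrow> \<eta> x = 0"
    using assms(2) by (auto simp: test1_def)
  show ?thesis
    using assms lr(1,2) cd(1,2)
    by (intro test_fun_product[OF _ _ lr(3) cd(3)]) (auto simp: test1_def)
qed

section \<open>From test functions on the rectangle to trigonometric modes\<close>

context fourier_interval
begin

text \<open>Functions extended by zero to the plane, so that Fubini and dominated convergence work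
  with \<open>lborel\<close> throughout.\<close>

definition L2x :: "(real \<times> real \<Rightarrow> real) \<Rightarrow> bool" where
  "L2x f \<longleftrightarrow> f \<in> borel_measurable borel \<and> integrable lborel (\<lambda>p. (f p)\<^sup>2) \<and> (\<forall>p. p \<notin> Omega a b \<longrightarrow> f p = 0)"

text \<open>The rectangle has finite measure, and on it |f| <= 1 + f^2.\<close>

lemma L2x_integrable:
  assumes "L2x f"
  shows "integrable lborel f"
proof -
  have z: "f p = 0" if "p \<notin> Omega a b" for p using assms that unfolding L2x_def by blast
  have O: "Omega a b \<in> sets borel" by (simp add: Omega_def open_Times)
  have "bounded (Omega a b)" unfolding Omega_def by (intro bounded_Times) auto
  then have "integrable lborel (indicat_real (Omega a b))"
    using O by (intro integrable_real_indicator) (simp_all add: emeasure_bounded_finite[unfolded infinity_ennreal_def])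
  then have "integrable lborel (\<lambda>p. indicat_real (Omega a b) p + (f p)\<^sup>2)"
    using assms by (auto simp: L2x_def)
  then show ?thesis
  proof (rule Bochner_Integration.integrable_bound)
    show "AE p in lborel. norm (f p) \<le> norm (indicat_real (Omega a b) p + (f p)\<^sup>2)"
    proof (rule AE_I2)
      fix p
      have "\<bar>f p\<bar> \<le> 1 + (f p)\<^sup>2"
        using zero_le_power2[of "\<bar>f p\<bar> - 1 / 2"] by (simp add: power2_diff field_simps)
      then show "norm (f p) \<le> norm (indicat_real (Omega a b) p + (f p)\<^sup>2)"
        using z[of p] by (cases "p \<in> Omega a b") auto
    qed
  qed (use assms in \<open>auto simp: L2x_def\<close>)
qed

lemma L2x_zero:
  assumes "L2x f"
  shows "x \<notin> {a<..<b} \<Longrightarrow> f (x, z) = 0" "z \<notin> {-1<..<1} \<Longrightarrow> f (x, z) = 0"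
proof -
  have "f (x, z) = 0" if "(x, z) \<notin> Omega a b" using assms that by (simp add: L2x_def)
  then show "x \<notin> {a<..<b} \<Longrightarrow> f (x, z) = 0" "z \<notin> {-1<..<1} \<Longrightarrow> f (x, z) = 0"
    by (auto simp: Omega_def)
qed

lemma L2x_sections:
  assumes "L2x f"
  shows "AE z in lborel. integrable lborel (\<lambda>x. f (x, z)) \<and> integrable lborel (\<lambda>x. (f (x, z))\<^sup>2)"
proof -
  have "AE z in lborel. integrable lborel (\<lambda>x. f (x, z))"
    using L2x_integrable[OF assms] by (intro lborel_pair.AE_integrable_snd) (simp add: lborel_prod)
  moreover have "AE z in lborel. integrable lborel (\<lambda>x. (f (x, z))\<^sup>2)"
    using assms by (intro lborel_pair.AE_integrable_snd) (simp add: lborel_prod L2x_def split_beta')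
  ultimately show ?thesis by eventually_elim simp
qed

lemma L2x_nn_integral:
  assumes "L2x f"
  shows "(\<integral>\<^sup>+z. \<integral>\<^sup>+x. ennreal ((f (x, z))\<^sup>2) \<partial>lborel \<partial>lborel) = ennreal (LBINT p. (f p)\<^sup>2)"
proof -
  have "(\<lambda>p. ennreal ((f p)\<^sup>2)) \<in> borel_measurable (lborel \<Otimes>\<^sub>M lborel)"
    using assms by (auto simp: lborel_prod L2x_def intro!: measurable_compose[OF _ measurable_ennreal] borel_measurable_power)
  then have "(\<integral>\<^sup>+z. \<integral>\<^sup>+x. ennreal ((f (x, z))\<^sup>2) \<partial>lborel \<partial>lborel) = (\<integral>\<^sup>+p. ennreal ((f p)\<^sup>2) \<partial>lborel)"
    by (subst lborel_pair.nn_integral_snd) (simp_all only: lborel_prod)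
  also have "\<dots> = ennreal (LBINT p. (f p)\<^sup>2)"
    using assms by (intro nn_integral_eq_integral) (auto simp: L2x_def)
  finally show ?thesis .
qed

lemma fst_snd_measurable:
  fixes e :: "real \<Rightarrow> real"
  assumes "e \<in> borel_measurable borel"
  shows "(\<lambda>p::real \<times> real. e (fst p)) \<in> borel_measurable borel" "(\<lambda>p::real \<times> real. e (snd p)) \<in> borel_measurable borel"
  using measurable_compose[OF borel_measurable_continuous_onI assms, of fst]
    measurable_compose[OF borel_measurable_continuous_onI assms, of snd]
  by (simp_all add: continuous_on_fst continuous_on_snd continuous_on_id)

lemma strip_fubini:
  assumes f: "L2x f" and e: "e \<in> borel_measurable borel" "\<And>x. \<bar>e x\<bar> \<le> K"
    and \<eta>: "\<eta> \<in> borel_measurable borel" "\<And>z. \<bar>\<eta> z\<bar> \<le> M"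
  shows "integrable lborel (\<lambda>z. LBINT x. f (x, z) * e x)"
    and "(LBINT p. f p * (e (fst p) * \<eta> (snd p))) = (LBINT z. (LBINT x. f (x, z) * e x) * \<eta> z)"
proof -
  have *: "integrable (lborel \<Otimes>\<^sub>M lborel) (\<lambda>(x, z). f (x, z) * (e x * \<eta>' z))"
    if "\<eta>' \<in> borel_measurable borel" "\<And>z. \<bar>\<eta>' z\<bar> \<le> M'" for \<eta>' :: "real \<Rightarrow> real" and M'
  proof -
    have "integrable lborel (\<lambda>p. f p * (e (fst p) * \<eta>' (snd p)))"
    proof (rule integrable_mult_bounded[OF L2x_integrable[OF f]])
      show "(\<lambda>p. e (fst p) * \<eta>' (snd p)) \<in> borel_measurable lborel"
        using fst_snd_measurable(1)[OF e(1)] fst_snd_measurable(2)[OF that(1)] by (simp add: borel_measurable_times)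
      show "\<bar>e (fst p) * \<eta>' (snd p)\<bar> \<le> K * M'" for p
        using e(2)[of "fst p"] that(2)[of "snd p"] by (simp add: abs_mult mult_mono')
    qed
    then show ?thesis by (simp add: lborel_prod split_beta')
  qed
  have "integrable lborel (\<lambda>z. LBINT x. f (x, z) * (e x * 1))"
    by (rule lborel_pair.integrable_snd) (use *[of "\<lambda>_. 1" 1] in simp)
  then show "integrable lborel (\<lambda>z. LBINT x. f (x, z) * e x)" by simp
  have "(LBINT p. f p * (e (fst p) * \<eta> (snd p))) = (LBINT z. LBINT x. f (x, z) * (e x * \<eta> z))"
    using lborel_pair.integral_snd[OF *[OF \<eta>]] by (simp add: lborel_prod split_beta')
  then show "(LBINT p. f p * (e (fst p) * \<eta> (snd p))) = (LBINT z. (LBINT x. f (x, z) * e x) * \<eta> z)"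
    by (simp add: mult.assoc[symmetric])
qed

text \<open>This removes the cutoffs: \<open>A j\<close> will be a compactly supported approximation
  of the mode \<open>e\<close>, or its derivative. The assumptions on \<open>A\<close> are confined
  to (a, b), where the bound on differentiated cutoffs holds; outside, \<open>f\<close>
  vanishes.\<close>

lemma strip_limit:
  assumes f: "L2x f"
    and A: "\<And>j. A j \<in> borel_measurable borel" "\<And>j x. x \<in> {a<..<b} \<Longrightarrow> \<bar>A j x\<bar> \<le> K'"
      "\<And>x. x \<in> {a<..<b} \<Longrightarrow> (\<lambda>j. A j x) \<longlonglongrightarrow> e x"
    and e: "e \<in> borel_measurable borel" "\<And>x. \<bar>e x\<bar> \<le> K"
    and \<eta>: "\<eta> \<in> borel_measurable borel" "\<And>z. \<bar>\<eta> z\<bar> \<le> M"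
  shows "(\<lambda>j::nat. LBINT p. f p * (A j (fst p) * \<eta> (snd p))) \<longlonglongrightarrow> (LBINT z. (LBINT x. f (x, z) * e x) * \<eta> z)"
proof -
  have fm: "f \<in> borel_measurable borel" using f by (simp add: L2x_def)
  have f0: "f p = 0" if "fst p \<notin> {a<..<b}" for p using L2x_zero(1)[OF f that, of "snd p"] by simp
  have "(\<lambda>j. LBINT p. f p * (A j (fst p) * \<eta> (snd p))) \<longlonglongrightarrow> (LBINT p. f p * (e (fst p) * \<eta> (snd p)))"
  proof (rule integral_dominated_convergence[where w = "\<lambda>p. K' * M * \<bar>f p\<bar>"])
    show "integrable lborel (\<lambda>p. K' * M * \<bar>f p\<bar>)" using L2x_integrable[OF f] by simp
    show "(\<lambda>p. f p * (e (fst p) * \<eta> (snd p))) \<in> borel_measurable lborel"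
      using fm fst_snd_measurable(1)[OF e(1)] fst_snd_measurable(2)[OF \<eta>(1)] by (simp add: borel_measurable_times)
    show "(\<lambda>p. f p * (A j (fst p) * \<eta> (snd p))) \<in> borel_measurable lborel" for j
      using fm fst_snd_measurable(1)[OF A(1)] fst_snd_measurable(2)[OF \<eta>(1)] by (simp add: borel_measurable_times)
    show "AE p in lborel. (\<lambda>j. f p * (A j (fst p) * \<eta> (snd p))) \<longlonglongrightarrow> f p * (e (fst p) * \<eta> (snd p))"
    proof (rule AE_I2)
      fix p :: "real \<times> real"
      show "(\<lambda>j. f p * (A j (fst p) * \<eta> (snd p))) \<longlonglongrightarrow> f p * (e (fst p) * \<eta> (snd p))"
      proof (cases "fst p \<in> {a<..<b}")
        case True
        then show ?thesis by (intro tendsto_mult tendsto_const A(3))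
      next
        case False
        then show ?thesis by (simp add: f0)
      qed
    qed
    show "AE p in lborel. norm (f p * (A j (fst p) * \<eta> (snd p))) \<le> K' * M * \<bar>f p\<bar>" for j
    proof (rule AE_I2)
      fix p :: "real \<times> real"
      show "norm (f p * (A j (fst p) * \<eta> (snd p))) \<le> K' * M * \<bar>f p\<bar>"
      proof (cases "fst p \<in> {a<..<b}")
        case True
        have "\<bar>A j (fst p)\<bar> * \<bar>\<eta> (snd p)\<bar> \<le> K' * M"
          using A(2)[OF True] \<eta>(2) by (intro mult_mono') auto
        then have "\<bar>A j (fst p)\<bar> * \<bar>\<eta> (snd p)\<bar> * \<bar>f p\<bar> \<le> K' * M * \<bar>f p\<bar>" by (rule mult_right_mono) simp
        then show ?thesis by (simp add: abs_mult mult_ac)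
      next
        case False
        then show ?thesis by (simp add: f0)
      qed
    qed
  qed
  then show ?thesis unfolding strip_fubini(2)[OF f e \<eta>] .
qed

definition cos_cut :: "nat \<Rightarrow> nat \<Rightarrow> real \<Rightarrow> real" where
  "cos_cut n j x = cutoff a b j x * cos (real n * om * (x - a))"

definition sin_cut :: "nat \<Rightarrow> nat \<Rightarrow> real \<Rightarrow> real" where
  "sin_cut n j x = cutoff a b j x * sin (real n * om * (x - a))"

lemma test1_cos_cut: "test1 a b (cos_cut n j)"
  and test1_sin_cut: "test1 a b (sin_cut n j)"
proof -
  have arg: "real n * om * (x - a) = real n * om * x + (- real n * om * a)" for x by (simp add: algebra_simps)
  show "test1 a b (cos_cut n j)" "test1 a b (sin_cut n j)"
    unfolding cos_cut_def[abs_def] sin_cut_def[abs_def] arg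
    by (intro test1_mult_smooth1 test1_cutoff smooth1_affine smooth1_cos smooth1_sin; simp)+
qed

lemma smooth1_cos_cut: "smooth1 (cos_cut n j)"
  and smooth1_sin_cut: "smooth1 (sin_cut n j)"
  using test1_cos_cut test1_sin_cut by (auto simp: test1_def)

lemma cos_cut_limit:
  assumes f: "L2x f" and \<eta>: "\<eta> \<in> borel_measurable borel" "\<And>z. \<bar>\<eta> z\<bar> \<le> M"
  shows "(\<lambda>j. LBINT p. f p * (cos_cut n j (fst p) * \<eta> (snd p)))
    \<longlonglongrightarrow> (LBINT z. coef (\<lambda>x. f (x, z)) n * \<eta> z)"
  unfolding coef_def
proof (rule strip_limit[OF f _ _ _ cs_meas cs_bound \<eta>, where K' = 1])
  show "cos_cut n j \<in> borel_measurable borel" for j by (intro smooth1_measurable smooth1_cos_cut)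
  show "\<bar>cos_cut n j x\<bar> \<le> 1" for j x
    using cutoff_bounds[of a b j x] by (simp add: cos_cut_def abs_mult mult_le_one)
  show "(\<lambda>j. cos_cut n j x) \<longlonglongrightarrow> cs n x" for x
    unfolding cs_def cos_cut_def by (intro tendsto_mult cutoff_tendsto tendsto_const)
qed

lemma sin_cut_limit:
  assumes f: "L2x f" and \<eta>: "\<eta> \<in> borel_measurable borel" "\<And>z. \<bar>\<eta> z\<bar> \<le> M"
  shows "(\<lambda>j. LBINT p. f p * (sin_cut n j (fst p) * \<eta> (snd p)))
    \<longlonglongrightarrow> (LBINT z. (LBINT x. f (x, z) * sn n x) * \<eta> z)"
proof (rule strip_limit[OF f _ _ _ sn_meas sn_bound \<eta>, where K' = 1])
  show "sin_cut n j \<in> borel_measurable borel" for j by (intro smooth1_measurable smooth1_sin_cut)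
  show "\<bar>sin_cut n j x\<bar> \<le> 1" for j x
    using cutoff_bounds[of a b j x] by (simp add: sin_cut_def abs_mult mult_le_one)
  show "(\<lambda>j. sin_cut n j x) \<longlonglongrightarrow> sn n x" for x
    unfolding sn_def sin_cut_def by (intro tendsto_mult cutoff_tendsto tendsto_const)
qed

text \<open>The sine vanishes at both end points, which compensates the blow-up of the derivative of the cutoff:
  no boundary condition on the function itself is needed.\<close>

lemma sin_cut_deriv:
  shows "deriv (sin_cut n j) x
      = deriv (cutoff a b j) x * sin (real n * om * (x - a)) + real n * om * (cutoff a b j x * cos (real n * om * (x - a)))"
    and "x \<in> {a<..<b} \<Longrightarrow> \<bar>deriv (sin_cut n j) x\<bar> \<le> 5 * (real n * om)"
proof -
  define N where "N = real n * om"
  have N: "0 \<le> N" using om_pos by (simp add: N_def)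
  have arg: "sin_cut n j = (\<lambda>x. cutoff a b j x * sin (N * (x - a)))"
    by (simp add: sin_cut_def fun_eq_iff N_def)
  have "((\<lambda>x. cutoff a b j x * sin (N * (x - a))) has_real_derivative
      deriv (cutoff a b j) x * sin (N * (x - a)) + N * (cutoff a b j x * cos (N * (x - a)))) (at x)" for x
    using smooth1_deriv(1)[OF smooth1_cutoff[of a b j], of x]
    by (auto intro!: derivative_eq_intros)
  then show eq: "deriv (sin_cut n j) x
      = deriv (cutoff a b j) x * sin (real n * om * (x - a)) + real n * om * (cutoff a b j x * cos (real n * om * (x - a)))" for x
    unfolding arg unfolding N_def[symmetric] by (rule DERIV_imp_deriv)
  assume x: "x \<in> {a<..<b}"
  have s1: "\<bar>sin (N * (x - a))\<bar> \<le> N * (x - a)"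
    using abs_sin_x_le_abs_x[of "N * (x - a)"] N x by (simp add: abs_mult)
  \<comment> \<open>Because om (b - a) = pi, the sine is up to sign a function of the distance to
    \<open>b\<close> in the same way as of the distance to \<open>a\<close>.\<close>
  have s2: "\<bar>sin (N * (x - a))\<bar> \<le> N * (b - x)"
  proof -
    have "N * (x - a) = real n * pi - N * (b - x)"
    proof -
      have "N * (x - a) = real n * (om * (b - a)) - N * (b - x)" by (simp add: N_def algebra_simps)
      then show ?thesis by (simp add: om_ba)
    qed
    then have "\<bar>sin (N * (x - a))\<bar> = \<bar>sin (N * (b - x))\<bar>"
      by (simp add: sin_diff abs_mult)
    also have "\<dots> \<le> N * (b - x)"
      using abs_sin_x_le_abs_x[of "N * (b - x)"] N x by (simp add: abs_mult)
    finally show ?thesis .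
  qed
  \<comment> \<open>The sine supplies the distance to the nearer end, and the distance to the
    farther end is at least half of b - a.\<close>
  have s3: "\<bar>sin (N * (x - a))\<bar> * (b - a) \<le> N * (2 * ((x - a) * (b - x)))"
  proof (cases "x - a \<le> b - x")
    case True
    have "\<bar>sin (N * (x - a))\<bar> * (b - a) \<le> (N * (x - a)) * (2 * (b - x))"
      using s1 True x N by (intro mult_mono) auto
    then show ?thesis by (simp only: mult_ac)
  next
    case False
    have "\<bar>sin (N * (x - a))\<bar> * (b - a) \<le> (N * (b - x)) * (2 * (x - a))"
      using s2 False x N by (intro mult_mono) auto
    then show ?thesis by (simp only: mult_ac)
  qed
  define D where "D = \<bar>deriv (cutoff a b j) x\<bar>"
  have D: "D * (x - a) * (b - x) \<le> 2 * (b - a)" unfolding D_def by (rule cutoff_deriv(1)[OF x])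
  have "(D * \<bar>sin (N * (x - a))\<bar>) * (b - a) = D * (\<bar>sin (N * (x - a))\<bar> * (b - a))" by simp
  also have "\<dots> \<le> D * (N * (2 * ((x - a) * (b - x))))"
    using s3 by (intro mult_left_mono) (auto simp: D_def)
  also have "\<dots> = (2 * N) * (D * (x - a) * (b - x))" by (simp add: mult_ac)
  also have "\<dots> \<le> (2 * N) * (2 * (b - a))" using D N by (intro mult_left_mono) auto
  also have "\<dots> = (4 * N) * (b - a)" by simp
  finally have 1: "D * \<bar>sin (N * (x - a))\<bar> \<le> 4 * N" using ab by (simp add: mult_le_cancel_right)
  have 2: "N * (cutoff a b j x * \<bar>cos (N * (x - a))\<bar>) \<le> N * 1"
    using N cutoff_bounds[of a b j x] by (intro mult_left_mono mult_le_one) auto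
  have "\<bar>deriv (cutoff a b j) x * sin (N * (x - a)) + N * (cutoff a b j x * cos (N * (x - a)))\<bar>
      \<le> D * \<bar>sin (N * (x - a))\<bar> + N * (cutoff a b j x * \<bar>cos (N * (x - a))\<bar>)"
    using N cutoff_bounds[of a b j x]
      abs_triangle_ineq[of "deriv (cutoff a b j) x * sin (N * (x - a))" "N * (cutoff a b j x * cos (N * (x - a)))"]
    by (simp add: abs_mult D_def)
  then show "\<bar>deriv (sin_cut n j) x\<bar> \<le> 5 * (real n * om)"
    unfolding eq unfolding N_def[symmetric] using 1 2 by simp
qed

text \<open>The term with the differentiated cutoff tends to 0 pointwise under a uniform bound, so
  only the cosine obtained by differentiating the sine survives and no boundary term
  appears.\<close>

lemma sin_cut_deriv_limit:
  assumes f: "L2x f" and \<eta>: "\<eta> \<in> borel_measurable borel" "\<And>z. \<bar>\<eta> z\<bar> \<le> M"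
  shows "(\<lambda>j. LBINT p. f p * (deriv (sin_cut n j) (fst p) * \<eta> (snd p)))
    \<longlonglongrightarrow> real n * om * (LBINT z. coef (\<lambda>x. f (x, z)) n * \<eta> z)"
proof -
  have lim: "(\<lambda>j. LBINT p. f p * (deriv (sin_cut n j) (fst p) * \<eta> (snd p)))
    \<longlonglongrightarrow> (LBINT z. (LBINT x. f (x, z) * (real n * om * cs n x)) * \<eta> z)"
  proof (rule strip_limit[OF f _ _ _ _ _ \<eta>, where K' = "5 * (real n * om)" and K = "real n * om"])
    show "deriv (sin_cut n j) \<in> borel_measurable borel" for j
      by (intro smooth1_measurable smooth1_deriv(2) smooth1_sin_cut)
    show "\<bar>deriv (sin_cut n j) x\<bar> \<le> 5 * (real n * om)" if "x \<in> {a<..<b}" for j x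
      using that by (rule sin_cut_deriv(2))
    show "(\<lambda>j. deriv (sin_cut n j) x) \<longlonglongrightarrow> real n * om * cs n x" if x: "x \<in> {a<..<b}" for x
    proof -
      have "(\<lambda>j. deriv (cutoff a b j) x * sin (real n * om * (x - a)) + real n * om * (cutoff a b j x * cos (real n * om * (x - a))))
        \<longlonglongrightarrow> 0 * sin (real n * om * (x - a)) + real n * om * (indicator {a<..<b} x * cos (real n * om * (x - a)))"
        by (intro tendsto_intros cutoff_deriv(2)[OF x] cutoff_tendsto)
      then show ?thesis unfolding sin_cut_deriv(1) cs_def by simp
    qed
    show "(\<lambda>x. real n * om * cs n x) \<in> borel_measurable borel" by simp
    show "\<bar>real n * om * cs n x\<bar> \<le> real n * om" for x
      using cs_bound[of n x] om_pos mult_left_mono[of "\<bar>cs n x\<bar>" 1 "real n * om"] by (simp add: abs_mult)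
  qed
  have "(LBINT x. f (x, z) * (real n * om * cs n x)) * \<eta> z = real n * om * (coef (\<lambda>x. f (x, z)) n * \<eta> z)" for z
  proof -
    have "f (x, z) * (real n * om * cs n x) = real n * om * (f (x, z) * cs n x)" for x by (simp only: mult_ac)
    then show ?thesis by (simp only: integral_mult_right_zero coef_def mult.assoc)
  qed
  then show ?thesis using lim by (simp only: integral_mult_right_zero)
qed

end

section \<open>Weak relations and Bessel bounds for the modes\<close>

context fourier_interval
begin

definition ext :: "(real \<times> real \<Rightarrow> real) \<Rightarrow> real \<times> real \<Rightarrow> real" where
  "ext f p = indicator (Omega a b) p * f p"

lemma L2_ext:
  assumes "L2 (Omega a b) f"
  shows "L2x (ext f)" and "(LBINT p. (ext f p)\<^sup>2) = (L2norm (Omega a b) f)\<^sup>2"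
proof -
  have sq: "(ext f p)\<^sup>2 = indicator (Omega a b) p *\<^sub>R (f p)\<^sup>2" for p
    by (simp add: ext_def power_mult_distrib indicator_def)
  have m: "ext f \<in> borel_measurable borel"
    using assms by (simp add: L2_def set_borel_measurable_def ext_def[abs_def])
  have i: "integrable lborel (\<lambda>p. (ext f p)\<^sup>2)"
    using assms unfolding sq by (simp only: L2_def set_integrable_def)
  show "L2x (ext f)" unfolding L2x_def using m i by (simp add: ext_def)
  have "0 \<le> (LBINT p. (ext f p)\<^sup>2)" by simp
  then show "(LBINT p. (ext f p)\<^sup>2) = (L2norm (Omega a b) f)\<^sup>2"
    unfolding L2norm_def set_lebesgue_integral_def sq[symmetric] by simp
qed

lemma set_integral_ext:
  "(LBINT p:Omega a b. f p * X p) = (LBINT p. ext f p * X p)"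
  by (simp add: set_lebesgue_integral_def ext_def mult.assoc)

definition mode :: "(real \<times> real \<Rightarrow> real) \<Rightarrow> nat \<Rightarrow> real \<Rightarrow> real" where
  "mode f n z = coef (\<lambda>x. f (x, z)) n"

definition smode :: "(real \<times> real \<Rightarrow> real) \<Rightarrow> nat \<Rightarrow> real \<Rightarrow> real" where
  "smode f n z = (LBINT x. f (x, z) * sn n x)"

lemma mode_integrable:
  assumes "L2x f"
  shows "integrable lborel (mode f n)" "integrable lborel (smode f n)"
  using strip_fubini(1)[OF assms cs_meas cs_bound, of "\<lambda>_. 1" 1 n]
    strip_fubini(1)[OF assms sn_meas sn_bound, of "\<lambda>_. 1" 1 n]
  by (simp_all add: mode_def[abs_def] smode_def[abs_def] coef_def)

lemma mode_zero:
  assumes "L2x f" "z \<notin> {-1<..<1}"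
  shows "mode f n z = 0" "smode f n z = 0"
  using L2x_zero(2)[OF assms] by (simp_all add: mode_def smode_def coef_def)

lemma test1_facts:
  assumes "test1 c d \<eta>"
  obtains M where "\<eta> \<in> borel_measurable borel" "\<And>z. \<bar>\<eta> z\<bar> \<le> M"
  using test1_bounded[OF assms] assms by (metis smooth1_measurable test1_def)

text \<open>Both sides of an identity between test function pairings converge by
  \<open>cos_cut_limit\<close>. The scalar \<open>c\<close> carries the sign of the integrations by
  parts, -1 for one derivative and 1 for two.\<close>

lemma mode_pairing:
  assumes f: "L2x f" and g: "L2x g" and t: "test1 (-1) 1 \<theta>" "test1 (-1) 1 \<eta>"
    and eq: "\<And>j. (LBINT p. f p * (cos_cut n j (fst p) * \<theta> (snd p))) = c * (LBINT p. g p * (cos_cut n j (fst p) * \<eta> (snd p)))"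
  shows "(LBINT z. mode f n z * \<theta> z) = c * (LBINT z. mode g n z * \<eta> z)"
proof -
  have lim: "(\<lambda>j. LBINT p. u p * (cos_cut n j (fst p) * \<zeta> (snd p))) \<longlonglongrightarrow> (LBINT z. mode u n z * \<zeta> z)"
    if u: "L2x u" and z: "test1 (-1) 1 \<zeta>" for u \<zeta>
  proof -
    obtain M where "\<zeta> \<in> borel_measurable borel" "\<And>z. \<bar>\<zeta> z\<bar> \<le> M" using test1_facts[OF z] by blast
    then show ?thesis unfolding mode_def by (rule cos_cut_limit[OF u])
  qed
  show ?thesis
    using LIMSEQ_unique[OF lim[OF f t(1), unfolded eq] tendsto_mult_left[OF lim[OF g t(2)]]] .
qed

lemma mode_weak_dz:
  assumes f: "L2 (Omega a b) f" and g: "L2 (Omega a b) g" and w: "weak_dz (Omega a b) f g" and t: "test1 (-1) 1 \<eta>"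
  shows "(LBINT z. mode (ext f) n z * deriv \<eta> z) = - (LBINT z. mode (ext g) n z * \<eta> z)"
proof -
  have s: "smooth1 \<eta>" using t by (simp add: test1_def)
  have "(LBINT p. ext f p * (cos_cut n j (fst p) * deriv \<eta> (snd p))) = (-1) * (LBINT p. ext g p * (cos_cut n j (fst p) * \<eta> (snd p)))" for j
    using w[unfolded weak_dz_def, rule_format, OF test_fun_test1_product[OF test1_cos_cut t], of n j]
    unfolding set_integral_ext pd_product(2)[OF smooth1_cos_cut s] by (simp add: split_beta')
  from mode_pairing[OF f[THEN L2_ext(1)] g[THEN L2_ext(1)] test1_deriv[OF t] t this] show ?thesis by simp
qed

lemma mode_weak_dzz:
  assumes f: "L2 (Omega a b) f" and g: "L2 (Omega a b) g" and w: "weak_dzz (Omega a b) f g" and t: "test1 (-1) 1 \<eta>"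
  shows "(LBINT z. mode (ext f) n z * deriv (deriv \<eta>) z) = (LBINT z. mode (ext g) n z * \<eta> z)"
proof -
  have s: "smooth1 \<eta>" using t by (simp add: test1_def)
  have "(LBINT p. ext f p * (cos_cut n j (fst p) * deriv (deriv \<eta>) (snd p))) = 1 * (LBINT p. ext g p * (cos_cut n j (fst p) * \<eta> (snd p)))" for j
    using w[unfolded weak_dzz_def, rule_format, OF test_fun_test1_product[OF test1_cos_cut t], of n j]
    unfolding set_integral_ext pd_product(2)[OF smooth1_cos_cut s] pd_product(2)[OF smooth1_cos_cut smooth1_deriv(2)[OF s]]
    by (simp add: split_beta')
  from mode_pairing[OF f[THEN L2_ext(1)] g[THEN L2_ext(1)] test1_deriv[OF test1_deriv[OF t]] t this] show ?thesis by simp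
qed

text \<open>Tested with \<open>sin_cut n j\<close> in x and \<open>\<eta>\<close> in z, the
  horizontal derivative turns the sine into the cosine, and the weight is absorbed in the vertical
  factor z \<open>\<eta>\<close>. As \<open>\<eta>\<close> is arbitrary,
  \<open>fundamental_lemma\<close> gives the identity almost everywhere.\<close>

lemma mode_weak_zdx:
  assumes f: "L2 (Omega a b) f" and h: "L2 (Omega a b) h" and w: "weak_zdx (Omega a b) f h"
  shows "AE z in lborel. real n * om * (z * mode (ext f) n z) = - smode (ext h) n z"
proof -
  have Lf: "L2x (ext f)" and Lh: "L2x (ext h)" using f h by (auto intro: L2_ext)
  define W where "W z = real n * om * (z * mode (ext f) n z) + smode (ext h) n z" for z
  have zi: "integrable lborel (\<lambda>z. z * mode (ext f) n z)"
  proof (rule Bochner_Integration.integrable_bound[OF mode_integrable(1)[OF Lf, of n]])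
    show "(\<lambda>z. z * mode (ext f) n z) \<in> borel_measurable lborel"
      using borel_measurable_integrable[OF mode_integrable(1)[OF Lf, of n]] by simp
    show "AE z in lborel. norm (z * mode (ext f) n z) \<le> norm (mode (ext f) n z)"
    proof (rule AE_I2)
      fix z :: real
      show "norm (z * mode (ext f) n z) \<le> norm (mode (ext f) n z)"
      proof (cases "z \<in> {-1<..<1}")
        case True
        then have "\<bar>z\<bar> \<le> 1" by auto
        then show ?thesis by (simp add: abs_mult mult_right_le_one_le mult_left_le_one_le)
      qed (simp add: mode_zero[OF Lf])
    qed
  qed
  have "AE z in lborel. W z = 0"
  proof (rule fundamental_lemma[where a = "-1" and b = 1])
    show "integrable lborel W" unfolding W_def[abs_def] using zi mode_integrable(2)[OF Lh] by simp
    show "W z = 0" if "z \<notin> {-1<..<1}" for z using mode_zero[OF Lf that] mode_zero[OF Lh that] by (simp add: W_def)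
    fix \<eta> assume t: "test1 (-1) 1 \<eta>"
    have s: "smooth1 (sin_cut n j)" "smooth1 \<eta>" for j using smooth1_sin_cut t by (auto simp: test1_def)
    obtain M where M: "\<eta> \<in> borel_measurable borel" "\<And>z. \<bar>\<eta> z\<bar> \<le> M" using test1_facts[OF t] by blast
    have zM: "(\<lambda>z. z * \<eta> z) \<in> borel_measurable borel" "\<bar>z * \<eta> z\<bar> \<le> M" for z
    proof -
      show "(\<lambda>z. z * \<eta> z) \<in> borel_measurable borel" using M(1) by simp
      obtain c d where cd: "-1 < c" "d < 1" "\<And>x. x \<notin> {c..d} \<Longrightarrow> \<eta> x = 0" using t by (auto simp: test1_def)
      have "\<eta> z = 0 \<or> \<bar>z\<bar> \<le> 1" using cd(1,2) cd(3)[of z] by (cases "z \<in> {c..d}") auto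
      then have "\<bar>z * \<eta> z\<bar> \<le> \<bar>\<eta> z\<bar>" by (auto simp: abs_mult mult_left_le_one_le)
      then show "\<bar>z * \<eta> z\<bar> \<le> M" using M(2)[of z] by linarith
    qed
    have rel: "(LBINT p. ext f p * (deriv (sin_cut n j) (fst p) * (snd p * \<eta> (snd p)))) = - (LBINT p. ext h p * (sin_cut n j (fst p) * \<eta> (snd p)))" for j
      using w[unfolded weak_zdx_def, rule_format, OF test_fun_test1_product[OF test1_sin_cut t], of n j]
      unfolding set_integral_ext pd_product(1)[OF s] by (simp add: split_beta' mult_ac)
    have 1: "(\<lambda>j. LBINT p. ext f p * (deriv (sin_cut n j) (fst p) * (snd p * \<eta> (snd p)))) \<longlonglongrightarrow> real n * om * (LBINT z. mode (ext f) n z * (z * \<eta> z))"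
      unfolding mode_def by (rule sin_cut_deriv_limit[OF Lf zM])
    have 2: "(\<lambda>j. LBINT p. ext h p * (sin_cut n j (fst p) * \<eta> (snd p))) \<longlonglongrightarrow> (LBINT z. smode (ext h) n z * \<eta> z)"
      unfolding smode_def by (rule sin_cut_limit[OF Lh M])
    have eq: "real n * om * (LBINT z. mode (ext f) n z * (z * \<eta> z)) = - (LBINT z. smode (ext h) n z * \<eta> z)"
      by (rule LIMSEQ_unique[OF 1[unfolded rel] tendsto_minus[OF 2]])
    have "(LBINT z. W z * \<eta> z) = (LBINT z. real n * om * (mode (ext f) n z * (z * \<eta> z)) + smode (ext h) n z * \<eta> z)"
      by (intro Bochner_Integration.integral_cong) (auto simp: W_def algebra_simps)
    also have "\<dots> = real n * om * (LBINT z. mode (ext f) n z * (z * \<eta> z)) + (LBINT z. smode (ext h) n z * \<eta> z)"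
      using integrable_mult_bounded[OF mode_integrable(1)[OF Lf, of n] _ zM(2)] zM(1)
        integrable_mult_bounded[OF mode_integrable(2)[OF Lh, of n] _ M(2)] M(1)
      by simp
    finally show "(LBINT z. W z * \<eta> z) = 0" using eq by simp
  qed
  then show ?thesis by eventually_elim (simp add: W_def)
qed

lemma section_nn_integral_measurable:
  assumes "L2x f"
  shows "(\<lambda>z. \<integral>\<^sup>+x. ennreal ((f (x, z))\<^sup>2) \<partial>lborel) \<in> borel_measurable borel"
    and "(\<lambda>z. gagliardo (\<lambda>x. f (x, z))) \<in> borel_measurable borel"
proof -
  have [measurable]: "f \<in> borel_measurable (borel \<Otimes>\<^sub>M borel)" using assms by (simp add: L2x_def borel_prod)
  show "(\<lambda>z. \<integral>\<^sup>+x. ennreal ((f (x, z))\<^sup>2) \<partial>lborel) \<in> borel_measurable borel" by measurable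
  show "(\<lambda>z. gagliardo (\<lambda>x. f (x, z))) \<in> borel_measurable borel" unfolding gagliardo_def by measurable
qed

text \<open>Bessel's inequality on almost every horizontal slice, integrated in z, for cosines and
  sines at once. The mode 0 is masked because its norm differs from the common value of the
  others.\<close>

lemma bessel_strip:
  assumes f: "L2x f" and e: "\<And>n. e n \<in> borel_measurable borel" "\<And>n x. \<bar>e n x\<bar> \<le> 1"
    and bes: "\<And>u N. integrable lborel u \<Longrightarrow> integrable lborel (\<lambda>x. (u x)\<^sup>2) \<Longrightarrow>
      finite N \<Longrightarrow> 0 \<notin> N \<Longrightarrow> (\<Sum>n\<in>N. (LBINT x. u x * e n x)\<^sup>2) \<le> (b - a) / 2 * (LBINT x. (u x)\<^sup>2)"
  shows "(\<Sum>n. \<integral>\<^sup>+z. ennreal ((if n = 0 then 0 else LBINT x. f (x, z) * e n x)\<^sup>2) \<partial>lborel)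
    \<le> ennreal ((b - a) / 2 * (LBINT p. (f p)\<^sup>2))"
proof -
  define c where "c n z = (if n = 0 then 0 else LBINT x. f (x, z) * e n x)" for n z
  have m: "c n \<in> borel_measurable lborel" for n
    using strip_fubini(1)[OF f e(1) e(2), of "\<lambda>_. 1" 1 n] by (cases "n = 0") (simp_all add: c_def[abs_def])
  have "(\<Sum>n. \<integral>\<^sup>+z. ennreal ((c n z)\<^sup>2) \<partial>lborel) = (\<integral>\<^sup>+z. (\<Sum>n. ennreal ((c n z)\<^sup>2)) \<partial>lborel)"
    using m by (intro nn_integral_suminf[symmetric]) simp
  also have "\<dots> \<le> (\<integral>\<^sup>+z. ennreal ((b - a) / 2) * (\<integral>\<^sup>+x. ennreal ((f (x, z))\<^sup>2) \<partial>lborel) \<partial>lborel)"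
  proof (rule nn_integral_mono_AE)
    show "AE z in lborel. (\<Sum>n. ennreal ((c n z)\<^sup>2)) \<le> ennreal ((b - a) / 2) * (\<integral>\<^sup>+x. ennreal ((f (x, z))\<^sup>2) \<partial>lborel)"
      using L2x_sections[OF f]
    proof eventually_elim
      case (elim z)
      have "(\<Sum>n. ennreal ((c n z)\<^sup>2)) \<le> ennreal ((b - a) / 2 * (LBINT x. (f (x, z))\<^sup>2))"
      proof (rule suminf_le_const[OF summableI])
        fix N
        have "(\<Sum>n<N. ennreal ((c n z)\<^sup>2)) = ennreal (\<Sum>n<N. (c n z)\<^sup>2)"
          by (rule sum_ennreal) simp
        also have "(\<Sum>n<N. (c n z)\<^sup>2) = (\<Sum>n\<in>{1..<N}. (LBINT x. f (x, z) * e n x)\<^sup>2)"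
          by (rule sum.mono_neutral_cong_right) (auto simp: c_def)
        also have "ennreal \<dots> \<le> ennreal ((b - a) / 2 * (LBINT x. (f (x, z))\<^sup>2))"
          using elim by (intro ennreal_leI bes) auto
        finally show "(\<Sum>n<N. ennreal ((c n z)\<^sup>2)) \<le> ennreal ((b - a) / 2 * (LBINT x. (f (x, z))\<^sup>2))" .
      qed
      also have "\<dots> = ennreal ((b - a) / 2) * ennreal (LBINT x. (f (x, z))\<^sup>2)"
        using ab by (intro ennreal_mult) auto
      also have "ennreal (LBINT x. (f (x, z))\<^sup>2) = (\<integral>\<^sup>+x. ennreal ((f (x, z))\<^sup>2) \<partial>lborel)"
        using elim by (intro nn_integral_eq_integral[symmetric]) auto
      finally show ?case .
    qed
  qed
  also have "\<dots> = ennreal ((b - a) / 2) * (\<integral>\<^sup>+z. \<integral>\<^sup>+x. ennreal ((f (x, z))\<^sup>2) \<partial>lborel \<partial>lborel)"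
    using section_nn_integral_measurable(1)[OF f] by (intro nn_integral_cmult) simp
  also have "\<dots> = ennreal ((b - a) / 2 * (LBINT p. (f p)\<^sup>2))"
    unfolding L2x_nn_integral[OF f] using ab by (intro ennreal_mult[symmetric]) auto
  finally show ?thesis unfolding c_def .
qed

lemma bessel_modes:
  assumes f: "L2x f"
  shows "(\<Sum>n. \<integral>\<^sup>+z. ennreal ((if n = 0 then 0 else mode f n z)\<^sup>2) \<partial>lborel) \<le> ennreal ((b - a) / 2 * (LBINT p. (f p)\<^sup>2))"
    and "(\<Sum>n. \<integral>\<^sup>+z. ennreal ((if n = 0 then 0 else smode f n z)\<^sup>2) \<partial>lborel) \<le> ennreal ((b - a) / 2 * (LBINT p. (f p)\<^sup>2))"
  unfolding mode_def smode_def coef_def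
  by - (rule bessel_strip[OF f]; (rule cs_meas sn_meas cs_bound sn_bound | rule bessel_cs[unfolded coef_def] bessel_sn; assumption))+

end

section \<open>Summation over the modes and the final estimate\<close>

context fourier_interval
begin

text \<open>The one-dimensional inequality for the n-th modes, in which n z times the mode of
  \<open>f\<close> is replaced by the sine mode of \<open>h\<close> divided by \<open>om\<close>.
  The right-hand side is then summable over n by Bessel's inequality.\<close>

lemma mode_interpolation:
  assumes L2: "L2 (Omega a b) f" "L2 (Omega a b) g" "L2 (Omega a b) k" "L2 (Omega a b) h"
    and weak: "weak_dz (Omega a b) f g" "weak_dzz (Omega a b) f k" "weak_zdx (Omega a b) f h"
    and n: "n \<noteq> 0"
  shows "ennreal (real n) * (\<integral>\<^sup>+z. ennreal (\<bar>z\<bar> * (mode (ext g) n z)\<^sup>2) \<partial>lborel)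
    \<le> ennreal 21000 * (ennreal ((1 / om)\<^sup>2) * (\<integral>\<^sup>+z. ennreal ((smode (ext h) n z)\<^sup>2) \<partial>lborel)
        + (\<integral>\<^sup>+z. ennreal ((mode (ext k) n z)\<^sup>2) \<partial>lborel))"
proof -
  note L2x = L2[THEN L2_ext(1)]
  have mk: "mode (ext k) n \<in> borel_measurable lborel" "smode (ext h) n \<in> borel_measurable lborel"
    using borel_measurable_integrable[OF mode_integrable(1)[OF L2x(3)]] borel_measurable_integrable[OF mode_integrable(2)[OF L2x(4)]]
    by auto
  have k2: "integrable lborel (\<lambda>z. (mode (ext k) n z)\<^sup>2)"
  proof (rule integrableI_bounded)
    show "(\<lambda>z. (mode (ext k) n z)\<^sup>2) \<in> borel_measurable lborel" using mk(1) by simp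
    have "(\<integral>\<^sup>+z. ennreal (norm ((mode (ext k) n z)\<^sup>2)) \<partial>lborel) = (\<integral>\<^sup>+z. ennreal ((if n = 0 then 0 else mode (ext k) n z)\<^sup>2) \<partial>lborel)"
      using n by simp
    also have "\<dots> = (\<Sum>m\<in>{n}. \<integral>\<^sup>+z. ennreal ((if m = 0 then 0 else mode (ext k) m z)\<^sup>2) \<partial>lborel)" by simp
    also have "\<dots> \<le> (\<Sum>m. \<integral>\<^sup>+z. ennreal ((if m = 0 then 0 else mode (ext k) m z)\<^sup>2) \<partial>lborel)"
      by (rule sum_le_suminf) auto
    also have "\<dots> \<le> ennreal ((b - a) / 2 * (LBINT p. (ext k p)\<^sup>2))" by (rule bessel_modes(1)[OF L2x(3)])
    also have "\<dots> < \<infinity>" by simp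
    finally show "(\<integral>\<^sup>+z. ennreal (norm ((mode (ext k) n z)\<^sup>2)) \<partial>lborel) < \<infinity>" .
  qed
  have "ennreal (real n) * (\<integral>\<^sup>+z. ennreal (\<bar>z\<bar> * (mode (ext g) n z)\<^sup>2) \<partial>lborel)
    \<le> ennreal 21000 * ((\<integral>\<^sup>+z. ennreal ((real n * z * mode (ext f) n z)\<^sup>2) \<partial>lborel) + (\<integral>\<^sup>+z. ennreal ((mode (ext k) n z)\<^sup>2) \<partial>lborel))"
  proof (rule weak_weighted_interpolation[OF mode_integrable(1)[OF L2x(1)] mode_integrable(1)[OF L2x(2)] mode_integrable(1)[OF L2x(3)] k2
        mode_zero(1)[OF L2x(1)] mode_zero(1)[OF L2x(2)] mode_zero(1)[OF L2x(3)]])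
    fix \<eta> assume t: "test1 (-1) 1 \<eta>"
    show "(LBINT x. mode (ext f) n x * deriv \<eta> x) = - (LBINT x. mode (ext g) n x * \<eta> x)"
      by (rule mode_weak_dz[OF L2(1,2) weak(1) t])
    \<comment> \<open>The hypotheses relate \<open>k\<close> to \<open>f\<close> only. Using the
      derivative of \<open>\<eta>\<close> as test function in the relation between \<open>f\<close>
      and \<open>g\<close> links \<open>g\<close> to \<open>k\<close>.\<close>
    show "(LBINT x. mode (ext g) n x * deriv \<eta> x) = - (LBINT x. mode (ext k) n x * \<eta> x)"
      using mode_weak_dz[OF L2(1,2) weak(1) test1_deriv[OF t], of n] mode_weak_dzz[OF L2(1,3) weak(2) t, of n] by simp
  qed (use n in auto)
  also have "(\<integral>\<^sup>+z. ennreal ((real n * z * mode (ext f) n z)\<^sup>2) \<partial>lborel) = (\<integral>\<^sup>+z. ennreal ((1 / om)\<^sup>2) * ennreal ((smode (ext h) n z)\<^sup>2) \<partial>lborel)"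
  proof (rule nn_integral_cong_AE)
    show "AE z in lborel. ennreal ((real n * z * mode (ext f) n z)\<^sup>2) = ennreal ((1 / om)\<^sup>2) * ennreal ((smode (ext h) n z)\<^sup>2)"
      using mode_weak_zdx[OF L2(1,4) weak(3), of n]
    proof eventually_elim
      case (elim z)
      have "real n * z * mode (ext f) n z = (1 / om) * (real n * om * (z * mode (ext f) n z))"
        using om_pos by simp
      also have "\<dots> = (1 / om) * (- smode (ext h) n z)" by (simp only: elim)
      finally have "(real n * z * mode (ext f) n z)\<^sup>2 = (1 / om)\<^sup>2 * (smode (ext h) n z)\<^sup>2"
        by (simp only: power_mult_distrib power2_minus)
      then show ?case by (simp only: ennreal_mult zero_le_power2)
    qed
  qed
  also have "\<dots> = ennreal ((1 / om)\<^sup>2) * (\<integral>\<^sup>+z. ennreal ((smode (ext h) n z)\<^sup>2) \<partial>lborel)"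
    using mk(2) by (intro nn_integral_cmult) simp
  finally show ?thesis .
qed

text \<open>On almost every slice the seminorm is bounded by the coefficient series; sum and
  z-integral are exchanged, each mode is estimated by \<open>mode_interpolation\<close>, and
  Bessel's inequality resums the modes of \<open>h\<close> and \<open>k\<close>.\<close>

lemma weighted_gagliardo_bound:
  assumes L2: "L2 (Omega a b) f" "L2 (Omega a b) g" "L2 (Omega a b) k" "L2 (Omega a b) h"
    and weak: "weak_dz (Omega a b) f g" "weak_dzz (Omega a b) f k" "weak_zdx (Omega a b) f h"
  shows "(\<integral>\<^sup>+z. ennreal \<bar>z\<bar> * gagliardo (\<lambda>x. ext g (x, z)) \<partial>lborel)
    \<le> ennreal (5 * pi\<^sup>2 * (2 / (b - a))\<^sup>2 * 21000 * ((b - a) / 2) *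
        ((1 / om)\<^sup>2 * (L2norm (Omega a b) h)\<^sup>2 + (L2norm (Omega a b) k)\<^sup>2))"
proof -
  note L2x = L2[THEN L2_ext(1)]
  define c where "c = 5 * pi\<^sup>2 * (2 / (b - a))\<^sup>2"
  have c0: "0 \<le> c" by (simp add: c_def)
  define \<alpha> where "\<alpha> n = (\<integral>\<^sup>+z. ennreal ((if n = 0 then 0 else smode (ext h) n z)\<^sup>2) \<partial>lborel)" for n
  define \<beta> where "\<beta> n = (\<integral>\<^sup>+z. ennreal ((if n = 0 then 0 else mode (ext k) n z)\<^sup>2) \<partial>lborel)" for n
  have mg: "mode (ext g) n \<in> borel_measurable lborel" for n
    using borel_measurable_integrable[OF mode_integrable(1)[OF L2x(2)]] .
  have "(\<integral>\<^sup>+z. ennreal \<bar>z\<bar> * gagliardo (\<lambda>x. ext g (x, z)) \<partial>lborel)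
      \<le> (\<integral>\<^sup>+z. (\<Sum>n. ennreal c * (ennreal (real n) * ennreal (\<bar>z\<bar> * (mode (ext g) n z)\<^sup>2))) \<partial>lborel)"
  proof (rule nn_integral_mono_AE)
    show "AE z in lborel. ennreal \<bar>z\<bar> * gagliardo (\<lambda>x. ext g (x, z)) \<le> (\<Sum>n. ennreal c * (ennreal (real n) * ennreal (\<bar>z\<bar> * (mode (ext g) n z)\<^sup>2)))"
      using L2x_sections[OF L2x(2)]
    proof eventually_elim
      case (elim z)
      have "gagliardo (\<lambda>x. ext g (x, z)) \<le> ennreal c * (\<Sum>n. ennreal (real n * (mode (ext g) n z)\<^sup>2))"
        unfolding c_def mode_def using elim L2x_zero(1)[OF L2x(2)] by (intro gagliardo_le_coef_series) auto
      then have "ennreal \<bar>z\<bar> * gagliardo (\<lambda>x. ext g (x, z)) \<le> ennreal \<bar>z\<bar> * (ennreal c * (\<Sum>n. ennreal (real n * (mode (ext g) n z)\<^sup>2)))"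
        by (rule mult_left_mono) simp
      also have "\<dots> = (\<Sum>n. (ennreal \<bar>z\<bar> * ennreal c) * ennreal (real n * (mode (ext g) n z)\<^sup>2))"
        by (simp add: ennreal_suminf_cmult mult.assoc)
      also have "\<dots> = (\<Sum>n. ennreal c * (ennreal (real n) * ennreal (\<bar>z\<bar> * (mode (ext g) n z)\<^sup>2)))"
        by (intro suminf_cong) (simp add: ennreal_mult mult_ac)
      finally show ?case .
    qed
  qed
  also have "\<dots> = (\<Sum>n. \<integral>\<^sup>+z. ennreal c * (ennreal (real n) * ennreal (\<bar>z\<bar> * (mode (ext g) n z)\<^sup>2)) \<partial>lborel)"
    using mg by (intro nn_integral_suminf) simp
  also have "\<dots> = (\<Sum>n. ennreal c * (ennreal (real n) * (\<integral>\<^sup>+z. ennreal (\<bar>z\<bar> * (mode (ext g) n z)\<^sup>2) \<partial>lborel)))"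
    using mg by (simp add: nn_integral_cmult)
  also have "\<dots> \<le> (\<Sum>n. ennreal c * (ennreal 21000 * (ennreal ((1 / om)\<^sup>2) * \<alpha> n + \<beta> n)))"
  proof (intro suminf_le mult_left_mono summableI)
    fix n
    show "ennreal (real n) * (\<integral>\<^sup>+z. ennreal (\<bar>z\<bar> * (mode (ext g) n z)\<^sup>2) \<partial>lborel) \<le> ennreal 21000 * (ennreal ((1 / om)\<^sup>2) * \<alpha> n + \<beta> n)"
      using mode_interpolation[OF L2 weak, of n] by (cases "n = 0") (simp_all add: \<alpha>_def \<beta>_def)
  qed simp
  also have "\<dots> = ennreal c * (ennreal 21000 * (ennreal ((1 / om)\<^sup>2) * (\<Sum>n. \<alpha> n) + (\<Sum>n. \<beta> n)))"
    by (simp add: ennreal_suminf_cmult suminf_add[symmetric])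
  also have "\<dots> \<le> ennreal c * (ennreal 21000 * (ennreal ((1 / om)\<^sup>2) * ennreal ((b - a) / 2 * (L2norm (Omega a b) h)\<^sup>2)
      + ennreal ((b - a) / 2 * (L2norm (Omega a b) k)\<^sup>2)))"
    using bessel_modes(2)[OF L2x(4)] bessel_modes(1)[OF L2x(3)] L2_ext(2)[OF L2(3)] L2_ext(2)[OF L2(4)]
    by (intro mult_left_mono add_mono) (auto simp: \<alpha>_def \<beta>_def)
  also have "\<dots> = ennreal (c * (21000 * ((1 / om)\<^sup>2 * ((b - a) / 2 * (L2norm (Omega a b) h)\<^sup>2) + (b - a) / 2 * (L2norm (Omega a b) k)\<^sup>2)))"
  proof -
    have "ennreal c * (ennreal 21000 * (ennreal q * ennreal X + ennreal Y)) = ennreal (c * (21000 * (q * X + Y)))"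
      if "0 \<le> q" "0 \<le> X" "0 \<le> Y" for q X Y
    proof -
      have "ennreal q * ennreal X + ennreal Y = ennreal (q * X + Y)" using that by (simp add: ennreal_mult)
      moreover have "ennreal 21000 * ennreal (q * X + Y) = ennreal (21000 * (q * X + Y))"
        using that by (intro ennreal_mult[symmetric]) auto
      ultimately show ?thesis using c0 that by (simp only:) (intro ennreal_mult[symmetric]; simp)
    qed
    then show ?thesis using ab by simp
  qed
  also have "c * (21000 * ((1 / om)\<^sup>2 * ((b - a) / 2 * (L2norm (Omega a b) h)\<^sup>2) + (b - a) / 2 * (L2norm (Omega a b) k)\<^sup>2))
      = c * 21000 * ((b - a) / 2) * ((1 / om)\<^sup>2 * (L2norm (Omega a b) h)\<^sup>2 + (L2norm (Omega a b) k)\<^sup>2)"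
    by (simp only: distrib_left mult_ac)
  finally show ?thesis by (simp only: c_def)
qed

text \<open>The weight is constant on each horizontal slice and leaves both parts of the squared
  norm, and on a slice of the rectangle \<open>g\<close> coincides with its extension.\<close>

lemma H12_sq_scaled:
  assumes f: "L2x (ext g)" and z: "z \<in> {-1<..<1}"
  shows "H12_sq a b (\<lambda>x. sqrt \<bar>z\<bar> * g (x, z))
    = ennreal \<bar>z\<bar> * (\<integral>\<^sup>+x. ennreal ((ext g (x, z))\<^sup>2) \<partial>lborel) + ennreal \<bar>z\<bar> * gagliardo (\<lambda>x. ext g (x, z))"
proof -
  have m: "ext g \<in> borel_measurable (borel \<Otimes>\<^sub>M borel)" using f by (simp add: L2x_def borel_prod)
  define u where "u x = ext g (x, z)" for x
  have [measurable]: "u \<in> borel_measurable borel"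
    using measurable_compose[OF _ m, of "\<lambda>x. (x, z)" borel] by (simp add: u_def[abs_def])
  have gu: "g (x, z) = u x" if "x \<in> {a<..<b}" for x
    using that z by (simp add: u_def ext_def Omega_def)
  have u0: "u x = 0" if "x \<notin> {a<..<b}" for x
    using that by (auto simp: u_def ext_def Omega_def indicator_def)
  have "(\<integral>\<^sup>+x\<in>{a<..<b}. ennreal ((sqrt \<bar>z\<bar> * g (x, z))\<^sup>2) \<partial>lborel) = (\<integral>\<^sup>+x. ennreal \<bar>z\<bar> * ennreal ((u x)\<^sup>2) \<partial>lborel)"
  proof (rule nn_integral_cong)
    fix x show "ennreal ((sqrt \<bar>z\<bar> * g (x, z))\<^sup>2) * indicator {a<..<b} x = ennreal \<bar>z\<bar> * ennreal ((u x)\<^sup>2)"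
      using gu[of x] u0[of x] by (cases "x \<in> {a<..<b}") (simp_all add: power_mult_distrib ennreal_mult)
  qed
  also have "\<dots> = ennreal \<bar>z\<bar> * (\<integral>\<^sup>+x. ennreal ((u x)\<^sup>2) \<partial>lborel)" by (rule nn_integral_cmult) measurable
  finally have 1: "(\<integral>\<^sup>+x\<in>{a<..<b}. ennreal ((sqrt \<bar>z\<bar> * g (x, z))\<^sup>2) \<partial>lborel) = ennreal \<bar>z\<bar> * (\<integral>\<^sup>+x. ennreal ((u x)\<^sup>2) \<partial>lborel)" .
  let ?L = "\<lambda>x. \<integral>\<^sup>+y\<in>{a<..<b}. ennreal ((sqrt \<bar>z\<bar> * g (x, z) - sqrt \<bar>z\<bar> * g (y, z))\<^sup>2 / (x - y)\<^sup>2) \<partial>lborel"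
  let ?R = "\<lambda>x. \<integral>\<^sup>+y\<in>{a<..<b}. ennreal ((u x - u y)\<^sup>2 / (x - y)\<^sup>2) \<partial>lborel"
  have "(\<integral>\<^sup>+x\<in>{a<..<b}. ?L x \<partial>lborel)
      = (\<integral>\<^sup>+x. ennreal \<bar>z\<bar> * (?R x * indicator {a<..<b} x) \<partial>lborel)"
  proof (rule nn_integral_cong)
    fix x
    have "?L x
        = ennreal \<bar>z\<bar> * ?R x" if x: "x \<in> {a<..<b}"
    proof -
      have "?L x
          = (\<integral>\<^sup>+y. ennreal \<bar>z\<bar> * (ennreal ((u x - u y)\<^sup>2 / (x - y)\<^sup>2) * indicator {a<..<b} y) \<partial>lborel)"
      proof (rule nn_integral_cong)
        fix y
        have "(sqrt \<bar>z\<bar> * u x - sqrt \<bar>z\<bar> * u y)\<^sup>2 / (x - y)\<^sup>2 = \<bar>z\<bar> * ((u x - u y)\<^sup>2 / (x - y)\<^sup>2)"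
          by (simp add: power_mult_distrib flip: right_diff_distrib)
        then have "ennreal ((sqrt \<bar>z\<bar> * u x - sqrt \<bar>z\<bar> * u y)\<^sup>2 / (x - y)\<^sup>2) = ennreal \<bar>z\<bar> * ennreal ((u x - u y)\<^sup>2 / (x - y)\<^sup>2)"
          by (simp only:) (rule ennreal_mult; simp)
        then show "ennreal ((sqrt \<bar>z\<bar> * g (x, z) - sqrt \<bar>z\<bar> * g (y, z))\<^sup>2 / (x - y)\<^sup>2) * indicator {a<..<b} y
            = ennreal \<bar>z\<bar> * (ennreal ((u x - u y)\<^sup>2 / (x - y)\<^sup>2) * indicator {a<..<b} y)"
          using gu[OF x] gu[of y] by (cases "y \<in> {a<..<b}") simp_all
      qed
      also have "\<dots> = ennreal \<bar>z\<bar> * ?R x"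
        by (rule nn_integral_cmult) measurable
      finally show ?thesis .
    qed
    then show "?L x * indicator {a<..<b} x
        = ennreal \<bar>z\<bar> * (?R x * indicator {a<..<b} x)"
      by (cases "x \<in> {a<..<b}") simp_all
  qed
  also have "\<dots> = ennreal \<bar>z\<bar> * gagliardo u"
    unfolding gagliardo_def by (rule nn_integral_cmult) measurable
  finally show ?thesis unfolding H12_sq_def 1 by (simp add: u_def[abs_def])
qed

end

text \<open>The weak derivatives enter as functions \<open>g\<close>, \<open>k\<close>,
  \<open>h\<close> satisfying the defining identities. The estimate is stated for squared norms in
  the extended nonnegative reals, and finiteness for almost every z says that the slices belong to
  the fractional space.\<close>

theorem lemmaB12:
  fixes x0 x1 :: real
  assumes "x0 < x1"
  shows "\<exists>C. \<forall>\<phi> g k h.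
     L2 (Omega x0 x1) \<phi> \<and> L2 (Omega x0 x1) g \<and> L2 (Omega x0 x1) k \<and> L2 (Omega x0 x1) h \<and>
     weak_dz (Omega x0 x1) \<phi> g \<and> weak_dzz (Omega x0 x1) \<phi> k \<and> weak_zdx (Omega x0 x1) \<phi> h
     \<longrightarrow>
       (AE z in lborel. z \<in> {-1<..<1} \<longrightarrow> H12_sq x0 x1 (\<lambda>x. sqrt \<bar>z\<bar> * g (x, z)) < \<infinity>)
     \<and> (\<integral>\<^sup>+ z\<in>{-1<..<1}. H12_sq x0 x1 (\<lambda>x. sqrt \<bar>z\<bar> * g (x, z)) \<partial>lborel)
         \<le> ennreal ((C * (L2norm (Omega x0 x1) h + L2norm (Omega x0 x1) k
                          + L2norm (Omega x0 x1) g + L2norm (Omega x0 x1) \<phi>))\<^sup>2)"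
proof -
  interpret fourier_interval x0 x1 by standard (rule assms)
  define P where "P = 5 * pi\<^sup>2 * (2 / (x1 - x0))\<^sup>2 * 21000 * ((x1 - x0) / 2)"
  define Q where "Q = (1 / om)\<^sup>2"
  have PQ: "0 \<le> P" "0 \<le> Q" using assms by (auto simp: P_def Q_def)
  \<comment> \<open>In the square of \<open>C\<close> the summand 1 covers the L2 part of the norm,
    and P (1 + Q) covers the Gagliardo part.\<close>
  define C where "C = sqrt (1 + P * (1 + Q))"
  have C2: "C\<^sup>2 = 1 + P * (1 + Q)" using PQ by (simp add: C_def)
  show ?thesis
  proof (intro exI[of _ C] allI impI, goal_cases)
    case (1 \<phi> g k h)
    then have L2: "L2 (Omega x0 x1) \<phi>" "L2 (Omega x0 x1) g" "L2 (Omega x0 x1) k" "L2 (Omega x0 x1) h"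
      and weak: "weak_dz (Omega x0 x1) \<phi> g" "weak_dzz (Omega x0 x1) \<phi> k" "weak_zdx (Omega x0 x1) \<phi> h" by auto
    define N where "N f = L2norm (Omega x0 x1) f" for f
    have N0: "0 \<le> N f" for f by (simp add: N_def L2norm_def set_lebesgue_integral_def)
    have Lg: "L2x (ext g)" by (rule L2_ext(1)[OF L2(2)])
    note [measurable] = section_nn_integral_measurable[OF Lg]
    define I where "I z = (\<integral>\<^sup>+x. ennreal ((ext g (x, z))\<^sup>2) \<partial>lborel)" for z
    define J where "J z = gagliardo (\<lambda>x. ext g (x, z))" for z
    have [measurable]: "I \<in> borel_measurable borel" "J \<in> borel_measurable borel"
      unfolding I_def[abs_def] J_def[abs_def] by measurable
    let ?H = "\<lambda>z. H12_sq x0 x1 (\<lambda>x. sqrt \<bar>z\<bar> * g (x, z))"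
    define W where "W z = (ennreal \<bar>z\<bar> * I z + ennreal \<bar>z\<bar> * J z) * indicator {-1<..<1} z" for z
    have HW: "?H z * indicator {-1<..<1} z = W z" for z
      unfolding W_def I_def J_def using H12_sq_scaled[OF Lg, of z] by (cases "z \<in> {-1<..<1}") simp_all
    have [measurable]: "W \<in> borel_measurable borel" unfolding W_def[abs_def] by measurable
    \<comment> \<open>In the L2 part the weight is simply bounded by 1; only the Gagliardo part has
      to keep it.\<close>
    have "(\<integral>\<^sup>+z. W z \<partial>lborel) \<le> (\<integral>\<^sup>+z. I z + ennreal \<bar>z\<bar> * J z \<partial>lborel)"
    proof (rule nn_integral_mono)
      fix z
      show "W z \<le> I z + ennreal \<bar>z\<bar> * J z"
      proof (cases "z \<in> {-1<..<1}")
        case True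
        then have "ennreal \<bar>z\<bar> \<le> 1" by (simp add: abs_le_iff)
        then have "ennreal \<bar>z\<bar> * I z \<le> 1 * I z" by (rule mult_right_mono) simp
        then show ?thesis using True by (simp add: W_def add_right_mono)
      qed (simp add: W_def)
    qed
    also have "\<dots> = (\<integral>\<^sup>+z. I z \<partial>lborel) + (\<integral>\<^sup>+z. ennreal \<bar>z\<bar> * J z \<partial>lborel)"
      by (rule nn_integral_add) measurable
    also have "\<dots> \<le> ennreal ((N g)\<^sup>2) + ennreal (P * (Q * (N h)\<^sup>2 + (N k)\<^sup>2))"
      using L2x_nn_integral[OF Lg] weighted_gagliardo_bound[OF L2 weak] L2_ext(2)[OF L2(2)]
      by (intro add_mono) (simp_all add: I_def J_def P_def Q_def N_def)
    also have "\<dots> = ennreal ((N g)\<^sup>2 + P * (Q * (N h)\<^sup>2 + (N k)\<^sup>2))"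
      using PQ by (intro ennreal_plus[symmetric]) auto
    also have "\<dots> \<le> ennreal ((C * (N h + N k + N g + N \<phi>))\<^sup>2)"
    proof (rule ennreal_leI)
      define S where "S = (N h)\<^sup>2 + (N k)\<^sup>2 + (N g)\<^sup>2"
      have "Q * (N h)\<^sup>2 + (N k)\<^sup>2 \<le> (1 + Q) * S"
        using PQ unfolding S_def by (simp add: algebra_simps add_nonneg_nonneg)
      then have "P * (Q * (N h)\<^sup>2 + (N k)\<^sup>2) \<le> P * ((1 + Q) * S)" using PQ by (intro mult_left_mono)
      moreover have "(N g)\<^sup>2 \<le> S" by (simp add: S_def)
      ultimately have "(N g)\<^sup>2 + P * (Q * (N h)\<^sup>2 + (N k)\<^sup>2) \<le> C\<^sup>2 * S"
        unfolding C2 by (simp add: algebra_simps)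
      also have "\<dots> \<le> C\<^sup>2 * (N h + N k + N g + N \<phi>)\<^sup>2"
      proof (rule mult_left_mono)
        \<comment> \<open>The square of the sum of norms exceeds the sum of squares by nonnegative
          terms.\<close>
        have "0 \<le> N h * N k" "0 \<le> N h * N g" "0 \<le> N h * N \<phi>" "0 \<le> N k * N g" "0 \<le> N k * N \<phi>" "0 \<le> N g * N \<phi>" "0 \<le> N \<phi> * N \<phi>"
          using N0 by simp_all
        then show "S \<le> (N h + N k + N g + N \<phi>)\<^sup>2"
          unfolding S_def by (simp add: power2_eq_square algebra_simps)
      qed simp
      finally show "(N g)\<^sup>2 + P * (Q * (N h)\<^sup>2 + (N k)\<^sup>2) \<le> (C * (N h + N k + N g + N \<phi>))\<^sup>2"
        by (simp add: power_mult_distrib)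
    qed
    finally have bound: "(\<integral>\<^sup>+z. W z \<partial>lborel) \<le> ennreal ((C * (N h + N k + N g + N \<phi>))\<^sup>2)" .
    \<comment> \<open>The bound is a real number, so the integrand is finite almost
      everywhere.\<close>
    then have "AE z in lborel. W z \<noteq> \<infinity>"
      by (intro nn_integral_PInf_AE) (auto simp: top_unique)
    then have "AE z in lborel. z \<in> {-1<..<1} \<longrightarrow> ?H z < \<infinity>"
    proof eventually_elim
      case (elim z)
      then show ?case using HW[of z] by (auto simp: less_top)
    qed
    then show ?case
      using bound unfolding HW N_def by blast
  qed
qed

end
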